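(* At least $57$ of the $865$ triangulations (up to isomorphism) with exactly $10$ vertices (the minimal number) of the orientable closed surface $M_2$ of genus $2$ have polyhedral realizations in $\mathbb{R}^3$ which realize a non-trivial symmetry. More precisely, there are $57$ pairwise non-isomorphic such triangulations with polyhedral realizations, one for each, such that $46$ of these realizations possess $2$-fold rotational symmetry, $7$ possess $3$-fold rotational symmetry, $2$ realize a rotation-reflection of order $4$, and $2$ realize the dihedral group $D_2$ (the Klein four-group generated by rotations).
   Context: $M_g$ denotes the orientable closed surface of genus $g$. A triangulation of a closed connected surface $S$ is a finite two-dimensional simplicial complex $\Delta$ whose underlying space $|\Delta|$ is homeomorphic to $S$; triangulations are counted up to combinatorial (simplicial) isomorphism. The minimal number of vertices of a triangulation of $M_2$ is $10$, and there are exactly $865$ triangulations of $M_2$ with $10$ vertices, from the known enumeration. Let $V$ be the vertex set of $\Delta$. Each map $\psi\colon V\to\mathbb{R}^3$ induces a simplexwise linear map $\phi_\psi\colon|\Delta|\to\mathbb{R}^3$. Since the surface is orientable, a polyhedral realization of $\Delta$ in $\mathbb{R}^3$ is a map $\phi_\psi$ that is injective (a simplexwise linear embedding). A geometric symmetry of a polyhedral realization $\phi_\psi$ is an isometry $g$ of $\mathbb{R}^3$ that maps $\phi_\psi(|\Delta|)$ to itself and is induced by an automorphism $\alpha$ of $\Delta$, i.e. $g\circ\phi_\psi=\phi_\psi\circ|\alpha|$. The realization has $k$-fold rotational symmetry if a rotation of order $k$ about a line is a geometric symmetry of it. A rotation-reflection of order $4$ is the composition of a rotation by angle $\pi/2$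 about a line with the reflection in a plane orthogonal to that line. $D_2$ is the group of order $4$ generated by rotations of order $2$ about three mutually orthogonal axes. The four classes of the claim are disjoint ($46+7+2+2=57$), each triangulation being listed once, under the maximal symmetry found for its combinatorial type. *)

theory Defs
  imports "HOL-Analysis.Analysis"
begin

definition quotient_top :: "'a topology \<Rightarrow> ('a \<times> 'a) set \<Rightarrow> 'a set topology" where
  "quotient_top X r =
     topology (\<lambda>\<U>. \<U> \<subseteq> topspace X // r \<and> openin X (\<Union>\<U>))"

lemma openin_quotient_top:
  assumes "equiv (topspace X) r"
  shows "openin (quotient_top X r) \<U> \<longleftrightarrow> \<U> \<subseteq> topspace X // r \<and> openin X (\<Union>\<U>)"
proof -
  have int: "\<Union>(S \<inter> T) = \<Union>S \<inter> \<Union>T"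
    if "S \<subseteq> topspace X // r" "T \<subseteq> topspace X // r" for S T
  proof
    show "\<Union>S \<inter> \<Union>T \<subseteq> \<Union>(S \<inter> T)"
    proof
      fix x assume "x \<in> \<Union>S \<inter> \<Union>T"
      then obtain A B where AB: "A \<in> S" "x \<in> A" "B \<in> T" "x \<in> B" by blast
      then have "A = B"
        using quotient_disj[OF assms, of A B] that by blast
      with AB show "x \<in> \<Union>(S \<inter> T)" by blast
    qed
  qed blast
  have uni: "\<Union>(\<Union>\<K>) = \<Union>(Union ` \<K>)" for \<K> :: "'a set set set"
    by blast
  have "istopology (\<lambda>\<U>. \<U> \<subseteq> topspace X // r \<and> openin X (\<Union>\<U>))"
    unfolding istopology_def
  proof (intro conjI allI impI)
    fix S T
    assume S: "S \<subseteq> topspace X // r \<and> openin X (\<Union>S)"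
      and T: "T \<subseteq> topspace X // r \<and> openin X (\<Union>T)"
    then show "S \<inter> T \<subseteq> topspace X // r" by blast
    show "openin X (\<Union>(S \<inter> T))"
      using S T int[of S T] by (simp add: openin_Int)
  next
    fix \<K>
    assume "\<forall>K\<in>\<K>. K \<subseteq> topspace X // r \<and> openin X (\<Union>K)"
    then show "\<Union>\<K> \<subseteq> topspace X // r" and "openin X (\<Union>(\<Union>\<K>))"
      unfolding uni by (blast, blast intro: openin_Union)
  qed
  then show ?thesis
    by (simp add: quotient_top_def topology_inverse')
qed

text \<open>For \<open>g \<ge> 1\<close>, the surface \<open>M\<^sub>g\<close> is the regular \<open>4g\<close>-gon whose sides are glued according to
  the boundary word \<open>a\<^sub>1 b\<^sub>1 a\<^sub>1\<^sup>-\<^sup>1 b\<^sub>1\<^sup>-\<^sup>1 \<dots> a\<^sub>g b\<^sub>g a\<^sub>g\<^sup>-\<^sup>1 b\<^sub>g\<^sup>-\<^sup>1\<close>.\<close>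

definition corner :: "nat \<Rightarrow> nat \<Rightarrow> complex" where
  "corner g k = cis (2 * pi * real k / real (4 * g))"

definition polygon_4g :: "nat \<Rightarrow> complex set" where
  "polygon_4g g = convex hull (corner g ` {..<4 * g})"

definition side :: "nat \<Rightarrow> nat \<Rightarrow> real \<Rightarrow> complex" where
  "side g k = linepath (corner g k) (corner g (Suc k))"

inductive glued :: "nat \<Rightarrow> complex \<Rightarrow> complex \<Rightarrow> bool" for g :: nat where
  glue_a: "i < g \<Longrightarrow> 0 \<le> t \<Longrightarrow> t \<le> 1 \<Longrightarrow> glued g (side g (4 * i) t) (side g (4 * i + 2) (1 - t))"
| glue_b: "i < g \<Longrightarrow> 0 \<le> t \<Longrightarrow> t \<le> 1 \<Longrightarrow> glued g (side g (4 * i + 1) t) (side g (4 * i + 3) (1 - t))"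

definition glue_rel :: "nat \<Rightarrow> (complex \<times> complex) set" where
  "glue_rel g = {(z, w). z \<in> polygon_4g g \<and> w \<in> polygon_4g g \<and> equivclp (glued g) z w}"

definition orientable_surface :: "nat \<Rightarrow> complex set topology" where
  "orientable_surface g = quotient_top (top_of_set (polygon_4g g)) (glue_rel g)"

lemma equiv_glue_rel: "equiv (polygon_4g g) (glue_rel g)"
  by (rule equivI)
    (auto simp: glue_rel_def refl_on_def intro!: symI transI
      intro: equivclp_sym equivclp_trans)

lemma openin_orientable_surface:
  "openin (orientable_surface g) \<U> \<longleftrightarrow>
     \<U> \<subseteq> polygon_4g g // glue_rel g \<and> openin (top_of_set (polygon_4g g)) (\<Union>\<U>)"
  by (simp add: orientable_surface_def openin_quotient_top equiv_glue_rel)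

text \<open>Complexes are abstract, unlike the geometric ones of \<^theory>\<open>HOL-Analysis.Polytope\<close>.
  The empty set is not counted as a simplex.\<close>

definition abstract_complex :: "'v set set \<Rightarrow> bool" where
  "abstract_complex K \<longleftrightarrow>
     (\<forall>\<sigma>\<in>K. finite \<sigma> \<and> \<sigma> \<noteq> {}) \<and> (\<forall>\<sigma>\<in>K. \<forall>\<tau>. \<tau> \<subseteq> \<sigma> \<longrightarrow> \<tau> \<noteq> {} \<longrightarrow> \<tau> \<in> K)"

definition vertices :: "'v set set \<Rightarrow> 'v set" where
  "vertices K = \<Union>K"

definition two_dimensional :: "'v set set \<Rightarrow> bool" where
  "two_dimensional K \<longleftrightarrow> (\<forall>\<sigma>\<in>K. card \<sigma> \<le> 3) \<and> (\<exists>\<sigma>\<in>K. card \<sigma> = 3)"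

text \<open>The points of \<open>|K|\<close> are given by their barycentric coordinates.\<close>

definition geom_points :: "'v set set \<Rightarrow> ('v \<Rightarrow> real) set" where
  "geom_points K =
     {x. (\<forall>v. 0 \<le> x v) \<and> {v. x v \<noteq> 0} \<in> K \<and> (\<Sum>v\<in>vertices K. x v) = 1}"

text \<open>Since all complexes are finite, the topology of pointwise convergence of the
  coordinates is the usual one.\<close>

definition underlying_space :: "'v set set \<Rightarrow> ('v \<Rightarrow> real) topology" where
  "underlying_space K = top_of_set (geom_points K)"

definition triangulates :: "'a topology \<Rightarrow> 'v set set \<Rightarrow> bool" where
  "triangulates S K \<longleftrightarrow>
     finite K \<and> abstract_complex K \<and> two_dimensional K \<and> underlying_space K homeomorphic_space S"

definition simplicial_iso :: "('v \<Rightarrow> 'w) \<Rightarrow> 'v set set \<Rightarrow> 'w set set \<Rightarrow> bool" where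
  "simplicial_iso \<alpha> K L \<longleftrightarrow>
     bij_betw \<alpha> (vertices K) (vertices L) \<and> (\<lambda>\<sigma>. \<alpha> ` \<sigma>) ` K = L"

definition isomorphic_complexes :: "'v set set \<Rightarrow> 'w set set \<Rightarrow> bool" where
  "isomorphic_complexes K L \<longleftrightarrow> (\<exists>\<alpha>. simplicial_iso \<alpha> K L)"

definition induced_map :: "'v set set \<Rightarrow> ('v \<Rightarrow> 'w) \<Rightarrow> ('v \<Rightarrow> real) \<Rightarrow> 'w \<Rightarrow> real" where
  "induced_map K \<alpha> x = (\<lambda>w. \<Sum>v\<in>{v \<in> vertices K. \<alpha> v = w}. x v)"

definition simplexwise_linear :: "'v set set \<Rightarrow> ('v \<Rightarrow> real^3) \<Rightarrow> ('v \<Rightarrow> real) \<Rightarrow> real^3" where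
  "simplexwise_linear K \<psi> x = (\<Sum>v\<in>vertices K. x v *\<^sub>R \<psi> v)"

definition polyhedral_realization :: "'v set set \<Rightarrow> ('v \<Rightarrow> real^3) \<Rightarrow> bool" where
  "polyhedral_realization K \<psi> \<longleftrightarrow> inj_on (simplexwise_linear K \<psi>) (geom_points K)"

definition geometric_symmetries :: "'v set set \<Rightarrow> ('v \<Rightarrow> real^3) \<Rightarrow> (real^3 \<Rightarrow> real^3) set" where
  "geometric_symmetries K \<psi> =
     {g. (\<forall>x y. dist (g x) (g y) = dist x y) \<and>
         g ` (simplexwise_linear K \<psi> ` geom_points K) = simplexwise_linear K \<psi> ` geom_points K \<and>
         (\<exists>\<alpha>. simplicial_iso \<alpha> K K \<and>
              (\<forall>x\<in>geom_points K.
                 g (simplexwise_linear K \<psi> x) = simplexwise_linear K \<psi> (induced_map K \<alpha> x)))}"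

text \<open>Rodrigues' formula: the rotation by the angle \<open>\<theta>\<close> about the line through \<open>p\<close> with
  direction the unit vector \<open>u\<close>.\<close>

definition rotation_about :: "real^3 \<Rightarrow> real^3 \<Rightarrow> real \<Rightarrow> real^3 \<Rightarrow> real^3" where
  "rotation_about p u \<theta> x =
     p + cos \<theta> *\<^sub>R (x - p) + sin \<theta> *\<^sub>R cross3 u (x - p) + ((1 - cos \<theta>) * (u \<bullet> (x - p))) *\<^sub>R u"

definition reflection_in_plane :: "real^3 \<Rightarrow> real^3 \<Rightarrow> real^3 \<Rightarrow> real^3" where
  "reflection_in_plane q u x = x - (2 * (u \<bullet> (x - q))) *\<^sub>R u"

definition has_order :: "('a \<Rightarrow> 'a) \<Rightarrow> nat \<Rightarrow> bool" where
  "has_order g k \<longleftrightarrow> 0 < k \<and> g ^^ k = id \<and> (\<forall>j. 0 < j \<longrightarrow> j < k \<longrightarrow> g ^^ j \<noteq> id)"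

definition rotation_of_order :: "nat \<Rightarrow> (real^3 \<Rightarrow> real^3) \<Rightarrow> bool" where
  "rotation_of_order k g \<longleftrightarrow>
     (\<exists>p u \<theta>. norm u = 1 \<and> g = rotation_about p u \<theta>) \<and> has_order g k"

definition rotation_reflection_4 :: "(real^3 \<Rightarrow> real^3) \<Rightarrow> bool" where
  "rotation_reflection_4 g \<longleftrightarrow>
     (\<exists>p q u. norm u = 1 \<and> g = reflection_in_plane q u \<circ> rotation_about p u (pi / 2))"

text \<open>Half-turns about three mutually orthogonal axes generate a group of order 4 only if the
  axes meet in a point \<open>p\<close>; the product of any two of them is then the third.\<close>

definition dihedral_D2 :: "(real^3 \<Rightarrow> real^3) set \<Rightarrow> bool" where
  "dihedral_D2 G \<longleftrightarrow>
     (\<exists>p u v w. norm u = 1 \<and> norm v = 1 \<and> norm w = 1 \<and>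
        orthogonal u v \<and> orthogonal u w \<and> orthogonal v w \<and>
        G = {id, rotation_about p u pi, rotation_about p v pi, rotation_about p w pi})"

lemma half_turns_comp:
  assumes "norm u = 1" "norm v = 1" "norm w = 1"
    and o: "orthogonal u v" "orthogonal u w" "orthogonal v w"
  shows "rotation_about p u pi \<circ> rotation_about p v pi = rotation_about p w pi"
proof
  fix x
  define y where "y = x - p"
  have uu: "u \<bullet> u = 1" "v \<bullet> v = 1" "w \<bullet> w = 1"
    using assms(1-3) by (simp_all add: norm_eq_1)
  have uv: "u \<bullet> v = 0" "u \<bullet> w = 0" "v \<bullet> w = 0" "v \<bullet> u = 0" "w \<bullet> u = 0" "w \<bullet> v = 0"
    using o by (simp_all add: orthogonal_def inner_commute)
  have ne: "u \<noteq> v" "u \<noteq> w" "v \<noteq> w" "0 \<notin> {u, v, w}"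
    using uu uv by auto
  have ind: "independent {u, v, w}"
    by (rule pairwise_orthogonal_independent)
      (use uv ne in \<open>auto simp: pairwise_def orthogonal_def\<close>)
  have "card {u, v, w} = 3" using ne by simp
  then have span: "span {u, v, w} = (UNIV :: (real^3) set)"
    using ind by (intro subset_antisym subset_UNIV card_ge_dim_independent) simp_all
  define z where "z = y - (u \<bullet> y) *\<^sub>R u - (v \<bullet> y) *\<^sub>R v - (w \<bullet> y) *\<^sub>R w"
  have "orthogonal z z"
  proof (rule orthogonal_to_span)
    show "z \<in> span {u, v, w}" by (simp add: span)
    show "orthogonal z b" if "b \<in> {u, v, w}" for b
      using that uu uv by (auto simp: z_def orthogonal_def algebra_simps inner_commute)
  qed
  then have y: "y = (u \<bullet> y) *\<^sub>R u + (v \<bullet> y) *\<^sub>R v + (w \<bullet> y) *\<^sub>R w"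
    by (simp add: z_def orthogonal_self algebra_simps)
  have "- (- y + (2 * (v \<bullet> y)) *\<^sub>R v) + (2 * (u \<bullet> (- y + (2 * (v \<bullet> y)) *\<^sub>R v))) *\<^sub>R u
      = y - (2 * (v \<bullet> y)) *\<^sub>R v - (2 * (u \<bullet> y)) *\<^sub>R u"
    by (simp add: inner_simps uv)
  also have "\<dots> = - y + 2 *\<^sub>R (y - (u \<bullet> y) *\<^sub>R u - (v \<bullet> y) *\<^sub>R v)"
    by (simp add: algebra_simps scaleR_2)
  also have "y - (u \<bullet> y) *\<^sub>R u - (v \<bullet> y) *\<^sub>R v = (w \<bullet> y) *\<^sub>R w"
    using y by (simp add: algebra_simps)
  finally show "(rotation_about p u pi \<circ> rotation_about p v pi) x = rotation_about p w pi x"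
    by (simp add: rotation_about_def y_def algebra_simps)
qed

definition rotational_symmetry :: "nat \<Rightarrow> 'v set set \<Rightarrow> ('v \<Rightarrow> real^3) \<Rightarrow> bool" where
  "rotational_symmetry k K \<psi> \<longleftrightarrow> (\<exists>g\<in>geometric_symmetries K \<psi>. rotation_of_order k g)"

definition rotation_reflection_4_symmetry :: "'v set set \<Rightarrow> ('v \<Rightarrow> real^3) \<Rightarrow> bool" where
  "rotation_reflection_4_symmetry K \<psi> \<longleftrightarrow> (\<exists>g\<in>geometric_symmetries K \<psi>. rotation_reflection_4 g)"

definition D2_symmetry :: "'v set set \<Rightarrow> ('v \<Rightarrow> real^3) \<Rightarrow> bool" where
  "D2_symmetry K \<psi> \<longleftrightarrow> (\<exists>G. dihedral_D2 G \<and> G \<subseteq> geometric_symmetries K \<psi>)"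

end

theory Submission
  imports Defs "HOL-Library.Code_Binary_Nat"
begin

text \<open>A bistellar move does not change the underlying space up to homeomorphism, so a triangulation
  is recognised as one of the genus 2 surface by a sequence of moves from a single complex, obtained
  by gluing a triangulated octagon. All 57 triangulations lie on one path of edge flips.
  The realizations have small integer coordinates, found by a random search with the symmetry imposed.
  Injectivity holds because every pair of facets is weakly separated by a plane through three
  vertices which meets the two facets in those vertices only. A numerical invariant tells the
  triangulations apart.\<close>

section \<open>Simplicial complexes and bistellar moves\<close>

text \<open>The genus 2 surface is defined as a topological quotient of an octagon, so one bridge to
  combinatorics is unavoidable. It compares two maps out of one compact disc: onto the octagon
  followed by the gluing, and onto a simplicial complex by merging vertices with equal labels. They
  have the same fibres, so their targets are homeomorphic. The sides are cut into thirds because all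
  eight corners become one vertex, every side becomes a loop, and a simplicial loop needs three
  edges. Paying this price once suffices: bistellar moves carry the result on to the other
  complexes. An edge flip leaves the vertex set alone, so every complex on the path has the ten
  vertices of \<open>base_complex\<close>. A plane through vertices handles disjoint facets and
  facets sharing a vertex or an edge alike. The axes are placed so that every prescribed isometry is
  a signed permutation of the coordinates; it then acts on integer points, and embedding, symmetry,
  moves and invariant are all finite exact computations.\<close>

definition generated :: "'v set set \<Rightarrow> 'v set set" where
  "generated F = {\<sigma>. \<sigma> \<noteq> {} \<and> (\<exists>T\<in>F. \<sigma> \<subseteq> T)}"

lemma vertices_generated: "vertices (generated F) = \<Union>F"
proof
  show "\<Union>F \<subseteq> vertices (generated F)"
  proof
    fix v assume "v \<in> \<Union>F"
    then have "{v} \<in> generated F" by (auto simp: generated_def)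
    then show "v \<in> vertices (generated F)" by (auto simp: vertices_def)
  qed
qed (auto simp: vertices_def generated_def)

lemma abstract_complex_generated:
  assumes "\<And>T. T \<in> F \<Longrightarrow> finite T"
  shows "abstract_complex (generated F)"
  unfolding abstract_complex_def generated_def
  using assms by (auto intro: finite_subset) (meson subset_trans)

lemma finite_generated:
  assumes "finite F" "\<And>T. T \<in> F \<Longrightarrow> finite T"
  shows "finite (generated F)"
proof (rule finite_subset)
  show "generated F \<subseteq> Pow (\<Union>F)" by (auto simp: generated_def)
  show "finite (Pow (\<Union>F))" using assms by simp
qed

lemma two_dimensional_generated:
  assumes "F \<noteq> {}" "\<And>T. T \<in> F \<Longrightarrow> card T = 3"
  shows "two_dimensional (generated F)"
  unfolding two_dimensional_def
proof
  have fin: "finite T" if "T \<in> F" for T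
    using assms(2)[OF that] card.infinite by fastforce
  show "\<forall>\<sigma>\<in>generated F. card \<sigma> \<le> 3"
  proof
    fix \<sigma> assume "\<sigma> \<in> generated F"
    then obtain T where T: "T \<in> F" "\<sigma> \<subseteq> T" by (auto simp: generated_def)
    show "card \<sigma> \<le> 3" using card_mono[OF fin[OF T(1)] T(2)] assms(2)[OF T(1)] by simp
  qed
  obtain T where T: "T \<in> F" using assms(1) by blast
  then have "T \<in> generated F" using assms(2)[OF T] by (auto simp: generated_def)
  then show "\<exists>\<sigma>\<in>generated F. card \<sigma> = 3" using assms(2)[OF T] by blast
qed

text \<open>Summing over the support instead of over all vertices removes the vertex set from the
  condition. Complexes with different vertex sets become comparable, as needed for moves that create
  or delete a vertex.\<close>

lemma geom_points_generated:
  assumes "finite F" "\<And>T. T \<in> F \<Longrightarrow> finite T"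
  shows "x \<in> geom_points (generated F) \<longleftrightarrow>
    (\<forall>v. 0 \<le> x v) \<and> (\<exists>T\<in>F. {v. x v \<noteq> 0} \<subseteq> T) \<and> sum x {v. x v \<noteq> 0} = 1"
proof -
  have "sum x (\<Union>F) = sum x {v. x v \<noteq> 0}" if "T \<in> F" "{v. x v \<noteq> 0} \<subseteq> T" for T
    using that assms by (intro sum.mono_neutral_right) auto
  moreover have "{v. x v \<noteq> 0} \<noteq> {}" if "sum x {v. x v \<noteq> 0} = 1"
    using that by (metis sum.empty zero_neq_one)
  ultimately show ?thesis
    unfolding geom_points_def vertices_generated by (auto simp: generated_def)
qed

text \<open>A bistellar move replaces the join of \<open>A\<close> and \<open>\<partial>B\<close> by that of \<open>\<partial>A\<close> and \<open>B\<close>. Transferring as much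
  weight as possible from the barycentre of \<open>A\<close> to that of \<open>B\<close> is a homeomorphism, whose inverse is
  the transfer from \<open>B\<close> to \<open>A\<close>.\<close>

definition shift :: "'v set \<Rightarrow> 'v set \<Rightarrow> ('v \<Rightarrow> real) \<Rightarrow> 'v \<Rightarrow> real" where
  "shift A B x = (\<lambda>v. if v \<in> A then x v - Min (x ` A)
     else if v \<in> B then x v + Min (x ` A) * card A / card B else x v)"

lemma continuous_on_Min_coordinates:
  assumes "finite A" "A \<noteq> {}"
  shows "continuous_on S (\<lambda>x. Min (x ` A) :: real)"
  using assms
proof (induction A rule: finite_ne_induct)
  case (singleton a)
  then show ?case by (simp add: continuous_on_subset[OF continuous_on_product_coordinates])
next
  case (insert a A)
  have "continuous_on S (\<lambda>x. min (x a) (Min (x ` A)))"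
    by (intro continuous_on_min insert.IH continuous_on_subset[OF continuous_on_product_coordinates]) auto
  then show ?case using insert.hyps by simp
qed

lemma continuous_on_shift:
  assumes "finite A" "A \<noteq> {}"
  shows "continuous_on S (shift A B)"
  unfolding shift_def
proof (rule continuous_on_coordinatewise_then_product)
  fix v
  have c: "continuous_on S (\<lambda>x :: 'a \<Rightarrow> real. x v)"
    by (rule continuous_on_subset[OF continuous_on_product_coordinates]) simp
  note m = continuous_on_Min_coordinates[OF assms, of S]
  show "continuous_on S (\<lambda>x. if v \<in> A then x v - Min (x ` A)
     else if v \<in> B then x v + Min (x ` A) * card A / card B else x v)"
    by (cases "v \<in> A"; cases "v \<in> B") (auto simp: divide_inverse intro!: continuous_intros c m)
qed

text \<open>A vanishing coordinate in \<open>A\<close> makes the minimum zero, so nothing is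
  transferred. This covers the facets untouched by a move and, with the centre as that coordinate,
  the boundary of the octagon.\<close>

lemma shift_eq_self:
  assumes "finite A" "\<And>v. 0 \<le> x v" "a \<in> A" "x a = 0"
  shows "shift A B x = x"
proof -
  have "Min (x ` A) = 0"
    using assms by (intro Min_eqI) force+
  then show ?thesis by (auto simp: shift_def)
qed

text \<open>\<open>R\<close> collects the facets outside the star of \<open>A\<close>. That none of
  them contains \<open>B\<close> makes \<open>B\<close> a new face and the assumptions symmetric in
  \<open>A\<close> and \<open>B\<close>, so the inverse move is an instance of the same
  locale.\<close>

locale bistellar_move =
  fixes A B :: "'v set" and R :: "'v set set"
  assumes fin: "finite A" "finite B" "finite R" "\<And>T. T \<in> R \<Longrightarrow> finite T"
    and ne: "A \<noteq> {}" "B \<noteq> {}" and disj: "A \<inter> B = {}"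
    and no: "\<And>T. T \<in> R \<Longrightarrow> \<not> A \<subseteq> T" "\<And>T. T \<in> R \<Longrightarrow> \<not> B \<subseteq> T"
begin

definition old where "old = R \<union> (\<lambda>b. A \<union> B - {b}) ` B"
definition new where "new = R \<union> (\<lambda>a. A \<union> B - {a}) ` A"

lemma swap: "bistellar_move B A R"
  using fin ne disj no by unfold_locales auto

lemma geom_old:
  "x \<in> geom_points (generated old) \<longleftrightarrow>
    (\<forall>v. 0 \<le> x v) \<and> (\<exists>T\<in>old. {v. x v \<noteq> 0} \<subseteq> T) \<and> sum x {v. x v \<noteq> 0} = 1"
  by (rule geom_points_generated) (use fin in \<open>auto simp: old_def\<close>)

lemma geom_new:
  "x \<in> geom_points (generated new) \<longleftrightarrow>
    (\<forall>v. 0 \<le> x v) \<and> (\<exists>T\<in>new. {v. x v \<noteq> 0} \<subseteq> T) \<and> sum x {v. x v \<noteq> 0} = 1"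
  by (rule geom_points_generated) (use fin in \<open>auto simp: new_def\<close>)

text \<open>After subtracting the minimum some vertex of \<open>A\<close> carries no weight, so the
  point lies in a facet of the new join. Before the move some vertex of \<open>B\<close> carried
  none, so afterwards the minimum over \<open>B\<close> is exactly the amount received, and the
  reverse transfer gives it back.\<close>

lemma shift_maps:
  assumes x: "x \<in> geom_points (generated old)"
  shows "shift A B x \<in> geom_points (generated new)"
    and "shift B A (shift A B x) = x"
proof -
  have pos: "0 \<le> x v" for v using x geom_old by blast
  obtain T where T: "T \<in> old" "{v. x v \<noteq> 0} \<subseteq> T" and one: "sum x {v. x v \<noteq> 0} = 1"
    using x geom_old by blast
  have finT: "finite T" using T fin by (auto simp: old_def)
  define m where "m = Min (x ` A)"
  define y where "y = shift A B x"
  have m_le: "m \<le> x a" if "a \<in> A" for a using that fin by (simp add: m_def)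
  have "m \<in> x ` A" unfolding m_def using fin ne by (intro Min_in) auto
  then obtain a0 where a0: "a0 \<in> A" "x a0 = m" by blast
  have m0: "0 \<le> m" using a0 pos by metis
  have cA: "card A > 0" and cB: "card B > 0" using fin ne by (auto simp: card_gt_0_iff)
  have yA: "y v = x v - m" if "v \<in> A" for v using that by (simp add: y_def shift_def m_def)
  have yB: "y v = x v + m * card A / card B" if "v \<in> B" for v
    using that disj by (auto simp: y_def shift_def m_def)
  have yO: "y v = x v" if "v \<notin> A" "v \<notin> B" for v using that by (simp add: y_def shift_def)
  have ypos: "0 \<le> y v" for v
    using pos[of v] m_le[of v] yA[of v] yB[of v] yO[of v] m0
    by (cases "v \<in> A"; cases "v \<in> B") auto
  have supp: "\<exists>T\<in>new. {v. y v \<noteq> 0} \<subseteq> T"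
  proof (cases "T \<in> R")
    case True
    then obtain a where a: "a \<in> A" "a \<notin> T" using no by blast
    then have "x a = 0" using T by auto
    then have "y = x" unfolding y_def by (intro shift_eq_self[OF fin(1) pos a(1)])
    then show ?thesis using T True by (auto simp: new_def)
  next
    case False
    then have "T \<subseteq> A \<union> B" using T by (auto simp: old_def)
    then have "x v = 0" if "v \<notin> A \<union> B" for v using T that by auto
    then have "{v. y v \<noteq> 0} \<subseteq> A \<union> B - {a0}" using yA[OF a0(1)] a0 yO by force
    then show ?thesis using a0 by (auto simp: new_def)
  qed
  \<comment> \<open>The total weight is compared over one finite set containing both supports; the
    loss \<open>m * card A\<close> on \<open>A\<close> is the gain on \<open>B\<close>.\<close>
  define U where "U = A \<union> B \<union> T"
  have finU: "finite U" using fin finT by (simp add: U_def)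
  have split: "sum f U = sum f A + sum f B + sum f (U - A - B)" for f :: "'v \<Rightarrow> real"
  proof -
    have "A \<subseteq> U" "B \<subseteq> U - A" using disj by (auto simp: U_def)
    then show ?thesis
      using sum.subset_diff[of A U f] sum.subset_diff[of B "U - A" f] finU by simp
  qed
  have "sum y {v. y v \<noteq> 0} = sum y U"
    using finU T yO by (intro sum.mono_neutral_left) (auto simp: U_def)
  also have "\<dots> = sum y A + sum y B + sum y (U - A - B)" by (rule split)
  also have "sum y A = sum x A - m * card A"
    using yA by (simp add: sum_subtractf)
  also have "sum y B = sum x B + m * card A"
    using yB cB by (simp add: sum.distrib)
  also have "sum y (U - A - B) = sum x (U - A - B)"
    using yO by (intro sum.cong) auto
  also have "sum x A - m * card A + (sum x B + m * card A) + sum x (U - A - B)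
      = sum x A + sum x B + sum x (U - A - B)" by simp
  also have "\<dots> = sum x U" by (rule split[symmetric])
  also have "\<dots> = sum x {v. x v \<noteq> 0}"
    using finU T by (intro sum.mono_neutral_right) (auto simp: U_def)
  finally have "sum y {v. y v \<noteq> 0} = 1" using one by simp
  then show "shift A B x \<in> geom_points (generated new)"
    unfolding geom_new y_def[symmetric] using ypos supp by blast
  \<comment> \<open>Every old facet misses some vertex of \<open>B\<close>: by \<open>no\<close> for
    the facets in \<open>R\<close>, by construction for the others.\<close>
  obtain b0 where b0: "b0 \<in> B" "b0 \<notin> T"
    using T no(2) by (auto simp: old_def)
  then have "x b0 = 0" using T by auto
  have mB: "Min (y ` B) = m * card A / card B"
    using b0 yB pos \<open>x b0 = 0\<close> fin by (intro Min_eqI) force+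
  show "shift B A (shift A B x) = x"
  proof
    fix v
    show "shift B A (shift A B x) v = x v"
      unfolding y_def[symmetric] using mB yA[of v] yB[of v] yO[of v] cA cB disj
      by (cases "v \<in> A"; cases "v \<in> B") (auto simp: shift_def)
  qed
qed

lemma old_swap: "bistellar_move.old B A R = new" and new_swap: "bistellar_move.new B A R = old"
  using bistellar_move.old_def[OF swap] bistellar_move.new_def[OF swap]
  by (simp_all add: old_def new_def Un_commute)

lemma homeomorphic_maps_shift:
  "homeomorphic_maps (underlying_space (generated old)) (underlying_space (generated new))
     (shift A B) (shift B A)"
  using shift_maps bistellar_move.shift_maps[OF swap]
    continuous_on_shift[OF fin(1) ne(1)] continuous_on_shift[OF fin(2) ne(2)]
  by (auto simp: homeomorphic_maps_def underlying_space_def old_swap new_swap)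

end

definition complex_of :: "'v list list \<Rightarrow> 'v set set" where
  "complex_of F = generated (set ` set F)"

text \<open>Facets are kept as sorted lists, so \<open>sort (remove1 b (A @ B))\<close> is the
  normal form of the facet on \<open>A\<close> and \<open>B\<close> without \<open>b\<close>. The
  last two conditions say that the star of \<open>A\<close> is exactly the join of \<open>A\<close>
  with the boundary of \<open>B\<close>.\<close>

definition applicable :: "'v::linorder list \<times> 'v list \<Rightarrow> 'v list list \<Rightarrow> bool" where
  "applicable = (\<lambda>(A, B) F. A \<noteq> [] \<and> B \<noteq> [] \<and> distinct (A @ B) \<and>
     (\<forall>T\<in>set F. \<not> set B \<subseteq> set T) \<and> (\<forall>b\<in>set B. sort (remove1 b (A @ B)) \<in> set F) \<and>
     (\<forall>T\<in>set F. set A \<subseteq> set T \<longrightarrow> (\<exists>b\<in>set B. T = sort (remove1 b (A @ B)))))"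

fun apply_move :: "'v::linorder list \<times> 'v list \<Rightarrow> 'v list list \<Rightarrow> 'v list list" where
  "apply_move (A, B) F =
     filter (\<lambda>T. \<not> set A \<subseteq> set T) F @ map (\<lambda>a. sort (remove1 a (A @ B))) A"

fun moves_to :: "('v::linorder list \<times> 'v list) list \<Rightarrow> 'v list list \<Rightarrow> 'v list list \<Rightarrow> bool" where
  "moves_to [] F G \<longleftrightarrow> set F = set G"
| "moves_to (m # ms) F G \<longleftrightarrow> applicable m F \<and> moves_to ms (apply_move m F) G"

lemma homeomorphic_maps_apply_move:
  assumes "applicable (A, B) F"
  shows "homeomorphic_maps (underlying_space (complex_of F))
           (underlying_space (complex_of (apply_move (A, B) F)))
           (shift (set A) (set B)) (shift (set B) (set A))"
proof -
  define R where "R = set ` {T \<in> set F. \<not> set A \<subseteq> set T}"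
  have d: "distinct (A @ B)" "A \<noteq> []" "B \<noteq> []"
    and in_F: "\<And>b. b \<in> set B \<Longrightarrow> sort (remove1 b (A @ B)) \<in> set F"
    and F_in: "\<And>T. T \<in> set F \<Longrightarrow> set A \<subseteq> set T \<Longrightarrow> \<exists>b\<in>set B. T = sort (remove1 b (A @ B))"
    and noB: "\<And>T. T \<in> set F \<Longrightarrow> \<not> set B \<subseteq> set T"
    using assms by (auto simp: applicable_def)
  interpret bistellar_move "set A" "set B" R
    by unfold_locales (use d noB in \<open>auto simp: R_def\<close>)
  have s: "set (sort (remove1 c (A @ B))) = set A \<union> set B - {c}" for c
    using set_remove1_eq[OF d(1)] by auto
  have AB: "set A \<subseteq> set A \<union> set B - {b}" if "b \<in> set B" for b
    using that d by auto
  have "set ` {T \<in> set F. set A \<subseteq> set T} = (\<lambda>b. set A \<union> set B - {b}) ` set B" (is "?l = ?r")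
  proof
    show "?l \<subseteq> ?r" using F_in s by blast
    show "?r \<subseteq> ?l"
    proof
      fix X assume "X \<in> ?r"
      then obtain b where b: "b \<in> set B" "X = set (sort (remove1 b (A @ B)))" unfolding s by blast
      then show "X \<in> ?l" using in_F[OF b(1)] AB[OF b(1)] s by blast
    qed
  qed
  moreover have "set ` set F = R \<union> set ` {T \<in> set F. set A \<subseteq> set T}"
    by (auto simp: R_def)
  ultimately have "set ` set F = old" by (simp only: old_def)
  moreover have "set ` set (apply_move (A, B) F) = new"
    unfolding new_def using s by (simp add: image_Un image_image R_def)
  ultimately show ?thesis
    using homeomorphic_maps_shift by (simp add: complex_of_def)
qed

lemma moves_to_homeomorphic:
  assumes "moves_to ms F G"
  shows "underlying_space (complex_of F) homeomorphic_space underlying_space (complex_of G)"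
  using assms
proof (induction ms arbitrary: F)
  case Nil
  then show ?case by (simp add: complex_of_def homeomorphic_space_refl)
next
  case (Cons m ms)
  obtain A B where m: "m = (A, B)" by fastforce
  have "underlying_space (complex_of F) homeomorphic_space underlying_space (complex_of (apply_move m F))"
    using homeomorphic_maps_apply_move Cons.prems m unfolding homeomorphic_space_def by (metis moves_to.simps(2))
  then show ?case using Cons by (auto intro: homeomorphic_space_trans)
qed

text \<open>The gluing concerns only the boundary, so retriangulating the disc must leave the
  boundary pointwise fixed. When every move has \<open>z\<close> in \<open>A\<close>, a point
  without weight at \<open>z\<close> is fixed by each shift, and thereby lies in all intermediate
  complexes.\<close>

lemma moves_to_homeomorphic_fixing:
  assumes "moves_to ms F G" "\<forall>(A, B)\<in>set ms. z \<in> set A"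
  shows "\<exists>h k. homeomorphic_maps (underlying_space (complex_of F)) (underlying_space (complex_of G)) h k \<and>
           (\<forall>x\<in>geom_points (complex_of F). x z = 0 \<longrightarrow> h x = x)"
  using assms
proof (induction ms arbitrary: F)
  case Nil
  then have "homeomorphic_maps (underlying_space (complex_of F)) (underlying_space (complex_of G)) id id"
    by (simp add: complex_of_def homeomorphic_maps_id)
  then show ?case by force
next
  case (Cons m ms)
  obtain A B where m: "m = (A, B)" by fastforce
  let ?F = "apply_move m F" and ?s = "shift (set A) (set B)"
  have s: "homeomorphic_maps (underlying_space (complex_of F)) (underlying_space (complex_of ?F))
      ?s (shift (set B) (set A))"
    using homeomorphic_maps_apply_move Cons.prems m by (metis moves_to.simps(2))
  obtain h k where h: "homeomorphic_maps (underlying_space (complex_of ?F)) (underlying_space (complex_of G)) h k"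
      "\<forall>x\<in>geom_points (complex_of ?F). x z = 0 \<longrightarrow> h x = x"
    using Cons.IH[of ?F] Cons.prems by auto
  have fixed: "?s x = x" "x \<in> geom_points (complex_of ?F)"
    if "x \<in> geom_points (complex_of F)" "x z = 0" for x
  proof -
    show 1: "?s x = x"
      using that Cons.prems(2) m by (intro shift_eq_self[where a = z]) (auto simp: geom_points_def)
    have "?s x \<in> geom_points (complex_of ?F)"
      using s that by (auto simp: homeomorphic_maps_def underlying_space_def)
    then show "x \<in> geom_points (complex_of ?F)" using 1 by simp
  qed
  show ?case
    using homeomorphic_maps_compose[OF conjI[OF s h(1)]] h(2) fixed by (intro exI conjI) auto
qed

section \<open>Quotients and the regular octagon\<close>

text \<open>The coordinates range over a possibly infinite vertex type, so compactness comes from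
  Tychonoff: the complex is a closed subset of a product of unit intervals, being a finite union of
  simplices given by closed conditions.\<close>

lemma compact_geom_points_generated:
  fixes F :: "'v set set"
  assumes "finite F" "\<And>T. T \<in> F \<Longrightarrow> finite T"
  shows "compact (geom_points (generated F))"
proof -
  have coord: "continuous_on UNIV (\<lambda>x :: 'v \<Rightarrow> real. x v)" for v by simp
  have cp: "compact (PiE UNIV (\<lambda>_ :: 'v. {0..1 :: real}))"
    using compactin_PiE[of "\<lambda>_. euclidean" UNIV "\<lambda>_ :: 'v. {0..1 :: real}"]
    by (simp add: euclidean_product_topology)
  define C where "C = (\<Union>T\<in>F. (\<Inter>v. {x. 0 \<le> x v}) \<inter> (\<Inter>v\<in>- T. {x. x v = 0}) \<inter> {x. sum x T = (1 :: real)})"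
  have "closed C"
    unfolding C_def using assms(1)
    by (intro closed_UN closed_Int closed_INT ballI closed_Collect_le closed_Collect_eq
        continuous_on_sum coord continuous_on_const)
  have one: "sum x {v. x v \<noteq> 0} = sum x T" if "T \<in> F" "{v. x v \<noteq> 0} \<subseteq> T" for x :: "'v \<Rightarrow> real" and T
    using that assms by (intro sum.mono_neutral_left) auto
  have eq: "geom_points (generated F) = C"
  proof (intro set_eqI iffI)
    fix x assume "x \<in> geom_points (generated F)"
    then obtain T where "T \<in> F" "{v. x v \<noteq> 0} \<subseteq> T" "\<forall>v. 0 \<le> x v" "sum x {v. x v \<noteq> 0} = 1"
      using geom_points_generated[OF assms, of x] by blast
    then show "x \<in> C" using one[of T x] by (auto simp: C_def)
  next
    fix x assume "x \<in> C"
    then obtain T where T: "T \<in> F" "\<forall>v. 0 \<le> x v" "\<forall>v\<in>- T. x v = 0" "sum x T = 1"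
      by (auto simp: C_def)
    then have "{v. x v \<noteq> 0} \<subseteq> T" by auto
    then show "x \<in> geom_points (generated F)"
      using geom_points_generated[OF assms, of x] T one[of T x] by auto
  qed
  have "C \<subseteq> PiE UNIV (\<lambda>_. {0..1})"
  proof
    fix x assume "x \<in> C"
    then obtain T where T: "T \<in> F" "\<forall>v. 0 \<le> x v" "\<forall>v\<in>- T. x v = 0" "sum x T = 1"
      by (auto simp: C_def)
    have "x v \<le> 1" for v
      using T member_le_sum[of v T x] assms(2) by (cases "v \<in> T") auto
    then show "x \<in> PiE UNIV (\<lambda>_. {0..1})" using T by auto
  qed
  then have "compact (PiE UNIV (\<lambda>_. {0..1}) \<inter> C)"
    using cp \<open>closed C\<close> by (intro compact_Int_closed)
  then show ?thesis
    unfolding eq using \<open>C \<subseteq> _\<close> by (simp add: Int_absorb1)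
qed

text \<open>Continuous surjections from a compact onto a Hausdorff space are quotient maps. Hence
  \<open>f\<close>, and \<open>q\<close> followed by the projection to classes, are two quotient
  maps out of \<open>X\<close> with equal fibres, and each factors continuously through the
  other.\<close>

lemma homeomorphic_quotient_top:
  assumes X: "compact_space X" and Y: "Hausdorff_space Y" and Z: "Hausdorff_space Z"
    and q: "continuous_map X Y q" "q ` topspace X = topspace Y"
    and f: "continuous_map X Z f" "f ` topspace X = topspace Z"
    and r: "equiv (topspace Y) r"
    and fibres: "\<And>x y. x \<in> topspace X \<Longrightarrow> y \<in> topspace X \<Longrightarrow> f x = f y \<longleftrightarrow> (q x, q y) \<in> r"
  shows "Z homeomorphic_space quotient_top Y r"
proof -
  let ?p = "\<lambda>y. r `` {y}" and ?W = "quotient_top Y r"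
  have "openin ?W (topspace Y // r)"
    using r by (simp add: openin_quotient_top Union_quotient)
  then have top: "topspace ?W = topspace Y // r"
    using openin_subset openin_quotient_top[OF r] by (metis openin_topspace subset_antisym)
  have p: "quotient_map Y ?W ?p"
    unfolding quotient_map_def
  proof (intro conjI allI impI)
    show "?p ` topspace Y = topspace ?W" by (auto simp: top quotient_def)
    fix U assume U: "U \<subseteq> topspace ?W"
    have "{y \<in> topspace Y. ?p y \<in> U} = \<Union>U"
    proof
      show "{y \<in> topspace Y. ?p y \<in> U} \<subseteq> \<Union>U"
        using equiv_class_self[OF r] by blast
      show "\<Union>U \<subseteq> {y \<in> topspace Y. ?p y \<in> U}"
      proof
        fix y assume "y \<in> \<Union>U"
        then obtain C where C: "C \<in> U" "y \<in> C" by blast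
        then have "C \<in> topspace Y // r" using U top by auto
        then have "C = ?p y" "y \<in> topspace Y"
          using C(2) r by (metis Image_singleton_iff equiv_class_eq_iff quotientE)+
        then show "y \<in> {y \<in> topspace Y. ?p y \<in> U}" using C by simp
      qed
    qed
    then show "openin Y {y \<in> topspace Y. ?p y \<in> U} = openin ?W U"
      using U top openin_quotient_top[OF r] by auto
  qed
  have qf: "quotient_map X Z f" using continuous_imp_quotient_map[OF f(1) X Z f(2)] .
  have qq: "quotient_map X ?W (?p \<circ> q)"
    using quotient_map_compose[OF continuous_imp_quotient_map[OF q(1) X Y q(2)] p] .
  have same: "f x = f y \<longleftrightarrow> (?p \<circ> q) x = (?p \<circ> q) y" if "x \<in> topspace X" "y \<in> topspace X" for x y
    using fibres[OF that] that q(2) eq_equiv_class_iff[OF r, of "q x" "q y"] by auto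
  obtain g where g: "continuous_map Z ?W g" "\<And>x. x \<in> topspace X \<Longrightarrow> g (f x) = (?p \<circ> q) x"
    using quotient_map_lift_exists[OF qf quotient_imp_continuous_map[OF qq]] same by metis
  obtain k where k: "continuous_map ?W Z k" "\<And>x. x \<in> topspace X \<Longrightarrow> k ((?p \<circ> q) x) = f x"
    using quotient_map_lift_exists[OF qq quotient_imp_continuous_map[OF qf]] same by metis
  have "k (g z) = z" if "z \<in> topspace Z" for z
  proof -
    obtain x where "x \<in> topspace X" "z = f x" using \<open>z \<in> topspace Z\<close> f(2) by blast
    then show ?thesis using g(2) k(2) by simp
  qed
  moreover have "g (k w) = w" if "w \<in> topspace ?W" for w
  proof -
    obtain x where "x \<in> topspace X" "w = (?p \<circ> q) x"
      using \<open>w \<in> topspace ?W\<close> quotient_imp_surjective_map[OF qq] by blast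
    then show ?thesis using g(2) k(2) by simp
  qed
  ultimately show ?thesis
    using g(1) k(1) unfolding homeomorphic_space_def homeomorphic_maps_def by blast
qed

section \<open>Sector coordinates on the regular octagon\<close>

lemma cis_quarter: "cis (pi / 4) = Complex (sqrt 2 / 2) (sqrt 2 / 2)"
  by (simp add: cis.ctr cos_45 sin_45)

lemma corner_2_Suc: "corner 2 (Suc k) = corner 2 k * cis (pi / 4)"
  by (simp add: corner_def cis_mult add_divide_distrib ring_distribs add.commute)

lemma corner_2:
  "corner 2 0 = Complex 1 0" "corner 2 1 = Complex (sqrt 2 / 2) (sqrt 2 / 2)"
  "corner 2 2 = Complex 0 1" "corner 2 3 = Complex (- (sqrt 2 / 2)) (sqrt 2 / 2)"
  "corner 2 4 = Complex (- 1) 0" "corner 2 5 = Complex (- (sqrt 2 / 2)) (- (sqrt 2 / 2))"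
  "corner 2 6 = Complex 0 (- 1)" "corner 2 7 = Complex (sqrt 2 / 2) (- (sqrt 2 / 2))"
  "corner 2 8 = Complex 1 0"
proof -
  note c = corner_2_Suc[unfolded cis_quarter]
  show c0: "corner 2 0 = Complex 1 0" by (simp add: corner_def complex_eq_iff)
  show c1: "corner 2 1 = Complex (sqrt 2 / 2) (sqrt 2 / 2)"
    using c[of 0] c0 by (simp add: complex_eq_iff)
  show c2: "corner 2 2 = Complex 0 1"
    using c[of 1, unfolded Suc_1] c1 by (simp add: complex_eq_iff del: One_nat_def)
  show c3: "corner 2 3 = Complex (- (sqrt 2 / 2)) (sqrt 2 / 2)"
    using c[of 2] c2 by (simp add: complex_eq_iff)
  show c4: "corner 2 4 = Complex (- 1) 0"
    using c[of 3] c3 by (simp add: complex_eq_iff)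
  show c5: "corner 2 5 = Complex (- (sqrt 2 / 2)) (- (sqrt 2 / 2))"
    using c[of 4] c4 by (simp add: complex_eq_iff)
  show c6: "corner 2 6 = Complex 0 (- 1)"
    using c[of 5] c5 by (simp add: complex_eq_iff)
  show c7: "corner 2 7 = Complex (sqrt 2 / 2) (- (sqrt 2 / 2))"
    using c[of 6] c6 by (simp add: complex_eq_iff)
  show "corner 2 8 = Complex 1 0"
    using c[of 7] c7 by (simp add: complex_eq_iff)
qed

text \<open>With \<open>a\<close> and \<open>b\<close> nonnegative, the eight cones over the sides
  cover the plane and meet only along rays through corners. A point determines \<open>k\<close>,
  \<open>a\<close>, \<open>b\<close> up to these overlaps, and lies in the octagon when
  \<open>a + b \<le> 1\<close>.\<close>

definition sector :: "nat \<Rightarrow> real \<Rightarrow> real \<Rightarrow> complex" where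
  "sector k a b = a *\<^sub>R corner 2 k + b *\<^sub>R corner 2 (Suc k)"

lemma less_8_cases: "k < 8 \<Longrightarrow> k \<in> {0, 1, 2, 3, 4, 5, 6, 7 :: nat}"
  by auto

lemma sector_simps:
  "sector 0 a b = Complex (a + b * (sqrt 2 / 2)) (b * (sqrt 2 / 2))"
  "sector 1 a b = Complex (a * (sqrt 2 / 2)) (a * (sqrt 2 / 2) + b)"
  "sector 2 a b = Complex (- (b * (sqrt 2 / 2))) (a + b * (sqrt 2 / 2))"
  "sector 3 a b = Complex (- (a * (sqrt 2 / 2)) - b) (a * (sqrt 2 / 2))"
  "sector 4 a b = Complex (- a - b * (sqrt 2 / 2)) (- (b * (sqrt 2 / 2)))"
  "sector 5 a b = Complex (- (a * (sqrt 2 / 2))) (- (a * (sqrt 2 / 2)) - b)"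
  "sector 6 a b = Complex (b * (sqrt 2 / 2)) (- a - b * (sqrt 2 / 2))"
  "sector 7 a b = Complex (a * (sqrt 2 / 2) + b) (- (a * (sqrt 2 / 2)))"
  by (simp_all add: sector_def corner_2 complex_eq_iff flip: One_nat_def)

lemma corner_2_add: "corner 2 (j + k) = corner 2 j * corner 2 k"
  by (simp add: corner_def cis_mult add_divide_distrib ring_distribs)

lemma sector_add: "sector (j + k) a b = corner 2 j * sector k a b"
  using corner_2_add[of j k] corner_2_add[of j "Suc k"] by (simp add: sector_def ring_distribs)

text \<open>The signs of real and imaginary parts decide each of the eight cases. What survives is
  equality, a common boundary ray, or the origin.\<close>

lemma sector_0_eqD:
  assumes "j < 8" "0 \<le> a" "0 \<le> b" "0 \<le> c" "0 \<le> d"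
    and eq: "sector 0 a b = sector j c d"
  shows "j = 0 \<and> a = c \<and> b = d \<or> j = 1 \<and> a = 0 \<and> d = 0 \<and> b = c
    \<or> j = 7 \<and> c = 0 \<and> b = 0 \<and> a = d \<or> a = 0 \<and> b = 0 \<and> c = 0 \<and> d = 0"
proof -
  define s where "s = sqrt 2 / 2"
  have s: "0 < s" by (simp add: s_def)
  \<comment> \<open>Products with \<open>sqrt 2 / 2\<close> become variables of their own, so that
    each case is linear arithmetic.\<close>
  define b' c' d' where "b' = b * s" and "c' = c * s" and "d' = d * s"
  have nn: "0 \<le> b'" "0 \<le> c'" "0 \<le> d'" using s assms by (auto simp: b'_def c'_def d'_def)
  have z: "b' = 0 \<longleftrightarrow> b = 0" "c' = 0 \<longleftrightarrow> c = 0" "d' = 0 \<longleftrightarrow> d = 0"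
    "b' = c' \<longleftrightarrow> b = c" "b' = d' \<longleftrightarrow> b = d"
    using s by (auto simp: b'_def c'_def d'_def)
  note simps = sector_simps[folded s_def]
  consider "j = 0" | "j = 1" | "j = 2" | "j = 3" | "j = 4" | "j = 5" | "j = 6" | "j = 7"
    using assms(1) by linarith
  then show ?thesis
  proof cases
    case 1
    then have "a + b' = c + d'" "b' = d'" using eq by (simp_all add: simps b'_def d'_def)
    then show ?thesis using 1 z by auto
  next
    case 2
    then have "a + b' = c'" "b' = c' + d" using eq by (simp_all add: simps b'_def c'_def del: One_nat_def)
    then have "a = 0" "d = 0" "b' = c'" using assms nn by linarith+
    then show ?thesis using 2 z by auto
  next
    case 3
    then have "a + b' = - d'" "b' = c + d'" using eq by (simp_all add: simps b'_def d'_def)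
    then have "a = 0" "b' = 0" "d' = 0" "c = 0" using assms nn by linarith+
    then show ?thesis using z by auto
  next
    case 4
    then have "a + b' = - c' - d" "b' = c'" using eq by (simp_all add: simps b'_def c'_def)
    then have "a = 0" "b' = 0" "c' = 0" "d = 0" using assms nn by linarith+
    then show ?thesis using z by auto
  next
    case 5
    then have "a + b' = - c - d'" "b' = - d'" using eq by (simp_all add: simps b'_def d'_def)
    then have "a = 0" "b' = 0" "d' = 0" "c = 0" using assms nn by linarith+
    then show ?thesis using z by auto
  next
    case 6
    then have "a + b' = - c'" "b' = - c' - d" using eq by (simp_all add: simps b'_def c'_def)
    then have "a = 0" "b' = 0" "c' = 0" "d = 0" using assms nn by linarith+
    then show ?thesis using z by auto
  next
    case 7
    then have "a + b' = d'" "b' = - c - d'" using eq by (simp_all add: simps b'_def d'_def)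
    then have "a = 0" "b' = 0" "d' = 0" "c = 0" using assms nn by linarith+
    then show ?thesis using z by auto
  next
    case 8
    then have "a + b' = c' + d" "b' = - c'" using eq by (simp_all add: simps b'_def c'_def)
    then have "b' = 0" "c' = 0" "a = d" using assms nn by linarith+
    then show ?thesis using 8 z by auto
  qed
qed

text \<open>Multiplication by \<open>corner 2 k\<close> rotates the first cone onto cone
  \<open>k\<close>, which reduces the claim to \<open>sector_0_eqD\<close> with the index difference
  \<open>j\<close> taken modulo 8.\<close>

lemma sector_eqD:
  assumes "k < 8" "m < 8" "0 \<le> a" "0 \<le> b" "0 \<le> c" "0 \<le> d"
    and eq: "sector k a b = sector m c d"
  shows "k = m \<and> a = c \<and> b = d \<or> m = Suc k mod 8 \<and> a = 0 \<and> d = 0 \<and> b = c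
    \<or> k = Suc m mod 8 \<and> c = 0 \<and> b = 0 \<and> a = d \<or> a = 0 \<and> b = 0 \<and> c = 0 \<and> d = 0"
proof -
  define j where "j = (m + 8 - k) mod 8"
  have kj: "k + j = m \<or> k + j = m + 8" using assms(1,2) by (auto simp: j_def mod_if)
  have "sector (m + 8) c d = sector m c d"
    using sector_add[of 8 m c d] by (simp add: corner_2 add.commute flip: one_complex.code)
  then have "sector m c d = corner 2 k * sector j c d"
    using kj sector_add[of k j c d] by auto
  moreover have "sector k a b = corner 2 k * sector 0 a b"
    using sector_add[of k 0 a b] by simp
  moreover have "corner 2 k \<noteq> 0" by (simp add: corner_def)
  ultimately have "sector 0 a b = sector j c d" using eq by simp
  moreover have "j < 8" by (simp add: j_def)
  ultimately have "j = 0 \<and> a = c \<and> b = d \<or> j = 1 \<and> a = 0 \<and> d = 0 \<and> b = c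
    \<or> j = 7 \<and> c = 0 \<and> b = 0 \<and> a = d \<or> a = 0 \<and> b = 0 \<and> c = 0 \<and> d = 0"
    using sector_0_eqD[of j a b c d] assms(3-6) by blast
  then consider "j = 0" "a = c" "b = d" | "j = 1" "a = 0" "d = 0" "b = c"
    | "j = 7" "c = 0" "b = 0" "a = d" | "a = 0" "b = 0" "c = 0" "d = 0" by blast
  then show ?thesis
  proof cases
    case 1
    then have "k = m" using kj assms(1,2) by auto
    then show ?thesis using 1 by blast
  next
    case 2
    then have "m = Suc k mod 8" using kj assms(1,2) by (auto simp: mod_if)
    then show ?thesis using 2 by blast
  next
    case 3
    then have "k = Suc m mod 8" using kj assms(1,2) by (auto simp: mod_if)
    then show ?thesis using 3 by blast
  qed blast
qed

text \<open>The cones are bounded by the axes and the diagonals, so the cases compare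
  \<open>x\<close>, \<open>y\<close> and their negatives; the witnesses solve the linear equations
  in \<open>sector_simps\<close>.\<close>

lemma ex_sector: "\<exists>k a b. k < 8 \<and> 0 \<le> a \<and> 0 \<le> b \<and> z = sector k a b"
proof -
  define x y where "x = Re z" and "y = Im z"
  have z: "z = Complex x y" by (simp add: x_def y_def)
  have r: "u * sqrt 2 * (sqrt 2 / 2) = u" for u by simp
  consider "0 \<le> y" "y \<le> x" | "0 \<le> x" "x \<le> y" | "x \<le> 0" "- x \<le> y" | "0 \<le> y" "y \<le> - x"
    | "y \<le> 0" "x \<le> y" | "x \<le> 0" "y \<le> x" | "0 \<le> x" "x \<le> - y" | "y \<le> 0" "- y \<le> x"
    by linarith
  then show ?thesis
  proof cases
    case 1 then show ?thesis
      by - (rule exI[of _ "0 :: nat"], rule exI[of _ "x - y"], rule exI[of _ "y * sqrt 2"], simp add: z sector_simps r mult_nonpos_nonneg)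
  next
    case 2 then show ?thesis
      by - (rule exI[of _ "1 :: nat"], rule exI[of _ "x * sqrt 2"], rule exI[of _ "y - x"], simp add: z sector_simps r del: One_nat_def)
  next
    case 3 then show ?thesis
      by - (rule exI[of _ "2 :: nat"], rule exI[of _ "y + x"], rule exI[of _ "- x * sqrt 2"], simp add: z sector_simps r mult_nonpos_nonneg)
  next
    case 4 then show ?thesis
      by - (rule exI[of _ "3 :: nat"], rule exI[of _ "y * sqrt 2"], rule exI[of _ "- x - y"], simp add: z sector_simps r mult_nonpos_nonneg)
  next
    case 5 then show ?thesis
      by - (rule exI[of _ "4 :: nat"], rule exI[of _ "y - x"], rule exI[of _ "- y * sqrt 2"], simp add: z sector_simps r mult_nonpos_nonneg)
  next
    case 6 then show ?thesis
      by - (rule exI[of _ "5 :: nat"], rule exI[of _ "- x * sqrt 2"], rule exI[of _ "x - y"], simp add: z sector_simps r mult_nonpos_nonneg)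
  next
    case 7 then show ?thesis
      by - (rule exI[of _ "6 :: nat"], rule exI[of _ "- y - x"], rule exI[of _ "x * sqrt 2"], simp add: z sector_simps r mult_nonpos_nonneg)
  next
    case 8 then show ?thesis
      by - (rule exI[of _ "7 :: nat"], rule exI[of _ "- y * sqrt 2"], rule exI[of _ "x + y"], simp add: z sector_simps r mult_nonpos_nonneg)
  qed
qed

text \<open>The sum of two consecutive corners is an outward normal of the side between them, and
  \<open>1 + sqrt 2 / 2\<close>, one plus the cosine of \<open>pi / 4\<close>, is the value it takes
  on that side.\<close>

lemma inner_corners_le:
  assumes "k < 8" "j < 8"
  shows "(corner 2 k + corner 2 (Suc k)) \<bullet> corner 2 j \<le> 1 + sqrt 2 / 2"
proof -
  have s: "0 \<le> sqrt 2" "1 \<le> sqrt 2" "sqrt 2 * sqrt 2 = (2 :: real)" by simp_all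
  from assms show ?thesis
    by (auto dest!: less_8_cases simp: corner_2 inner_complex_def simp flip: One_nat_def)
       (use s in \<open>simp_all add: field_simps\<close>)
qed

lemma inner_sector:
  assumes "k < 8"
  shows "(corner 2 k + corner 2 (Suc k)) \<bullet> sector k a b = (a + b) * (1 + sqrt 2 / 2)"
proof -
  have s: "sqrt 2 * sqrt 2 = (2 :: real)" by simp
  from assms show ?thesis
    by (auto dest!: less_8_cases simp: corner_2 sector_simps inner_complex_def simp flip: One_nat_def)
      (use s in \<open>simp_all add: field_simps\<close>)
qed

lemma polygon_8:
  "polygon_4g 2 = {sector k a b | k a b. k < 8 \<and> 0 \<le> a \<and> 0 \<le> b \<and> a + b \<le> 1}" (is "?P = ?S")
proof
  show "?P \<subseteq> ?S"
  proof
    fix z assume z: "z \<in> ?P"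
    obtain k a b where k: "k < 8" "0 \<le> a" "0 \<le> b" "z = sector k a b" using ex_sector by metis
    let ?c = "corner 2 k + corner 2 (Suc k)"
    have "?P \<subseteq> {w. ?c \<bullet> w \<le> 1 + sqrt 2 / 2}"
      unfolding polygon_4g_def using inner_corners_le[OF k(1)]
      by (intro hull_minimal convex_halfspace_le) auto
    then have "(a + b) * (1 + sqrt 2 / 2) \<le> 1 * (1 + sqrt 2 / 2)"
      using z inner_sector[OF k(1)] k(4) by auto
    then have "a + b \<le> 1"
      by (rule mult_right_le_imp_le) (simp add: add_pos_nonneg)
    then show "z \<in> ?S" using k by blast
  qed
  show "?S \<subseteq> ?P"
  proof
    fix z assume "z \<in> ?S"
    then obtain k a b where k: "k < 8" "0 \<le> a" "0 \<le> b" "a + b \<le> 1" "z = sector k a b" by blast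
    have c: "corner 2 j \<in> ?P" if "j < 8" for j
      using that by (auto simp: polygon_4g_def intro!: hull_inc)
    have cS: "corner 2 (Suc k) \<in> ?P"
    proof (cases "k = 7")
      case True
      then show ?thesis using c[of 0] by (simp add: corner_2)
    next
      case False
      then show ?thesis using c[of "Suc k"] k(1) by simp
    qed
    have conv: "convex ?P" by (simp add: polygon_4g_def)
    \<comment> \<open>The centre belongs to the octagon as the midpoint of two opposite
      corners.\<close>
    have "(1 / 2) *\<^sub>R corner 2 0 + (1 / 2) *\<^sub>R corner 2 4 \<in> ?P"
      using c by (intro convexD[OF conv]) auto
    moreover have "(1 / 2) *\<^sub>R corner 2 0 + (1 / 2) *\<^sub>R corner 2 4 = 0"
      by (simp add: corner_2 complex_eq_iff)
    ultimately have "0 \<in> ?P" by simp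
    then have "{0, corner 2 k, corner 2 (Suc k)} \<subseteq> ?P" using c k(1) cS by simp
    then have "convex hull {0, corner 2 k, corner 2 (Suc k)} \<subseteq> ?P"
      using conv by (intro hull_minimal)
    moreover have "z \<in> convex hull {0, corner 2 k, corner 2 (Suc k)}"
      unfolding convex_hull_3 mem_Collect_eq using k
      by - (rule exI[of _ "1 - a - b"], rule exI[of _ a], rule exI[of _ b], simp add: sector_def)
    ultimately show "z \<in> ?P" by blast
  qed
qed

lemma side_2: "side 2 k t = sector k (1 - t) t"
  by (simp add: side_def sector_def linepath_def)

section \<open>The octagon as a cone over its subdivided boundary\<close>

lemma complex_of_geom:
  "x \<in> geom_points (complex_of F) \<longleftrightarrow>
    (\<forall>v. 0 \<le> x v) \<and> (\<exists>T\<in>set F. {v. x v \<noteq> 0} \<subseteq> set T) \<and> sum x {v. x v \<noteq> 0} = 1"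
  unfolding complex_of_def by (subst geom_points_generated) auto

lemma complex_of_geomI:
  assumes "\<And>v. 0 \<le> x v" "T \<in> set F" "{v. x v \<noteq> 0} \<subseteq> set T" "sum x (set T) = 1"
  shows "x \<in> geom_points (complex_of F)"
proof -
  have "sum x {v. x v \<noteq> 0} = sum x (set T)"
    using assms(3) by (intro sum.mono_neutral_left) auto
  then show ?thesis unfolding complex_of_geom using assms by auto
qed

lemma complex_of_geomE:
  assumes "x \<in> geom_points (complex_of F)"
  obtains T where "T \<in> set F" "{v. x v \<noteq> 0} \<subseteq> set T" "sum x (set T) = 1"
proof -
  obtain T where T: "T \<in> set F" "{v. x v \<noteq> 0} \<subseteq> set T" "sum x {v. x v \<noteq> 0} = 1"
    using assms unfolding complex_of_geom by blast
  have "sum x {v. x v \<noteq> 0} = sum x (set T)"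
    using T(2) by (intro sum.mono_neutral_left) auto
  then show ?thesis using T that by metis
qed

text \<open>Vertex \<open>3 * k\<close> is corner \<open>k\<close> of the octagon, the other vertices below \<open>24\<close> divide the sides
  into thirds, and \<open>24\<close> is the centre.\<close>

definition disc :: "nat list list" where
  "disc = map (\<lambda>i. [i, Suc i, 24]) [0..<23] @ [[0, 23, 24]]"

definition next_corner :: "nat \<Rightarrow> nat" where "next_corner k = (3 * k + 3) mod 24"

lemma next_corner: "k < 8 \<Longrightarrow> next_corner k < 24" "k < 8 \<Longrightarrow> next_corner k \<noteq> 3 * k" "k < 8 \<Longrightarrow> next_corner k \<noteq> Suc (3 * k)"
  "k < 8 \<Longrightarrow> next_corner k \<noteq> Suc (Suc (3 * k))"
  by (auto simp: next_corner_def mod_if)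

lemma disc_facetsE:
  assumes "T \<in> set disc"
  obtains k where "k < 8" "set T = {3 * k, Suc (3 * k), 24} \<or> set T = {Suc (3 * k), Suc (Suc (3 * k)), 24}
    \<or> set T = {Suc (Suc (3 * k)), next_corner k, 24}"
proof -
  have "\<exists>i<24. set T = {i, Suc i mod 24, 24}"
  proof (cases "T = [0, 23, 24]")
    case True
    then show ?thesis by (intro exI[of _ 23]) auto
  next
    case False
    then obtain i where "i < 23" "T = [i, Suc i, 24]" using assms by (auto simp: disc_def)
    then show ?thesis by (intro exI[of _ i]) auto
  qed
  then obtain i where i: "i < 24" "set T = {i, Suc i mod 24, 24}" by blast
  let ?k = "i div 3"
  have k: "?k < 8" using i(1) by auto
  consider "i = 3 * ?k" | "i = Suc (3 * ?k)" | "i = Suc (Suc (3 * ?k))"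
    using mult_div_mod_eq[of 3 i] by (metis (no_types) add.commute add_0 mod_less_divisor plus_1_eq_Suc One_nat_def numeral_3_eq_3 less_Suc_eq less_Suc0 zero_less_Suc add_Suc)
  then show ?thesis
  proof cases
    case 1
    then have "Suc i mod 24 = Suc (3 * ?k)" using k by auto
    then show ?thesis using that[OF k] i 1 by auto
  next
    case 2
    then have "Suc i mod 24 = Suc (Suc (3 * ?k))" using k by auto
    then show ?thesis using that[OF k] i 2 by auto
  next
    case 3
    then have "Suc i = 3 * ?k + 3" by linarith
    then have "Suc i mod 24 = next_corner ?k" by (simp only: next_corner_def)
    then show ?thesis using that[OF k] i 3 by auto
  qed
qed

lemma disc_facetsI:
  assumes "k < 8"
  shows "\<exists>T\<in>set disc. set T = {3 * k, Suc (3 * k), 24}"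
    and "\<exists>T\<in>set disc. set T = {Suc (3 * k), Suc (Suc (3 * k)), 24}"
    and "\<exists>T\<in>set disc. set T = {Suc (Suc (3 * k)), next_corner k, 24}"
proof -
  have i: "[i, Suc i, 24] \<in> set disc" if "i < 23" for i using that by (auto simp: disc_def)
  show "\<exists>T\<in>set disc. set T = {3 * k, Suc (3 * k), 24}"
    using i[of "3 * k"] assms by (intro bexI[of _ "[3 * k, Suc (3 * k), 24]"]) auto
  show "\<exists>T\<in>set disc. set T = {Suc (3 * k), Suc (Suc (3 * k)), 24}"
    using i[of "Suc (3 * k)"] assms by (intro bexI[of _ "[Suc (3 * k), Suc (Suc (3 * k)), 24]"]) auto
  show "\<exists>T\<in>set disc. set T = {Suc (Suc (3 * k)), next_corner k, 24}"
  proof (cases "k = 7")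
    case True
    then show ?thesis by (intro bexI[of _ "[0, 23, 24]"]) (auto simp: disc_def next_corner_def)
  next
    case False
    then have "next_corner k = Suc (Suc (Suc (3 * k)))" using assms by (simp add: next_corner_def)
    then show ?thesis
      using i[of "Suc (Suc (3 * k))"] assms False
      by (intro bexI[of _ "[Suc (Suc (3 * k)), next_corner k, 24]"]) auto
  qed
qed

text \<open>The barycentric coordinates of the point \<open>sector k a b\<close> with respect to the cone over the
  octagon boundary with every side divided into three parts.\<close>

definition fan :: "nat \<Rightarrow> real \<Rightarrow> real \<Rightarrow> nat \<Rightarrow> real" where
  "fan k a b = (\<lambda>v. if v = 24 then 1 - a - b
     else if v = 3 * k then max 0 (a - 2 * b)
     else if v = Suc (3 * k) then max 0 (min (3 * b) (2 * a - b))
     else if v = Suc (Suc (3 * k)) then max 0 (min (3 * a) (2 * b - a))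
     else if v = next_corner k then max 0 (b - 2 * a) else 0)"

text \<open>The ray from the centre meets the side in its first, middle or last third according to
  the ratio of \<open>a\<close> and \<open>b\<close>. In each case two neighbouring boundary
  vertices share the weight \<open>a + b\<close> and the centre keeps the rest.\<close>

lemma fan_in_disc:
  assumes k: "k < 8" and ab: "0 \<le> a" "0 \<le> b" "a + b \<le> 1"
  shows "fan k a b \<in> geom_points (complex_of disc)"
proof -
  have pos: "0 \<le> fan k a b v" for v using ab by (auto simp: fan_def)
  have *: ?thesis if T: "T \<in> set disc" "set T = {p, q, 24}" and "p \<noteq> q" "p \<noteq> 24" "q \<noteq> 24"
    and z: "\<And>v. v \<notin> {p, q, 24} \<Longrightarrow> fan k a b v = 0"
    and s: "fan k a b p + fan k a b q = a + b" for T p q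
  proof (rule complex_of_geomI[OF pos T(1)])
    show "{v. fan k a b v \<noteq> 0} \<subseteq> set T" using T z by auto
    have "fan k a b 24 = 1 - a - b" by (simp add: fan_def)
    then show "sum (fan k a b) (set T) = 1" using T that(3-5) s by simp
  qed
  note n = next_corner[OF k]
  consider "2 * b \<le> a" | "a \<le> 2 * b" "b \<le> 2 * a" | "2 * a \<le> b" by linarith
  then show ?thesis
  proof cases
    case 1
    obtain T where T: "T \<in> set disc" "set T = {3 * k, Suc (3 * k), 24}" using disc_facetsI(1)[OF k] by blast
    show ?thesis by (rule *[OF T]) (use 1 k ab n in \<open>auto simp: fan_def\<close>)
  next
    case 2
    obtain T where T: "T \<in> set disc" "set T = {Suc (3 * k), Suc (Suc (3 * k)), 24}"
      using disc_facetsI(2)[OF k] by blast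
    show ?thesis by (rule *[OF T]) (use 2 k ab n in \<open>auto simp: fan_def\<close>)
  next
    case 3
    obtain T where T: "T \<in> set disc" "set T = {Suc (Suc (3 * k)), next_corner k, 24}"
      using disc_facetsI(3)[OF k] by blast
    show ?thesis by (rule *[OF T]) (use 3 k ab n in \<open>auto simp: fan_def\<close>)
  qed
qed

text \<open>This inverts \<open>fan\<close>: the division points of side \<open>k\<close> have
  sector coordinates \<open>(2/3, 1/3)\<close> and \<open>(1/3, 2/3)\<close>, and the
  correspondingly weighted sums are the witnesses for \<open>a\<close> and \<open>b\<close> in each
  of the three kinds of facets.\<close>

lemma disc_fanE:
  assumes x: "x \<in> geom_points (complex_of disc)"
  obtains k a b where "k < 8" "0 \<le> a" "0 \<le> b" "a + b \<le> 1" "x = fan k a b"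
proof -
  have pos: "0 \<le> x v" for v using x unfolding complex_of_geom by blast
  obtain T where T: "T \<in> set disc" "{v. x v \<noteq> 0} \<subseteq> set T" "sum x (set T) = 1"
    using complex_of_geomE[OF x] by metis
  have z: "x v = 0" if "v \<notin> set T" for v using T(2) that by auto
  obtain k where k: "k < 8" and c: "set T = {3 * k, Suc (3 * k), 24}
      \<or> set T = {Suc (3 * k), Suc (Suc (3 * k)), 24} \<or> set T = {Suc (Suc (3 * k)), next_corner k, 24}"
    using disc_facetsE[OF T(1)] by metis
  note n = next_corner[OF k]
  from c show ?thesis
  proof (elim disjE)
    assume s: "set T = {3 * k, Suc (3 * k), 24}"
    let ?p = "x (3 * k)" and ?q = "x (Suc (3 * k))"
    have t: "x 24 = 1 - ?p - ?q" using T(3) k by (simp add: s)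
    show ?thesis
    proof (rule that[OF k, of "?p + 2 * ?q / 3" "?q / 3"])
      show "x = fan k (?p + 2 * ?q / 3) (?q / 3)"
        using z n k pos[of "3 * k"] pos[of "Suc (3 * k)"] t by (auto simp: fan_def s)
    qed (use pos[of "3 * k"] pos[of "Suc (3 * k)"] pos[of 24] t in auto)
  next
    assume s: "set T = {Suc (3 * k), Suc (Suc (3 * k)), 24}"
    let ?p = "x (Suc (3 * k))" and ?q = "x (Suc (Suc (3 * k)))"
    have t: "x 24 = 1 - ?p - ?q" using T(3) k by (simp add: s)
    show ?thesis
    proof (rule that[OF k, of "(2 * ?p + ?q) / 3" "(?p + 2 * ?q) / 3"])
      show "x = fan k ((2 * ?p + ?q) / 3) ((?p + 2 * ?q) / 3)"
      proof
        fix v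
        have "?p + 2 * ?q - 2 * (2 * ?p + ?q) \<le> 0" "(2 * ?p + ?q) - 2 * (?p + 2 * ?q) \<le> 0"
          "min (?p + 2 * ?q) ?p = ?p" "min (2 * ?p + ?q) ?q = ?q"
          using pos[of "Suc (3 * k)"] pos[of "Suc (Suc (3 * k))"] by simp_all
        then have "fan k ((2 * ?p + ?q) / 3) ((?p + 2 * ?q) / 3) v = (if v = 24 then 1 - ?p - ?q
            else if v = Suc (3 * k) then ?p else if v = Suc (Suc (3 * k)) then ?q else 0)"
          using pos[of "Suc (3 * k)"] pos[of "Suc (Suc (3 * k))"]
          by (simp add: fan_def field_simps)
        then show "x v = fan k ((2 * ?p + ?q) / 3) ((?p + 2 * ?q) / 3) v"
          using z[of v] t s by auto
      qed
    qed (use pos[of "Suc (3 * k)"] pos[of "Suc (Suc (3 * k))"] pos[of 24] t in \<open>auto simp: field_simps\<close>)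
  next
    assume s: "set T = {Suc (Suc (3 * k)), next_corner k, 24}"
    let ?p = "x (Suc (Suc (3 * k)))" and ?q = "x (next_corner k)"
    have t: "x 24 = 1 - ?p - ?q" using T(3) k n by (simp add: s)
    show ?thesis
    proof (rule that[OF k, of "?p / 3" "2 * ?p / 3 + ?q"])
      show "x = fan k (?p / 3) (2 * ?p / 3 + ?q)"
        using z n k pos[of "Suc (Suc (3 * k))"] pos[of "next_corner k"] t by (auto simp: fan_def s)
    qed (use pos[of "Suc (Suc (3 * k))"] pos[of "next_corner k"] pos[of 24] t in auto)
  qed
qed

definition disc_point :: "nat \<Rightarrow> complex" where
  "disc_point v = (if v < 24 then side 2 (v div 3) (real (v mod 3) / 3) else 0)"

text \<open>The linear extension of the vertex positions. The centre sits at the origin and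
  contributes nothing, so the sum omits vertex 24.\<close>

definition disc_map :: "(nat \<Rightarrow> real) \<Rightarrow> complex" where
  "disc_map x = (\<Sum>v<24. x v *\<^sub>R disc_point v)"

lemma disc_point_simps:
  assumes "k < 8"
  shows "disc_point (3 * k) = sector k 1 0" "disc_point (Suc (3 * k)) = sector k (2 / 3) (1 / 3)"
    "disc_point (Suc (Suc (3 * k))) = sector k (1 / 3) (2 / 3)" "disc_point (next_corner k) = sector k 0 1"
proof -
  have d: "Suc (3 * k) div 3 = k" "Suc (Suc (3 * k)) div 3 = k" "Suc (3 * k) mod 3 = 1"
    "Suc (Suc (3 * k)) mod 3 = 2" by presburger+
  show "disc_point (3 * k) = sector k 1 0" "disc_point (Suc (3 * k)) = sector k (2 / 3) (1 / 3)"
    "disc_point (Suc (Suc (3 * k))) = sector k (1 / 3) (2 / 3)"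
    using assms d by (simp_all add: disc_point_def side_2)
  show "disc_point (next_corner k) = sector k 0 1"
  proof (cases "k = 7")
    case True
    then show ?thesis by (simp add: disc_point_def next_corner_def side_2 sector_def corner_2)
  next
    case False
    then have "next_corner k = 3 * Suc k" "Suc k < 8" using assms by (auto simp: next_corner_def)
    then show ?thesis by (simp add: disc_point_def side_2 sector_def)
  qed
qed

lemma sum_4:
  assumes "finite U" "{p, q, r, s} \<subseteq> U" "distinct [p, q, r, s]" "\<And>v. v \<in> U - {p, q, r, s} \<Longrightarrow> f v = 0"
  shows "sum f U = f p + f q + f r + f s"
proof -
  have "sum f U = sum f {p, q, r, s}" using assms by (intro sum.mono_neutral_right) auto
  then show ?thesis using assms(3) by (simp add: add.assoc)
qed

lemma fan_values:
  assumes "k < 8"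
  shows "fan k a b (3 * k) = max 0 (a - 2 * b)" "fan k a b (Suc (3 * k)) = max 0 (min (3 * b) (2 * a - b))"
    "fan k a b (Suc (Suc (3 * k))) = max 0 (min (3 * a) (2 * b - a))"
    "fan k a b (next_corner k) = max 0 (b - 2 * a)"
    "v \<noteq> 24 \<Longrightarrow> v \<notin> {3 * k, Suc (3 * k), Suc (Suc (3 * k)), next_corner k} \<Longrightarrow> fan k a b v = 0"
    "fan k a b 24 = 1 - a - b"
  using assms next_corner[OF assms] by (auto simp: fan_def)

lemma sector_linear:
  "r *\<^sub>R sector k a b = sector k (r * a) (r * b)"
  "sector k a b + sector k c d = sector k (a + c) (b + d)"
  by (simp_all add: sector_def algebra_simps)

lemma disc_map_fan:
  assumes k: "k < 8" and ab: "0 \<le> a" "0 \<le> b"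
  shows "disc_map (fan k a b) = sector k a b"
proof -
  have "disc_map (fan k a b) = fan k a b (3 * k) *\<^sub>R disc_point (3 * k)
      + fan k a b (Suc (3 * k)) *\<^sub>R disc_point (Suc (3 * k))
      + fan k a b (Suc (Suc (3 * k))) *\<^sub>R disc_point (Suc (Suc (3 * k)))
      + fan k a b (next_corner k) *\<^sub>R disc_point (next_corner k)"
    unfolding disc_map_def
    by (rule sum_4) (use k next_corner[OF k] fan_values(5)[OF k] in auto)
  also have "\<dots> = sector k a b"
  proof -
    consider "2 * b \<le> a" | "a \<le> 2 * b" "b \<le> 2 * a" | "2 * a \<le> b" by linarith
    then show ?thesis
    proof cases
      case 1
      then have "max 0 (a - 2 * b) = a - 2 * b" "max 0 (min (3 * b) (2 * a - b)) = 3 * b"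
        "max 0 (min (3 * a) (2 * b - a)) = 0" "max 0 (b - 2 * a) = 0" using ab by auto
      then show ?thesis
        unfolding fan_values(1-4)[OF k] disc_point_simps[OF k]
        by (simp add: sector_linear)
    next
      case 2
      then have "max 0 (a - 2 * b) = 0" "max 0 (min (3 * b) (2 * a - b)) = 2 * a - b"
        "max 0 (min (3 * a) (2 * b - a)) = 2 * b - a" "max 0 (b - 2 * a) = 0" using ab by auto
      then show ?thesis
        unfolding fan_values(1-4)[OF k] disc_point_simps[OF k]
        by (simp add: sector_linear) (rule arg_cong2[where f = "sector k"]; simp add: field_simps)
    next
      case 3
      then have "max 0 (a - 2 * b) = 0" "max 0 (min (3 * b) (2 * a - b)) = 0"
        "max 0 (min (3 * a) (2 * b - a)) = 3 * a" "max 0 (b - 2 * a) = b - 2 * a" using ab by auto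
      then show ?thesis
        unfolding fan_values(1-4)[OF k] disc_point_simps[OF k]
        by (simp add: sector_linear)
    qed
  qed
  finally show ?thesis .
qed

text \<open>On the ray shared by two consecutive sectors both descriptions give the same barycentric
  coordinates. This absorbs the ambiguity left by \<open>sector_eqD\<close> when
  \<open>disc_map\<close> is shown to be injective.\<close>

lemma fan_next: "k < 8 \<Longrightarrow> 0 \<le> b \<Longrightarrow> fan k 0 b = fan (Suc k mod 8) b 0"
proof -
  assume k: "k < 8" and b: "0 \<le> b"
  have "fan k 0 b = (\<lambda>v. if v = 24 then 1 - b else if v = next_corner k then b else 0)"
    using next_corner[OF k] b by (auto simp: fan_def)
  moreover have "fan (Suc k mod 8) b 0 = (\<lambda>v. if v = 24 then 1 - b else if v = 3 * (Suc k mod 8) then b else 0)"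
    using b by (auto simp: fan_def)
  moreover have "3 * (Suc k mod 8) = next_corner k"
    using k by (auto simp: next_corner_def mod_if)
  ultimately show ?thesis by (simp only:)
qed

lemma inj_on_disc_map: "inj_on disc_map (geom_points (complex_of disc))"
proof (rule inj_onI)
  fix x y assume x: "x \<in> geom_points (complex_of disc)" and y: "y \<in> geom_points (complex_of disc)"
    and eq: "disc_map x = disc_map y"
  obtain k a b where k: "k < 8" "0 \<le> a" "0 \<le> b" "x = fan k a b" using disc_fanE[OF x] by metis
  obtain m c d where m: "m < 8" "0 \<le> c" "0 \<le> d" "y = fan m c d" using disc_fanE[OF y] by metis
  have "sector k a b = sector m c d"
    using eq k m by (simp add: disc_map_fan)
  then have "k = m \<and> a = c \<and> b = d \<or> m = Suc k mod 8 \<and> a = 0 \<and> d = 0 \<and> b = c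
    \<or> k = Suc m mod 8 \<and> c = 0 \<and> b = 0 \<and> a = d \<or> a = 0 \<and> b = 0 \<and> c = 0 \<and> d = 0"
    by (rule sector_eqD[OF k(1) m(1) k(2,3) m(2,3)])
  then show "x = y"
  proof (elim disjE conjE)
    assume "a = 0" "b = 0" "c = 0" "d = 0"
    moreover have "fan j 0 0 = (\<lambda>v. if v = 24 then 1 else 0)" for j
      by (simp add: fan_def fun_eq_iff)
    ultimately show ?thesis using k(4) m(4) by simp
  next
    assume "m = Suc k mod 8" "a = 0" "d = 0" "b = c"
    then show ?thesis using fan_next[OF k(1,3)] k(4) m(4) by simp
  next
    assume "k = Suc m mod 8" "c = 0" "b = 0" "a = d"
    then show ?thesis using fan_next[OF m(1,3)] k(4) m(4) by simp
  next
    assume "k = m" "a = c" "b = d"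
    then show ?thesis using k(4) m(4) by simp
  qed
qed

lemma disc_map_image: "disc_map ` geom_points (complex_of disc) = polygon_4g 2"
proof
  show "disc_map ` geom_points (complex_of disc) \<subseteq> polygon_4g 2"
  proof (rule image_subsetI)
    fix x assume "x \<in> geom_points (complex_of disc)"
    then obtain k a b where "k < 8" "0 \<le> a" "0 \<le> b" "a + b \<le> 1" "x = fan k a b"
      using disc_fanE by metis
    then show "disc_map x \<in> polygon_4g 2" unfolding polygon_8 using disc_map_fan by blast
  qed
  show "polygon_4g 2 \<subseteq> disc_map ` geom_points (complex_of disc)"
  proof
    fix z assume "z \<in> polygon_4g 2"
    then obtain k a b where "k < 8" "0 \<le> a" "0 \<le> b" "a + b \<le> 1" "z = sector k a b"
      unfolding polygon_8 by blast
    then show "z \<in> disc_map ` geom_points (complex_of disc)"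
      using fan_in_disc disc_map_fan by (intro image_eqI[of _ _ "fan k a b"]) simp_all
  qed
qed

lemma continuous_on_disc_map: "continuous_on S disc_map"
  unfolding disc_map_def
  by (intro continuous_on_sum continuous_on_scaleR continuous_on_const
      continuous_on_subset[OF continuous_on_product_coordinates]) auto

section \<open>A triangulation of the genus 2 surface\<close>

text \<open>In \<open>disc\<close> many edges at the centre have the same ends after gluing. The moves surround the
  centre by a ring of eight new vertices \<open>25, \<dots>, 32\<close>, which makes the glued complex simplicial;
  \<open>label\<close> sends each vertex to its class. The survivors of \<open>base_moves\<close> are labelled \<open>0, \<dots>, 9\<close>.\<close>

definition disc_moves :: "(nat list \<times> nat list) list" where
  "disc_moves = [
    ([24,1,2],[25]),([24,1],[25,0]),([24,4,5],[26]),([24,4],[26,3]),([24,7,8],[27]),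
    ([24,7],[27,6]),([24,10,11],[28]),([24,10],[28,9]),([24,13,14],[29]),
    ([24,13],[29,12]),([24,16,17],[30]),([24,16],[30,15]),([24,19,20],[31]),
    ([24,19],[31,18]),([24,22,23],[32]),([24,22],[32,21]),([24,3],[2,26]),
    ([24,2],[25,26]),([24,6],[5,27]),([24,5],[26,27]),([24,9],[8,28]),([24,8],[27,28]),
    ([24,12],[11,29]),([24,11],[28,29]),([24,15],[14,30]),([24,14],[29,30]),
    ([24,18],[17,31]),([24,17],[30,31]),([24,21],[20,32]),([24,20],[31,32]),
    ([24,0],[23,25]),([24,23],[32,25])]"

definition ringed_disc :: "nat list list" where
  "ringed_disc = [
    [1,2,25],[0,1,25],[4,5,26],[3,4,26],[7,8,27],[6,7,27],[10,11,28],[9,10,28],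
    [13,14,29],[12,13,29],[16,17,30],[15,16,30],[19,20,31],[18,19,31],[22,23,32],
    [21,22,32],[2,3,26],[2,25,26],[24,25,26],[5,6,27],[5,26,27],[24,26,27],[8,9,28],
    [8,27,28],[24,27,28],[11,12,29],[11,28,29],[24,28,29],[14,15,30],[14,29,30],
    [24,29,30],[17,18,31],[17,30,31],[24,30,31],[20,21,32],[20,31,32],[24,31,32],
    [0,23,25],[23,25,32],[24,25,32]]"

definition label :: "nat list" where
  "label = [
     9, 10, 11, 9, 12, 13, 9, 11, 10, 9, 13, 12, 9, 14, 15, 9, 16, 17, 9, 15, 14, 9, 17, 16, 8,
     0, 1, 2, 3, 4, 5, 6, 7]"

definition base_moves :: "(nat list \<times> nat list) list" where
  "base_moves = [
    ([9,10],[0,3]),([10,11],[0,2]),([10],[0,2,3]),([16,17],[5,7]),([7,16],[0,5]),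
    ([16],[0,5,9]),([9,12],[1,4]),([12,13],[1,3]),([12],[1,3,4]),([1,2],[8,13]),
    ([5,9],[0,15]),([7,17],[5,9]),([17],[5,6,9]),([14,15],[4,6]),([6,14],[4,7]),
    ([14],[4,7,9]),([9,11],[1,2]),([11],[0,1,2]),([2,13],[8,9]),([3,8],[2,4]),
    ([1,13],[3,8]),([13],[3,8,9]),([5,15],[0,4]),([4,15],[0,6]),([15],[0,6,9])]"

definition base_complex :: "nat list list" where
  "base_complex = [
    [0,1,2],[0,1,8],[0,2,3],[0,3,9],[0,4,5],[0,4,6],[0,5,7],[0,6,9],[0,7,8],[1,2,9],
    [1,3,4],[1,3,8],[1,4,9],[2,3,4],[2,4,8],[2,8,9],[3,8,9],[4,5,8],[4,6,7],[4,7,9],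
    [5,6,8],[5,6,9],[5,7,9],[6,7,8]]"

text \<open>In each block \<open>a b a^-1 b^-1\<close> of the boundary word a side is glued to the
  one two places away.\<close>

definition partner :: "nat \<Rightarrow> nat" where
  "partner k = (if k mod 4 < 2 then k + 2 else k - 2)"

text \<open>What the labels must satisfy on the boundary: one class for all corners, and the first
  division point of a side labelled like the second one of its partner, because sides are glued with
  opposite directions.\<close>

definition sides_glued :: bool where
  "sides_glued \<longleftrightarrow> (\<forall>k\<in>set [0..<8]. label ! (3 * k) = label ! 0
     \<and> label ! Suc (3 * k) \<noteq> label ! 0 \<and> label ! Suc (Suc (3 * k)) \<noteq> label ! 0
     \<and> (\<forall>m\<in>set [0..<8].
       (label ! Suc (3 * k) = label ! Suc (3 * m) \<longleftrightarrow> m = k) \<and>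
       (label ! Suc (Suc (3 * k)) = label ! Suc (Suc (3 * m)) \<longleftrightarrow> m = k) \<and>
       (label ! Suc (3 * k) = label ! Suc (Suc (3 * m)) \<longleftrightarrow> m = partner k) \<and>
       (label ! Suc (Suc (3 * k)) = label ! Suc (3 * m) \<longleftrightarrow> m = partner k)))"

text \<open>Vertices from 24 on are interior. Two facets sharing such a vertex lie in its closed
  star, so the condition makes labels injective on these stars; this helps to confine
  identifications to the boundary.\<close>

definition injective_on_stars :: "(nat \<times> nat) list list \<Rightarrow> bool" where
  "injective_on_stars R \<longleftrightarrow> (\<forall>S\<in>set R. \<forall>T\<in>set R.
     if \<exists>(a, p)\<in>set S. \<exists>(b, q)\<in>set T. 24 \<le> a \<and> a = b
     then \<forall>(v, p)\<in>set S. \<forall>(w, q)\<in>set T. if p = q then v = w else True else True)"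

text \<open>Further facts about the ring: an interior label is never reused, every facet has an
  interior vertex, and its boundary vertices lie in one facet of \<open>disc\<close>, so that a
  point without interior weight already belongs to \<open>disc\<close>.\<close>

definition interior_injective :: bool where
  "interior_injective \<longleftrightarrow>
     (\<forall>a\<in>set [24..<33]. \<forall>v\<in>set [0..<33]. if label ! v = label ! a then v = a else True) \<and>
     (\<forall>S\<in>set ringed_disc. (\<exists>a\<in>set S. 24 \<le> a) \<and> (\<forall>v\<in>set S. v < 33) \<and>
       (\<exists>D\<in>set disc. set (filter (\<lambda>v. v < 24) S) \<subseteq> set D)) \<and>
     injective_on_stars (map (map (\<lambda>v. (v, label ! v))) ringed_disc)"

lemma moves_to_ringed_disc: "moves_to disc_moves disc ringed_disc" by code_simp
lemma disc_moves_24: "\<forall>(A, B)\<in>set disc_moves. 24 \<in> set A" by code_simp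
lemma sides_glued: sides_glued by code_simp
lemma interior_injective: interior_injective by code_simp
lemma moves_to_base: "moves_to base_moves (map (\<lambda>T. sort (map ((!) label) T)) ringed_disc) base_complex" by code_simp

text \<open>The simplicial map induced by \<open>label\<close>, in barycentric coordinates: weights
  of merged vertices add up.\<close>

definition glue_map :: "(nat \<Rightarrow> real) \<Rightarrow> nat \<Rightarrow> real" where
  "glue_map x = (\<lambda>w. \<Sum>v<33. if label ! v = w then x v else 0)"

lemma partner: "k < 8 \<Longrightarrow> partner k < 8" "k < 8 \<Longrightarrow> partner k \<noteq> k" "k < 8 \<Longrightarrow> partner (partner k) = k"
  by (auto dest!: less_8_cases simp: partner_def)

lemma label_corner: "k < 8 \<Longrightarrow> label ! (3 * k) = label ! 0"
  and label_nx: "k < 8 \<Longrightarrow> label ! next_corner k = label ! 0"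
  and label_side: "k < 8 \<Longrightarrow> label ! Suc (3 * k) \<noteq> label ! 0" "k < 8 \<Longrightarrow> label ! Suc (Suc (3 * k)) \<noteq> label ! 0"
  and label_side_eq:
    "k < 8 \<Longrightarrow> m < 8 \<Longrightarrow> label ! Suc (3 * k) = label ! Suc (3 * m) \<longleftrightarrow> m = k"
    "k < 8 \<Longrightarrow> m < 8 \<Longrightarrow> label ! Suc (Suc (3 * k)) = label ! Suc (Suc (3 * m)) \<longleftrightarrow> m = k"
    "k < 8 \<Longrightarrow> m < 8 \<Longrightarrow> label ! Suc (3 * k) = label ! Suc (Suc (3 * m)) \<longleftrightarrow> m = partner k"
    "k < 8 \<Longrightarrow> m < 8 \<Longrightarrow> label ! Suc (Suc (3 * k)) = label ! Suc (3 * m) \<longleftrightarrow> m = partner k"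
proof -
  note * = sides_glued[unfolded sides_glued_def set_upt atLeastLessThan_iff Ball_def, simplified, rule_format]
  show c: "k < 8 \<Longrightarrow> label ! (3 * k) = label ! 0" for k using * by blast
  show "k < 8 \<Longrightarrow> label ! next_corner k = label ! 0"
  proof -
    assume "k < 8"
    then have "next_corner k = 3 * (Suc k mod 8)" by (auto simp: next_corner_def mod_if)
    then show ?thesis using c[of "Suc k mod 8"] by simp
  qed
qed (use sides_glued in \<open>auto simp: sides_glued_def\<close>)

text \<open>The weights of the two division points in the point \<open>side 2 k t\<close>.\<close>

definition third1 :: "real \<Rightarrow> real" where "third1 t = max 0 (min (3 * t) (2 - 3 * t))"
definition third2 :: "real \<Rightarrow> real" where "third2 t = max 0 (min (3 - 3 * t) (3 * t - 1))"

lemma thirds_flip: "third1 (1 - t) = third2 t" "third2 (1 - t) = third1 t"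
  by (auto simp: third1_def third2_def min.commute algebra_simps)

text \<open>Both ends of the side fall into the corner class, so their weights merge; only the two
  division points keep track of the side and of the position on it.\<close>

lemma glue_map_side:
  assumes k: "k < 8" and t: "0 \<le> t" "t \<le> 1"
  shows "glue_map (fan k (1 - t) t) w =
    (if w = label ! 0 then max 0 (1 - 3 * t) + max 0 (3 * t - 2) else 0)
    + (if w = label ! Suc (3 * k) then third1 t else 0)
    + (if w = label ! Suc (Suc (3 * k)) then third2 t else 0)"
proof -
  let ?f = "\<lambda>v. if label ! v = w then fan k (1 - t) t v else 0"
  have z: "fan k (1 - t) t v = 0" if "v \<notin> {3 * k, Suc (3 * k), Suc (Suc (3 * k)), next_corner k}" for v
    using fan_values(5)[OF k _ that] fan_values(6)[OF k, of "1 - t" t] by (cases "v = 24") auto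
  have "glue_map (fan k (1 - t) t) w = ?f (3 * k) + ?f (Suc (3 * k)) + ?f (Suc (Suc (3 * k))) + ?f (next_corner k)"
    unfolding glue_map_def
    by (rule sum_4) (use k next_corner[OF k] z in auto)
  also have "\<dots> = (if w = label ! 0 then max 0 (1 - 3 * t) + max 0 (3 * t - 2) else 0)
    + (if w = label ! Suc (3 * k) then third1 t else 0)
    + (if w = label ! Suc (Suc (3 * k)) then third2 t else 0)"
    unfolding fan_values(1-4)[OF k] label_corner[OF k] label_nx[OF k] third1_def third2_def
    by (auto simp: algebra_simps)
  finally show ?thesis .
qed

lemma glue_map_side_values:
  assumes k: "k < 8" "m < 8" and t: "0 \<le> t" "t \<le> 1"
  shows "glue_map (fan k (1 - t) t) (label ! Suc (3 * m)) =
      (if m = k then third1 t else if m = partner k then third2 t else 0)"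
    and "glue_map (fan k (1 - t) t) (label ! Suc (Suc (3 * m))) =
      (if m = k then third2 t else if m = partner k then third1 t else 0)"
  using label_side[OF k(2)] partner[OF k(1)] label_side_eq[OF k] label_side_eq[OF k(2,1)] partner[OF k(2)]
  unfolding glue_map_side[OF k(1) t] by auto

lemma glue_map_partner:
  assumes k: "k < 8" and t: "0 \<le> t" "t \<le> 1"
  shows "glue_map (fan (partner k) t (1 - t)) = glue_map (fan k (1 - t) t)"
proof
  fix w
  have s: "label ! Suc (3 * partner k) = label ! Suc (Suc (3 * k))"
    "label ! Suc (Suc (3 * partner k)) = label ! Suc (3 * k)"
    using label_side_eq[OF k partner(1)[OF k]] by auto
  have "1 - 3 * (1 - t) = 3 * t - 2" "3 * (1 - t) - 2 = 1 - 3 * t" by simp_all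
  then show "glue_map (fan (partner k) t (1 - t)) w = glue_map (fan k (1 - t) t) w"
    using glue_map_side[OF partner(1)[OF k], of "1 - t" w] t
    unfolding glue_map_side[OF k t] s by (simp add: thirds_flip)
qed

lemma thirds_zero_iff: "0 \<le> t \<Longrightarrow> t \<le> 1 \<Longrightarrow> third1 t = 0 \<and> third2 t = 0 \<longleftrightarrow> t = 0 \<or> t = 1"
  by (auto simp: third1_def third2_def max_def min_def split: if_splits)

text \<open>The two weights run through \<open>(3t, 0)\<close>, then
  \<open>(2 - 3t, 3t - 1)\<close>, then \<open>(0, 3 - 3t)\<close>, and so determine
  \<open>t\<close> away from the ends. A single midpoint would not separate \<open>t\<close> from
  \<open>1 - t\<close>.\<close>

lemma thirds_inj:
  assumes "0 \<le> t" "t \<le> 1" "0 \<le> r" "r \<le> 1" "third1 t = third1 r" "third2 t = third2 r"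
    "\<not> (third1 t = 0 \<and> third2 t = 0)"
  shows "t = r"
  using assms by (auto simp: third1_def third2_def max_def min_def split: if_splits)

lemma glued_partner:
  assumes k: "k < 8" and t: "0 \<le> t" "t \<le> 1"
  shows "equivclp (glued 2) (side 2 k t) (side 2 (partner k) (1 - t))"
proof -
  have *: "equivclp (glued 2) (side 2 k t) (side 2 (k + 2) (1 - t))"
    if "k < 8" "k mod 4 < 2" "0 \<le> t" "t \<le> 1" for k t
  proof -
    have "k div 4 < 2" using that by auto
    have c: "k = 4 * (k div 4) \<or> k = 4 * (k div 4) + 1" using that(2) by presburger
    have "glued 2 (side 2 k t) (side 2 (k + 2) (1 - t))"
      using c
    proof
      assume a: "k = 4 * (k div 4)"
      show ?thesis using glue_a[OF \<open>k div 4 < 2\<close> that(3,4)] a by metis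
    next
      assume a: "k = 4 * (k div 4) + 1"
      have "k + 2 = 4 * (k div 4) + 3" using a by linarith
      then show ?thesis using glue_b[OF \<open>k div 4 < 2\<close> that(3,4)] a by metis
    qed
    then show ?thesis by blast
  qed
  show ?thesis
  proof (cases "k mod 4 < 2")
    case True
    then show ?thesis using *[OF k True t] by (simp add: partner_def)
  next
    case False
    then have p: "partner k = k - 2" "k - 2 < 8" "(k - 2) mod 4 < 2" "k - 2 + 2 = k"
      using k by (auto dest!: less_8_cases simp: partner_def)
    then show ?thesis using *[of "k - 2" "1 - t"] t by (simp add: equivclp_sym)
  qed
qed

text \<open>The identifications at the ends of sides link the corners in the order 0, 3, 2, 1, 4, 7,
  6, 5, 8, where 8 is corner 0 again.\<close>

lemma corners_glued:
  assumes "k \<le> 8" "m \<le> 8"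
  shows "equivclp (glued 2) (corner 2 k) (corner 2 m)"
proof -
  have s: "side 2 k 0 = corner 2 k" "side 2 k 1 = corner 2 (Suc k)" for k
    by (simp_all add: side_def linepath_def)
  have c: "equivclp (glued 2) (corner 2 k) (corner 2 m)" if "k < 8" "m = Suc (partner k)" for k m
    using glued_partner[OF that(1), of 0] that(2) by (simp add: s)
  have c': "equivclp (glued 2) (corner 2 m) (corner 2 j)" if "k < 8" "m = Suc k" "j = partner k" for k m j
    using glued_partner[OF that(1), of 1] that by (simp add: s)
  have h: "equivclp (glued 2) (corner 2 0) (corner 2 3)" "equivclp (glued 2) (corner 2 1) (corner 2 2)"
    "equivclp (glued 2) (corner 2 1) (corner 2 4)" "equivclp (glued 2) (corner 2 2) (corner 2 3)"
    "equivclp (glued 2) (corner 2 4) (corner 2 7)" "equivclp (glued 2) (corner 2 5) (corner 2 6)"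
    "equivclp (glued 2) (corner 2 5) (corner 2 8)" "equivclp (glued 2) (corner 2 6) (corner 2 7)"
    by (rule c[of 0] c'[of 0] c[of 1] c'[of 1] c[of 4] c'[of 4] c[of 5] c'[of 5]; simp add: partner_def)+
  note e1 = equivclp_trans[OF equivclp_sym[OF h(4)] equivclp_sym[OF h(2)]]
  note e4 = equivclp_trans[OF e1 h(3)]
  note e7 = equivclp_trans[OF e4 h(5)]
  note e6 = equivclp_trans[OF e7 equivclp_sym[OF h(8)]]
  note e5 = equivclp_trans[OF e6 equivclp_sym[OF h(6)]]
  note e8 = equivclp_trans[OF e5 h(7)]
  have e: "equivclp (glued 2) (corner 2 3) (corner 2 j)" if "j \<in> {0, 1, 2, 3, 4, 5, 6, 7, 8}" for j
    using that equivclp_sym[OF h(1)] e1 equivclp_sym[OF h(4)] e4 e5 e6 e7 e8 by auto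
  have "j \<in> {0, 1, 2, 3, 4, 5, 6, 7, 8}" if "j \<le> 8" for j :: nat using that by auto
  then show ?thesis using e[of k] e[of m] assms by (blast intro: equivclp_sym equivclp_trans)
qed

text \<open>The weights at the labels of division points reveal the side up to its partner and the
  position on it. If all of them vanish, both points are corners, which are all equivalent.\<close>

lemma glue_map_boundary_imp_glued:
  assumes k: "k < 8" "m < 8" and t: "0 \<le> t" "t \<le> 1" "0 \<le> r" "r \<le> 1"
    and eq: "glue_map (fan k (1 - t) t) = glue_map (fan m (1 - r) r)"
  shows "equivclp (glued 2) (side 2 k t) (side 2 m r)"
proof -
  have s: "side 2 k t \<in> {corner 2 k, corner 2 (Suc k)}" if "t = 0 \<or> t = 1" for k t
    using that by (auto simp: side_def linepath_def)
  note v = glue_map_side_values[OF _ _ t(1,2)] glue_map_side_values[OF _ _ t(3,4)]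
  have kk: "third1 t = (if k = m then third1 r else if k = partner m then third2 r else 0)"
    "third2 t = (if k = m then third2 r else if k = partner m then third1 r else 0)"
    using v(1,2)[OF k(1) k(1)] v(3,4)[OF k(2) k(1)] eq by auto
  have mm: "third1 r = (if m = k then third1 t else if m = partner k then third2 t else 0)"
    "third2 r = (if m = k then third2 t else if m = partner k then third1 t else 0)"
    using v(1,2)[OF k(1) k(2)] v(3,4)[OF k(2) k(2)] eq by auto
  show ?thesis
  proof (cases "third1 t = 0 \<and> third2 t = 0")
    case True
    then have "third1 r = 0 \<and> third2 r = 0" using mm by auto
    then have "t = 0 \<or> t = 1" "r = 0 \<or> r = 1" using True thirds_zero_iff t by blast+
    then show ?thesis using s[of t k] s[of r m] corners_glued k by auto
  next
    case False
    then consider "k = m" | "k \<noteq> m" "k = partner m" using kk by presburger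
    then show ?thesis
    proof cases
      case 1
      then have "t = r" using kk False thirds_inj t by simp
      then show ?thesis using 1 by simp
    next
      case 2
      then have "third1 t = third1 (1 - r)" "third2 t = third2 (1 - r)" using kk by (simp_all add: thirds_flip)
      then have "t = 1 - r" using False thirds_inj[of t "1 - r"] t by simp
      then show ?thesis using glued_partner[OF k(2) t(3,4)] 2 by (simp add: equivclp_sym)
    qed
  qed
qed

lemma gluedE:
  assumes "glued 2 z w"
  obtains k t where "k < 8" "0 \<le> t" "t \<le> 1" "z = side 2 k t" "w = side 2 (partner k) (1 - t)"
  using assms
proof cases
  case (glue_a i t)
  then show ?thesis using that[of "4 * i" t] by (simp add: partner_def)
next
  case (glue_b i t)
  then show ?thesis using that[of "4 * i + 1" t] by (simp add: partner_def numeral_3_eq_3)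
qed

section \<open>The gluing away from the boundary\<close>

definition glued_complex :: "nat list list" where
  "glued_complex = map (\<lambda>T. sort (map ((!) label) T)) ringed_disc"

lemma ringed_disc_stars:
  assumes "S \<in> set ringed_disc" "T \<in> set ringed_disc" "a \<in> set S" "a \<in> set T" "24 \<le> a"
    "v \<in> set S" "w \<in> set T" "label ! v = label ! w"
  shows "v = w"
proof -
  have ite: "(if C then X else True) = (C \<longrightarrow> X)" for C X by simp
  have "injective_on_stars (map (map (\<lambda>v. (v, label ! v))) ringed_disc)"
    using interior_injective unfolding interior_injective_def by (elim conjE)
  then have "\<forall>S\<in>set ringed_disc. \<forall>T\<in>set ringed_disc. (\<exists>a\<in>set S. \<exists>b\<in>set T. 24 \<le> a \<and> a = b) \<longrightarrow>
      (\<forall>v\<in>set S. \<forall>w\<in>set T. label ! v = label ! w \<longrightarrow> v = w)"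
    unfolding injective_on_stars_def ite by simp
  then have "(\<exists>a\<in>set S. \<exists>b\<in>set T. 24 \<le> a \<and> a = b) \<longrightarrow>
      (\<forall>v\<in>set S. \<forall>w\<in>set T. label ! v = label ! w \<longrightarrow> v = w)"
    using assms(1,2) by (blast elim!: ballE)
  then show ?thesis using assms(3-) by blast
qed

lemma ringed_disc_facet:
  assumes "S \<in> set ringed_disc"
  shows "set S \<subseteq> {..<33}" "\<exists>a\<in>set S. 24 \<le> a" "\<exists>D\<in>set disc. set S \<inter> {..<24} \<subseteq> set D"
    "inj_on ((!) label) (set S)"
proof -
  have "\<forall>S\<in>set ringed_disc. (\<exists>a\<in>set S. 24 \<le> a) \<and> (\<forall>v\<in>set S. v < 33) \<and>
       (\<exists>D\<in>set disc. set (filter (\<lambda>v. v < 24) S) \<subseteq> set D)"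
    using interior_injective unfolding interior_injective_def by (elim conjE)
  note i = bspec[OF this assms]
  have "set S \<inter> {..<24} = set (filter (\<lambda>v. v < 24) S)" by auto
  then show "set S \<subseteq> {..<33}" "\<exists>D\<in>set disc. set S \<inter> {..<24} \<subseteq> set D" using i by auto
  show "\<exists>a\<in>set S. 24 \<le> a" using i by blast
  then show "inj_on ((!) label) (set S)"
    using ringed_disc_stars[OF assms assms] by (auto simp: inj_on_def)
qed

lemma label_interior: "24 \<le> a \<Longrightarrow> a < 33 \<Longrightarrow> v < 33 \<Longrightarrow> label ! v = label ! a \<Longrightarrow> v = a"
proof -
  assume a: "24 \<le> a" "a < 33" "v < 33" "label ! v = label ! a"
  have "\<forall>a\<in>set [24..<33]. \<forall>v\<in>set [0..<33]. if label ! v = label ! a then v = a else True"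
    using interior_injective unfolding interior_injective_def by (elim conjE)
  moreover have "a \<in> set [24..<33]" "v \<in> set [0..<33]" using a by auto
  ultimately have "if label ! v = label ! a then v = a else True" by blast
  then show "v = a" using a(4) by simp
qed

lemma glue_map_label:
  assumes "S \<in> set ringed_disc" "{v. u v \<noteq> 0} \<subseteq> set S" "v \<in> set S"
  shows "glue_map u (label ! v) = u v"
proof -
  have "u w = 0" if "label ! w = label ! v" "w \<noteq> v" for w
  proof (rule ccontr)
    assume "u w \<noteq> 0"
    then have "w \<in> set S" using assms(2) by auto
    then show False using ringed_disc_facet(4)[OF assms(1)] assms(3) that by (auto dest: inj_onD)
  qed
  then have "glue_map u (label ! v) = (\<Sum>w<33. if w = v then u v else 0)"
    unfolding glue_map_def by (intro sum.cong) auto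
  also have "\<dots> = u v" using ringed_disc_facet(1)[OF assms(1)] assms(3) by (simp add: subset_iff)
  finally show ?thesis .
qed

lemma glue_map_outside:
  assumes "\<And>v. v < 33 \<Longrightarrow> u v \<noteq> 0 \<Longrightarrow> label ! v \<noteq> w"
  shows "glue_map u w = 0"
  unfolding glue_map_def using assms by (intro sum.neutral) auto

text \<open>The label of \<open>a\<close> belongs to no other vertex, so \<open>w\<close> has weight
  at \<open>a\<close> too. Both points then lie in the star of \<open>a\<close>, where labels are
  injective, and the coordinates can be read back from the image.\<close>

lemma glue_map_interior:
  assumes u: "u \<in> geom_points (complex_of ringed_disc)" and w: "w \<in> geom_points (complex_of ringed_disc)"
    and eq: "glue_map u = glue_map w" and a: "24 \<le> a" "u a \<noteq> 0"
  shows "u = w"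
proof -
  obtain S where S: "S \<in> set ringed_disc" "{v. u v \<noteq> 0} \<subseteq> set S" using complex_of_geomE[OF u] by metis
  obtain T where T: "T \<in> set ringed_disc" "{v. w v \<noteq> 0} \<subseteq> set T" using complex_of_geomE[OF w] by metis
  have aS: "a \<in> set S" using S a by auto
  have "glue_map w (label ! a) \<noteq> 0" using glue_map_label[OF S aS] eq a by simp
  then obtain b where b: "b < 33" "w b \<noteq> 0" "label ! b = label ! a"
    using glue_map_outside[of w "label ! a"] by blast
  then have "b = a" using label_interior[OF a(1), of b] ringed_disc_facet(1)[OF S(1)] aS by auto
  then have aT: "a \<in> set T" using T b by auto
  \<comment> \<open>All data are generalized, since the claim is used a second time with
    \<open>u\<close> and \<open>w\<close> exchanged.\<close>
  have half: "u v = w v" if S: "S \<in> set ringed_disc" "{v. u v \<noteq> 0} \<subseteq> set S" "a \<in> set S"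
    and T: "T \<in> set ringed_disc" "{v. w v \<noteq> 0} \<subseteq> set T" "a \<in> set T"
    and eq: "glue_map u = glue_map w" and v: "v \<in> set S" for u w S T v
  proof (cases "v \<in> set T")
    case True
    then show ?thesis using glue_map_label[OF S(1,2) v] glue_map_label[OF T(1,2) True] eq by simp
  next
    case False
    have "glue_map w (label ! v) = 0"
    proof (rule glue_map_outside)
      fix b assume "w b \<noteq> 0"
      then have "b \<in> set T" using T(2) by auto
      then show "label ! b \<noteq> label ! v"
        using ringed_disc_stars[OF T(1) S(1) T(3) S(3) a(1), of b v] v False by auto
    qed
    then have "u v = 0" using glue_map_label[OF S(1,2) v] eq by simp
    moreover have "w v = 0" using False T(2) by auto
    ultimately show ?thesis by simp
  qed
  show ?thesis
  proof
    fix v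
    show "u v = w v"
      using half[OF S aS T aT eq, of v] half[OF T aT S aS eq[symmetric], of v] S(2) T(2) by force
  qed
qed

lemma glue_map_image: "glue_map ` geom_points (complex_of ringed_disc) = geom_points (complex_of glued_complex)"
proof
  show "glue_map ` geom_points (complex_of ringed_disc) \<subseteq> geom_points (complex_of glued_complex)"
  proof (rule image_subsetI)
    fix u assume u: "u \<in> geom_points (complex_of ringed_disc)"
    obtain S where S: "S \<in> set ringed_disc" "{v. u v \<noteq> 0} \<subseteq> set S" "sum u (set S) = 1"
      using complex_of_geomE[OF u] by metis
    show "glue_map u \<in> geom_points (complex_of glued_complex)"
    proof (rule complex_of_geomI)
      show "0 \<le> glue_map u v" for v
        using u unfolding glue_map_def complex_of_geom by (intro sum_nonneg) auto
      show "sort (map ((!) label) S) \<in> set glued_complex"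
        using S(1) by (auto simp: glued_complex_def)
      show "{w. glue_map u w \<noteq> 0} \<subseteq> set (sort (map ((!) label) S))"
        using glue_map_outside[of u] S(2) by force
      have "sum (glue_map u) (set (sort (map ((!) label) S))) = (\<Sum>v\<in>set S. glue_map u (label ! v))"
        using ringed_disc_facet(4)[OF S(1)] by (simp add: sum.reindex)
      then show "sum (glue_map u) (set (sort (map ((!) label) S))) = 1"
        using glue_map_label[OF S(1,2)] S(3) by simp
    qed
  qed
  show "geom_points (complex_of glued_complex) \<subseteq> glue_map ` geom_points (complex_of ringed_disc)"
  proof
    fix y assume y: "y \<in> geom_points (complex_of glued_complex)"
    obtain S where S: "S \<in> set ringed_disc" "{w. y w \<noteq> 0} \<subseteq> (!) label ` set S" "sum y ((!) label ` set S) = 1"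
    proof -
      obtain T where T: "T \<in> set glued_complex" "{w. y w \<noteq> 0} \<subseteq> set T" "sum y (set T) = 1"
        using complex_of_geomE[OF y] by metis
      then obtain S where "S \<in> set ringed_disc" "T = sort (map ((!) label) S)"
        by (auto simp: glued_complex_def)
      then show ?thesis using T that[of S] by simp
    qed
    \<comment> \<open>The lift of \<open>y\<close> along \<open>label\<close> on the facet
      \<open>S\<close>, where \<open>label\<close> is injective.\<close>
    define u where "u = (\<lambda>v. if v \<in> set S then y (label ! v) else 0)"
    have uS: "{v. u v \<noteq> 0} \<subseteq> set S" by (auto simp: u_def)
    have "u \<in> geom_points (complex_of ringed_disc)"
    proof (rule complex_of_geomI[OF _ S(1) uS])
      show "0 \<le> u v" for v using y unfolding complex_of_geom u_def by auto
      show "sum u (set S) = 1"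
        using S(3) ringed_disc_facet(4)[OF S(1)] by (simp add: u_def sum.reindex)
    qed
    moreover have "glue_map u = y"
    proof
      fix w
      show "glue_map u w = y w"
      proof (cases "w \<in> (!) label ` set S")
        case True
        then show ?thesis using glue_map_label[OF S(1) uS] by (auto simp: u_def)
      next
        case False
        then have "glue_map u w = 0" using uS by (intro glue_map_outside) auto
        then show ?thesis using False S(2) by auto
      qed
    qed
    ultimately show "y \<in> glue_map ` geom_points (complex_of ringed_disc)" by blast
  qed
qed

lemma continuous_on_glue_map: "continuous_on U glue_map"
  unfolding glue_map_def
proof (rule continuous_on_coordinatewise_then_product)
  fix w
  have "continuous_on U (\<lambda>x :: nat \<Rightarrow> real. if label ! v = w then x v else 0)" for v
    by (cases "label ! v = w") (auto intro: continuous_on_subset[OF continuous_on_product_coordinates])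
  then show "continuous_on U (\<lambda>x. \<Sum>v<33. if label ! v = w then x v else 0)"
    by (intro continuous_on_sum)
qed

text \<open>\<open>h\<close> retriangulates the disc and fixes its boundary. The maps compared are
  \<open>disc_map\<close> into the octagon and \<open>h\<close> followed by \<open>glue_map\<close>;
  the work is to show that the second identifies two points exactly when the gluing identifies their
  images under the first.\<close>

lemma glued_complex_homeomorphic:
  "underlying_space (complex_of glued_complex) homeomorphic_space orientable_surface 2"
proof -
  obtain h k where hk: "homeomorphic_maps (underlying_space (complex_of disc)) (underlying_space (complex_of ringed_disc)) h k"
    and fixed: "\<And>x. x \<in> geom_points (complex_of disc) \<Longrightarrow> x 24 = 0 \<Longrightarrow> h x = x"
    using moves_to_homeomorphic_fixing[OF moves_to_ringed_disc disc_moves_24] by blast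
  let ?D = "geom_points (complex_of disc)" and ?R = "geom_points (complex_of ringed_disc)"
    and ?G = "geom_points (complex_of glued_complex)"
  let ?f = "\<lambda>x. glue_map (h x)"
  have h: "continuous_on ?D h" "\<And>x. x \<in> ?D \<Longrightarrow> h x \<in> ?R" "\<And>x. x \<in> ?D \<Longrightarrow> k (h x) = x"
    "\<And>y. y \<in> ?R \<Longrightarrow> k y \<in> ?D \<and> h (k y) = y"
    using hk by (auto simp: homeomorphic_maps_def underlying_space_def)
  then have "h ` ?D = ?R" by force
  then have image: "?f ` ?D = ?G" using glue_map_image by (metis image_image)
  have cont: "continuous_on ?D ?f"
    using continuous_on_compose[OF h(1) continuous_on_glue_map] by (simp add: comp_def)
  have side_fan: "disc_map (fan j (1 - t) t) = side 2 j t" "fan j (1 - t) t \<in> ?D" "h (fan j (1 - t) t) = fan j (1 - t) t"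
    if "j < 8" "0 \<le> t" "t \<le> 1" for j t
    using that disc_map_fan fan_in_disc fixed by (simp_all add: side_2 fan_values)
  \<comment> \<open>A point whose image under \<open>h\<close> has no interior weight lies on a
    side: the image already belongs to \<open>disc\<close>, has no weight at the centre, is
    therefore fixed by \<open>h\<close>, and equals the point itself by injectivity.\<close>
  have boundary: "\<exists>j t. j < 8 \<and> 0 \<le> t \<and> t \<le> 1 \<and> x = fan j (1 - t) t"
    if x: "x \<in> ?D" and z: "\<And>v. 24 \<le> v \<Longrightarrow> h x v = 0" for x
  proof -
    have hx: "h x \<in> ?R" using x h by blast
    then obtain S where S: "S \<in> set ringed_disc" "{v. h x v \<noteq> 0} \<subseteq> set S" "sum (h x) (set S) = 1"
      by (metis complex_of_geomE)
    obtain C where C: "C \<in> set disc" "set S \<inter> {..<24} \<subseteq> set C" using ringed_disc_facet(3)[OF S(1)] by blast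
    have "v < 24" if "h x v \<noteq> 0" for v
      using that z[of v] by linarith
    then have supp: "{v. h x v \<noteq> 0} \<subseteq> set C" using S(2) C(2) by blast
    have "h x \<in> ?D"
      using hx C(1) supp unfolding complex_of_geom by blast
    then have "h (h x) = h x" using fixed z by simp
    then have "h x = x" using h(3) \<open>h x \<in> ?D\<close> x by metis
    obtain j a b where j: "j < 8" "0 \<le> a" "0 \<le> b" "x = fan j a b" using disc_fanE[OF x] by metis
    have "x 24 = 0" using z[of 24] \<open>h x = x\<close> by simp
    then have "a = 1 - b" using j fan_values(6) by simp
    then show ?thesis using j by (intro exI[of _ j] exI[of _ b]) auto
  qed
  have fibres: "?f x = ?f y \<longleftrightarrow> (disc_map x, disc_map y) \<in> glue_rel 2" if x: "x \<in> ?D" and y: "y \<in> ?D" for x y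
  proof
    have P: "disc_map x \<in> polygon_4g 2" "disc_map y \<in> polygon_4g 2" using x y disc_map_image by auto
    assume eq: "?f x = ?f y"
    show "(disc_map x, disc_map y) \<in> glue_rel 2"
    proof (cases "\<exists>a\<ge>24. h x a \<noteq> 0 \<or> h y a \<noteq> 0")
      case True
      then have "h x = h y"
        using glue_map_interior[OF h(2)[OF x] h(2)[OF y] eq] glue_map_interior[OF h(2)[OF y] h(2)[OF x] eq[symmetric]]
        by metis
      then have "x = y" using h(3) x y by metis
      then show ?thesis using P by (simp add: glue_rel_def)
    next
      case False
      then obtain i t j r where *: "i < 8" "0 \<le> t" "t \<le> 1" "x = fan i (1 - t) t"
        "j < 8" "0 \<le> r" "r \<le> 1" "y = fan j (1 - r) r"
        using boundary[OF x] boundary[OF y] by metis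
      then have "glue_map (fan i (1 - t) t) = glue_map (fan j (1 - r) r)" using eq side_fan by simp
      then have "equivclp (glued 2) (disc_map x) (disc_map y)"
        using glue_map_boundary_imp_glued * side_fan by simp
      then show ?thesis using P by (simp add: glue_rel_def)
    qed
  next
    \<comment> \<open>\<open>F\<close> is the composite map read on the octagon. It agrees on each
      generating pair of the gluing, hence on pairs in the equivalence closure.\<close>
    define F where "F z = ?f (inv_into ?D disc_map z)" for z
    have F: "F (disc_map x) = ?f x" if "x \<in> ?D" for x
      using that inj_on_disc_map by (simp add: F_def)
    have step: "F z = F w" if "glued 2 z w" for z w
      using that
    proof (rule gluedE)
      fix i t assume *: "i < 8" "0 \<le> t" "t \<le> 1" "z = side 2 i t" "w = side 2 (partner i) (1 - t)"
      have "F z = glue_map (fan i (1 - t) t)"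
        using F[OF side_fan(2)[OF *(1-3)]] side_fan[OF *(1-3)] * by simp
      moreover have "F w = glue_map (fan (partner i) t (1 - t))"
        using F[OF side_fan(2)[OF partner(1)[OF *(1)], of "1 - t"]]
          side_fan[OF partner(1)[OF *(1)], of "1 - t"] * by simp
      ultimately show ?thesis using glue_map_partner * by simp
    qed
    assume "(disc_map x, disc_map y) \<in> glue_rel 2"
    then have "equivclp (glued 2) (disc_map x) (disc_map y)" by (simp add: glue_rel_def)
    then have "F (disc_map x) = F (disc_map y)"
      by (induction rule: equivclp_induct) (auto dest: step)
    then show "?f x = ?f y" using F x y by simp
  qed
  show ?thesis
    unfolding orientable_surface_def underlying_space_def
  proof (rule homeomorphic_quotient_top[where X = "top_of_set ?D" and q = disc_map and f = ?f])
    show "compact_space (top_of_set ?D)"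
    proof (rule compact_space_subtopology)
      have "compact ?D"
        unfolding complex_of_def by (rule compact_geom_points_generated) auto
      then show "compactin euclidean ?D" by simp
    qed
    show "continuous_map (top_of_set ?D) (top_of_set (polygon_4g 2)) disc_map"
      using continuous_on_disc_map disc_map_image by auto
    show "continuous_map (top_of_set ?D) (top_of_set ?G) ?f" using cont image by auto
  qed (use disc_map_image image fibres equiv_glue_rel in
      \<open>auto intro: Hausdorff_space_subtopology simp: Hausdorff_space_euclidean\<close>)
qed

lemma base_homeomorphic:
  "underlying_space (complex_of base_complex) homeomorphic_space orientable_surface 2"
  using moves_to_homeomorphic[OF moves_to_base] glued_complex_homeomorphic
  unfolding glued_complex_def
  by (metis homeomorphic_space_sym homeomorphic_space_trans)

section \<open>Separating planes and polyhedral realizations\<close>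

type_synonym point = "int \<times> int \<times> int"

fun minus3 :: "point \<Rightarrow> point \<Rightarrow> point" where "minus3 (a, b, c) (d, e, f) = (a - d, b - e, c - f)"
fun dot_int :: "point \<Rightarrow> point \<Rightarrow> int" where "dot_int (a, b, c) (d, e, f) = a * d + b * e + c * f"
fun cross_int :: "point \<Rightarrow> point \<Rightarrow> point" where
  "cross_int (a, b, c) (d, e, f) = (b * f - c * e, c * d - a * f, a * e - b * d)"
fun vec3 :: "point \<Rightarrow> real^3" where
  "vec3 (a, b, c) = vector [real_of_int a, real_of_int b, real_of_int c]"

lemma vec3_minus: "vec3 (minus3 p q) = vec3 p - vec3 q"
  by (cases p; cases q) (simp add: vec_eq_iff forall_3)

lemma vec3_dot: "real_of_int (dot_int p q) = vec3 p \<bullet> vec3 q"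
  by (cases p; cases q) (simp add: inner_vec_def sum_3)

lemma vec3_cross: "vec3 (cross_int p q) = cross3 (vec3 p) (vec3 q)"
  by (cases p; cases q) (simp add: vec_eq_iff forall_3 cross3_def)

lemma vec3_eq_iff: "vec3 p = vec3 q \<longleftrightarrow> p = q"
  by (cases p; cases q) (simp add: vec_eq_iff forall_3)

definition place :: "point list \<Rightarrow> nat \<Rightarrow> real^3" where "place cs v = vec3 (cs ! v)"

text \<open>A plane is stored as the three vertices spanning it, a normal vector and an offset.\<close>

type_synonym plane = "(nat \<times> nat \<times> nat) \<times> point \<times> int"

fun plane_of :: "nat \<times> nat \<times> nat \<Rightarrow> point \<Rightarrow> point \<Rightarrow> plane" where
  "plane_of t p n = (t, n, dot_int n p)"

fun plane :: "point list \<Rightarrow> nat \<times> nat \<times> nat \<Rightarrow> plane" where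
  "plane cs (p, q, r) =
     plane_of (p, q, r) (cs ! p) (cross_int (minus3 (cs ! q) (cs ! p)) (minus3 (cs ! r) (cs ! p)))"

fun is_plane :: "plane \<Rightarrow> bool" where "is_plane (t, n, d) \<longleftrightarrow> n \<noteq> (0, 0, 0)"

text \<open>The spanning vertices count as lying on both closed sides; any other vertex in the plane
  lies on neither, so that no degenerate plane is used to separate facets containing it.\<close>

fun strict_sides :: "int \<Rightarrow> int \<Rightarrow> bool \<times> bool" where "strict_sides s d = (d < s, s < d)"

fun sides :: "nat \<Rightarrow> point \<Rightarrow> plane \<Rightarrow> bool \<times> bool" where
  "sides v x ((p, q, r), n, d) =
     (if v = p \<or> v = q \<or> v = r then (True, True) else strict_sides (dot_int n x) d)"

text \<open>For each plane the two flags record whether all vertices considered lie on its closed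
  positive side and whether all lie on its closed negative side.\<close>

fun meet :: "(bool \<times> bool) list \<Rightarrow> (bool \<times> bool) list \<Rightarrow> (bool \<times> bool) list" where
  "meet ((a, b) # xs) ((c, d) # ys) = (a \<and> c, b \<and> d) # meet xs ys"
| "meet _ _ = []"

fun facet_sides :: "(bool \<times> bool) list list \<Rightarrow> nat list \<Rightarrow> (bool \<times> bool) list" where
  "facet_sides R [a, b, c] = meet (R ! a) (meet (R ! b) (R ! c))"
| "facet_sides R _ = []"

fun separated :: "(bool \<times> bool) list \<Rightarrow> (bool \<times> bool) list \<Rightarrow> bool" where
  "separated ((a, b) # xs) ((c, d) # ys) =
     (if a \<and> d then True else if b \<and> c then True else separated xs ys)"
| "separated _ _ = False"

text \<open>A facet is compared with itself as well. That succeeds only through a nondegenerate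
  plane spanned by its own three vertices, which handles two points of one facet.\<close>

fun pairwise_separated :: "(bool \<times> bool) list list \<Rightarrow> bool" where
  "pairwise_separated [] = True"
| "pairwise_separated (r # rs) = (if list_all (separated r) (r # rs) then pairwise_separated rs else False)"

definition vertex_sides :: "plane list \<Rightarrow> nat \<Rightarrow> point \<Rightarrow> (bool \<times> bool) list" where
  "vertex_sides Ps v x = map (sides v x) Ps"

fun all_vertex_sides :: "plane list \<Rightarrow> nat \<Rightarrow> point list \<Rightarrow> (bool \<times> bool) list list" where
  "all_vertex_sides Ps v [] = []"
| "all_vertex_sides Ps v (x # xs) = vertex_sides Ps v x # all_vertex_sides Ps (Suc v) xs"

definition embedded_wrt :: "plane list \<Rightarrow> nat list list \<Rightarrow> point list \<Rightarrow> bool" where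
  "embedded_wrt Ps F cs \<longleftrightarrow> pairwise_separated (map (facet_sides (all_vertex_sides Ps 0 cs)) F)"

definition embedded :: "nat list list \<Rightarrow> point list \<Rightarrow> (nat \<times> nat \<times> nat) list \<Rightarrow> bool" where
  "embedded F cs ts \<longleftrightarrow> length cs = 10 \<and> embedded_wrt (filter is_plane (map (plane cs) ts)) F cs"

fun is_triangle :: "nat list \<Rightarrow> bool" where
  "is_triangle [a, b, c] \<longleftrightarrow> a < b \<and> b < c \<and> c < 10"
| "is_triangle _ \<longleftrightarrow> False"

text \<open>Predicates evaluated by \<open>code_simp\<close> inside lists are named, since it simplifies the bodies of
  abstractions before they are applied.\<close>

definition contains :: "nat \<Rightarrow> nat list \<Rightarrow> bool" where "contains v T \<longleftrightarrow> v \<in> set T"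

definition covers :: "nat list list \<Rightarrow> nat \<Rightarrow> bool" where "covers F v \<longleftrightarrow> list_ex (contains v) F"

text \<open>Increasing triples make facets canonical lists, so distinct lists are distinct facets;
  coverage makes the vertex set exactly the numbers below 10.\<close>

definition well_formed :: "nat list list \<Rightarrow> bool" where
  "well_formed F \<longleftrightarrow> list_all is_triangle F \<and> distinct F \<and> list_all (covers F) [0..<10]"

lemma meet_map: "meet (map f xs) (map g xs) = map (\<lambda>x. (fst (f x) \<and> fst (g x), snd (f x) \<and> snd (g x))) xs"
proof (induction xs)
  case (Cons x xs)
  then show ?case by (cases "f x"; cases "g x") simp
qed simp

lemma separated_map:
  "separated (map f xs) (map g xs) \<longleftrightarrow> (\<exists>x\<in>set xs. fst (f x) \<and> snd (g x) \<or> snd (f x) \<and> fst (g x))"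
proof (induction xs)
  case (Cons x xs)
  then show ?case by (cases "f x"; cases "g x") auto
qed simp

lemma pairwise_separatedD:
  "pairwise_separated rs \<Longrightarrow> r \<in> set rs \<Longrightarrow> s \<in> set rs \<Longrightarrow> separated r s \<or> separated s r"
  by (induction rs) (auto simp: list_all_iff split: if_splits)

lemma is_triangleE:
  assumes "is_triangle T"
  obtains a b c where "T = [a, b, c]" "a < b" "b < c" "c < 10"
  using assms by (cases T rule: is_triangle.cases) auto

lemma well_formedD:
  assumes "well_formed F"
  shows "\<And>T. T \<in> set F \<Longrightarrow> is_triangle T" "distinct F" "\<Union> (set ` set F) = {..<10}"
proof -
  show t: "is_triangle T" if "T \<in> set F" for T using assms that by (auto simp: well_formed_def list_all_iff)
  show "distinct F" using assms by (simp add: well_formed_def)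
  have "set T \<subseteq> {..<10}" if "T \<in> set F" for T using t[OF that] by (rule is_triangleE) auto
  moreover have "\<exists>T\<in>set F. v \<in> set T" if "v < 10" for v
    using assms that by (auto simp: well_formed_def list_all_iff covers_def list_ex_iff contains_def)
  ultimately show "\<Union> (set ` set F) = {..<10}" by auto
qed

lemma vertices_well_formed: "well_formed F \<Longrightarrow> vertices (complex_of F) = {..<10}"
  unfolding complex_of_def vertices_generated by (rule well_formedD)

lemma card_triangle: "is_triangle T \<Longrightarrow> card (set T) = 3"
  by (erule is_triangleE) auto

lemma triangulates_complex_of:
  assumes "well_formed F" "underlying_space (complex_of F) homeomorphic_space S"
  shows "triangulates S (complex_of F)"
proof -
  have "0 \<in> \<Union> (set ` set F)" unfolding well_formedD(3)[OF assms(1)] by simp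
  then have "F \<noteq> []" by auto
  moreover have "card T = 3" if "T \<in> set ` set F" for T
    using that well_formedD(1)[OF assms(1)] card_triangle by auto
  ultimately show ?thesis
    using assms(2) two_dimensional_generated[of "set ` set F"]
    unfolding triangulates_def complex_of_def by (auto intro: finite_generated abstract_complex_generated)
qed

text \<open>A nonzero cross product makes the three points affinely independent: crossing the
  difference of the two combinations with one edge vector isolates the coefficient of the
  other.\<close>

lemma three_points_independent:
  fixes \<psi> :: "'v \<Rightarrow> real^3"
  assumes n: "cross3 (\<psi> q - \<psi> p) (\<psi> r - \<psi> p) \<noteq> 0"
    and x: "{v. x v \<noteq> 0} \<subseteq> {p, q, r}" "sum x {p, q, r} = 1"
    and y: "{v. y v \<noteq> 0} \<subseteq> {p, q, r}" "sum y {p, q, r} = 1"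
    and eq: "(\<Sum>v\<in>{p, q, r}. x v *\<^sub>R \<psi> v) = (\<Sum>v\<in>{p, q, r}. y v *\<^sub>R \<psi> v)"
  shows "x = y"
proof -
  have d: "p \<noteq> q" "p \<noteq> r" "q \<noteq> r"
    using n by (auto simp: cross_refl)
  let ?a = "\<psi> q - \<psi> p" and ?b = "\<psi> r - \<psi> p"
  have s: "x p = 1 - x q - x r" "y p = 1 - y q - y r" using x(2) y(2) d by simp_all
  have "x p *\<^sub>R \<psi> p + x q *\<^sub>R \<psi> q + x r *\<^sub>R \<psi> r = y p *\<^sub>R \<psi> p + y q *\<^sub>R \<psi> q + y r *\<^sub>R \<psi> r"
    using eq d by (simp add: add.assoc)
  then have z: "(x q - y q) *\<^sub>R ?a + (x r - y r) *\<^sub>R ?b = 0"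
    unfolding s by (simp add: algebra_simps)
  have "cross3 ((x q - y q) *\<^sub>R ?a + (x r - y r) *\<^sub>R ?b) ?b = (x q - y q) *\<^sub>R cross3 ?a ?b"
    by (simp only: cross_add_left cross_mult_left cross_refl) simp
  then have "x q = y q" using n unfolding z by simp
  moreover have "cross3 ?a ((x q - y q) *\<^sub>R ?a + (x r - y r) *\<^sub>R ?b) = (x r - y r) *\<^sub>R cross3 ?a ?b"
    by (simp only: cross_add_right cross_mult_right cross_refl) simp
  then have "x r = y r" using n unfolding z by simp
  ultimately have "x v = y v" if "v \<in> {p, q, r}" for v using that s by auto
  moreover have "x v = y v" if "v \<notin> {p, q, r}" for v
  proof -
    have "x v = 0" "y v = 0" using that x(1) y(1) by auto
    then show ?thesis by simp
  qed
  ultimately show ?thesis by blast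
qed

lemma simplexwise_linear_facet:
  assumes "T \<in> set F" "{v. x v \<noteq> 0} \<subseteq> set T"
  shows "simplexwise_linear (complex_of F) \<psi> x = (\<Sum>v\<in>set T. x v *\<^sub>R \<psi> v)"
  unfolding simplexwise_linear_def complex_of_def vertices_generated
  using assms by (intro sum.mono_neutral_right) auto

text \<open>If the plane through \<open>\<psi> p\<close>, \<open>\<psi> q\<close>, \<open>\<psi> r\<close> weakly separates two facets, a common image point
  lies in that plane, hence comes from the independent points \<open>\<psi> p\<close>, \<open>\<psi> q\<close>, \<open>\<psi> r\<close> on both sides.\<close>

lemma separating_plane:
  fixes \<psi> :: "nat \<Rightarrow> real^3"
  assumes n: "n = cross3 (\<psi> q - \<psi> p) (\<psi> r - \<psi> p)" "n \<noteq> 0" "d = n \<bullet> \<psi> p"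
    and S: "\<And>v. v \<in> set S \<Longrightarrow> v \<in> {p, q, r} \<or> d < n \<bullet> \<psi> v"
    and T: "\<And>v. v \<in> set T \<Longrightarrow> v \<in> {p, q, r} \<or> n \<bullet> \<psi> v < d"
    and x: "\<And>v. 0 \<le> x v" "{v. x v \<noteq> 0} \<subseteq> set S" "sum x (set S) = 1"
    and y: "\<And>v. 0 \<le> y v" "{v. y v \<noteq> 0} \<subseteq> set T" "sum y (set T) = 1"
    and eq: "(\<Sum>v\<in>set S. x v *\<^sub>R \<psi> v) = (\<Sum>v\<in>set T. y v *\<^sub>R \<psi> v)"
  shows "x = y"
proof -
  have on: "n \<bullet> \<psi> v = d" if "v \<in> {p, q, r}" for v
  proof -
    have "n \<bullet> (\<psi> q - \<psi> p) = 0" "n \<bullet> (\<psi> r - \<psi> p) = 0"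
      unfolding n(1) by (simp_all add: dot_cross_self)
    then show ?thesis using that n(3) by (auto simp: inner_diff_right)
  qed
  \<comment> \<open>Weighted signed distances from the plane: \<open>S\<close> contributes
    nonnegative terms, \<open>T\<close> nonpositive ones, and a common image point makes the totals
    equal, so every term vanishes.\<close>
  have e: "n \<bullet> (\<Sum>v\<in>A. z v *\<^sub>R \<psi> v) - d * sum z A = (\<Sum>v\<in>A. z v * (n \<bullet> \<psi> v - d))" for A z
    by (simp add: inner_sum_right sum_distrib_left sum_subtractf[symmetric] algebra_simps)
  have S0: "0 \<le> x v * (n \<bullet> \<psi> v - d)" if "v \<in> set S" for v
    using S[OF that] on x(1)[of v] by (fastforce intro: mult_nonneg_nonneg)
  have T0: "0 \<le> y v * (d - n \<bullet> \<psi> v)" if "v \<in> set T" for v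
    using T[OF that] on y(1)[of v] by (fastforce intro: mult_nonneg_nonneg)
  have "(\<Sum>v\<in>set S. x v * (n \<bullet> \<psi> v - d)) = (\<Sum>v\<in>set T. y v * (n \<bullet> \<psi> v - d))"
    using e[where A = "set S" and z = x] e[where A = "set T" and z = y] x(3) y(3) eq by simp
  also have "\<dots> = - (\<Sum>v\<in>set T. y v * (d - n \<bullet> \<psi> v))"
    by (simp add: sum_negf[symmetric] algebra_simps)
  finally have "(\<Sum>v\<in>set S. x v * (n \<bullet> \<psi> v - d)) + (\<Sum>v\<in>set T. y v * (d - n \<bullet> \<psi> v)) = 0" by simp
  then have "(\<Sum>v\<in>set S. x v * (n \<bullet> \<psi> v - d)) = 0" "(\<Sum>v\<in>set T. y v * (d - n \<bullet> \<psi> v)) = 0"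
    using sum_nonneg[of "set S" "\<lambda>v. x v * (n \<bullet> \<psi> v - d)"] S0
      sum_nonneg[of "set T" "\<lambda>v. y v * (d - n \<bullet> \<psi> v)"] T0 by force+
  note zero = this
  have zx: "x v * (n \<bullet> \<psi> v - d) = 0" if "v \<in> set S" for v
    using sum_nonneg_eq_0_iff[of "set S" "\<lambda>v. x v * (n \<bullet> \<psi> v - d)"] S0 zero that by auto
  have zy: "y v * (d - n \<bullet> \<psi> v) = 0" if "v \<in> set T" for v
    using sum_nonneg_eq_0_iff[of "set T" "\<lambda>v. y v * (d - n \<bullet> \<psi> v)"] T0 zero that by auto
  \<comment> \<open>A vertex of positive weight lies in the plane, and among the vertices of the
    facet only spanning ones do.\<close>
  have sx: "{v. x v \<noteq> 0} \<subseteq> {p, q, r}"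
  proof
    fix v assume "v \<in> {v. x v \<noteq> 0}"
    then have "v \<in> set S" "x v \<noteq> 0" using x(2) by auto
    then show "v \<in> {p, q, r}" using zx[of v] S[of v] by auto
  qed
  have sy: "{v. y v \<noteq> 0} \<subseteq> {p, q, r}"
  proof
    fix v assume "v \<in> {v. y v \<noteq> 0}"
    then have "v \<in> set T" "y v \<noteq> 0" using y(2) by auto
    then show "v \<in> {p, q, r}" using zy[of v] T[of v] by auto
  qed
  have change: "sum f A = sum f {p, q, r}"
    if "{v. f v \<noteq> 0} \<subseteq> {p, q, r}" "{v. f v \<noteq> 0} \<subseteq> A" "finite A" for f :: "nat \<Rightarrow> 'b :: comm_monoid_add" and A
  proof -
    have "sum f A = sum f {v. f v \<noteq> 0}" using that by (intro sum.mono_neutral_right) auto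
    also have "\<dots> = sum f {p, q, r}" using that by (intro sum.mono_neutral_left) auto
    finally show ?thesis .
  qed
  have "sum x {p, q, r} = 1" "sum y {p, q, r} = 1"
    using change[OF sx x(2)] change[OF sy y(2)] x(3) y(3) by simp_all
  moreover have "(\<Sum>v\<in>{p, q, r}. x v *\<^sub>R \<psi> v) = (\<Sum>v\<in>{p, q, r}. y v *\<^sub>R \<psi> v)"
  proof -
    have "(\<Sum>v\<in>set S. x v *\<^sub>R \<psi> v) = (\<Sum>v\<in>{p, q, r}. x v *\<^sub>R \<psi> v)"
      using sx x(2) by (intro change) auto
    moreover have "(\<Sum>v\<in>set T. y v *\<^sub>R \<psi> v) = (\<Sum>v\<in>{p, q, r}. y v *\<^sub>R \<psi> v)"
      using sy y(2) by (intro change) auto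
    ultimately show ?thesis using eq by simp
  qed
  ultimately show ?thesis using three_points_independent[of \<psi> q p r x y] n(1,2) sx sy by simp
qed

lemma nth_all_vertex_sides:
  "i < length cs \<Longrightarrow> all_vertex_sides Ps v cs ! i = map (sides (v + i) (cs ! i)) Ps"
  by (induction cs arbitrary: v i) (auto simp: vertex_sides_def nth_Cons split: nat.split)

lemma facet_sides_map:
  assumes "is_triangle T" "length cs = 10"
  shows "facet_sides (all_vertex_sides Ps 0 cs) T =
    map (\<lambda>P. (\<forall>v\<in>set T. fst (sides v (cs ! v) P), \<forall>v\<in>set T. snd (sides v (cs ! v) P))) Ps"
  using assms by (elim is_triangleE) (simp add: meet_map nth_all_vertex_sides)

lemma embedded_imp_realization:
  assumes wf: "well_formed F" and emb: "embedded F cs ts"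
  shows "polyhedral_realization (complex_of F) (place cs)"
  unfolding polyhedral_realization_def
proof (rule inj_onI)
  let ?L = "simplexwise_linear (complex_of F) (place cs)"
  let ?Ps = "filter is_plane (map (plane cs) ts)"
  let ?R = "all_vertex_sides ?Ps 0 cs"
  have len: "length cs = 10" using emb by (simp add: embedded_def)
  have main: "x = y"
    if S: "S \<in> set F" "\<And>v. 0 \<le> x v" "{v. x v \<noteq> 0} \<subseteq> set S" "sum x (set S) = 1"
    and T: "T \<in> set F" "\<And>v. 0 \<le> y v" "{v. y v \<noteq> 0} \<subseteq> set T" "sum y (set T) = 1"
    and P: "P \<in> set ?Ps" "\<forall>v\<in>set S. fst (sides v (cs ! v) P)" "\<forall>v\<in>set T. snd (sides v (cs ! v) P)"
    and eq: "?L x = ?L y" for x y S T P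
  proof -
    obtain p q r where P': "P = plane cs (p, q, r)" "is_plane P" using P(1) by auto
    let ?n = "cross_int (minus3 (cs ! q) (cs ! p)) (minus3 (cs ! r) (cs ! p))"
    have "?n \<noteq> (0, 0, 0)" using P' by simp
    then have "vec3 ?n \<noteq> vec3 (0, 0, 0)" unfolding vec3_eq_iff .
    moreover have "vec3 (0, 0, 0) = 0" by (simp add: vec_eq_iff forall_3)
    ultimately have n0: "vec3 ?n \<noteq> 0" by simp
    have n: "vec3 ?n = cross3 (place cs q - place cs p) (place cs r - place cs p)"
      by (simp add: vec3_cross vec3_minus place_def)
    have d: "real_of_int (dot_int ?n (cs ! p)) = vec3 ?n \<bullet> place cs p" by (simp add: vec3_dot place_def)
    have c: "v \<in> {p, q, r} \<or> real_of_int (dot_int ?n (cs ! p)) < vec3 ?n \<bullet> place cs v" if "v \<in> set S" for v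
      using P(2) that unfolding P'(1) place_def vec3_dot[symmetric] by (auto split: if_splits)
    have c': "v \<in> {p, q, r} \<or> vec3 ?n \<bullet> place cs v < real_of_int (dot_int ?n (cs ! p))" if "v \<in> set T" for v
      using P(3) that unfolding P'(1) place_def vec3_dot[symmetric] by (auto split: if_splits)
    show "x = y"
      using separating_plane[OF n n0 d c c' S(2-4) T(2-4)] eq
      by (simp add: simplexwise_linear_facet[OF S(1,3)] simplexwise_linear_facet[OF T(1,3)])
  qed
  fix x y assume x: "x \<in> geom_points (complex_of F)" and y: "y \<in> geom_points (complex_of F)" and eq: "?L x = ?L y"
  obtain S where S: "S \<in> set F" "{v. x v \<noteq> 0} \<subseteq> set S" "sum x (set S) = 1" using complex_of_geomE[OF x] by metis
  obtain T where T: "T \<in> set F" "{v. y v \<noteq> 0} \<subseteq> set T" "sum y (set T) = 1" using complex_of_geomE[OF y] by metis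
  have pos: "\<And>v. 0 \<le> x v" "\<And>v. 0 \<le> y v" using x y by (auto simp: complex_of_geom)
  have "separated (facet_sides ?R S) (facet_sides ?R T) \<or> separated (facet_sides ?R T) (facet_sides ?R S)"
    using emb S(1) T(1) unfolding embedded_def embedded_wrt_def by (intro pairwise_separatedD) auto
  then obtain P where "P \<in> set ?Ps"
    "(\<forall>v\<in>set S. fst (sides v (cs ! v) P)) \<and> (\<forall>v\<in>set T. snd (sides v (cs ! v) P)) \<or>
     (\<forall>v\<in>set T. fst (sides v (cs ! v) P)) \<and> (\<forall>v\<in>set S. snd (sides v (cs ! v) P))"
    unfolding facet_sides_map[OF well_formedD(1)[OF wf S(1)] len] facet_sides_map[OF well_formedD(1)[OF wf T(1)] len]
      separated_map fst_conv snd_conv by blast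
  then show "x = y"
    using main[OF S(1) pos(1) S(2,3) T(1) pos(2) T(2,3)] main[OF T(1) pos(2) T(2,3) S(1) pos(1) S(2,3)] eq
    by metis
qed

section \<open>Symmetries\<close>

lemma induced_map_geom_points:
  assumes fin: "finite F" "\<And>T. T \<in> F \<Longrightarrow> finite T" and \<alpha>: "(\<lambda>T. \<alpha> ` T) ` F \<subseteq> F"
    and x: "x \<in> geom_points (generated F)"
  shows "induced_map (generated F) \<alpha> x \<in> geom_points (generated F)"
proof -
  let ?V = "\<Union>F" and ?y = "induced_map (generated F) \<alpha> x"
  have V: "finite ?V" using fin by blast
  obtain T where pos: "\<And>v. 0 \<le> x v" and T: "T \<in> F" "{v. x v \<noteq> 0} \<subseteq> T" and one: "sum x {v. x v \<noteq> 0} = 1"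
    using x geom_points_generated[OF fin] by metis
  have y: "?y w = (\<Sum>v\<in>{v \<in> ?V. \<alpha> v = w}. x v)" for w
    by (simp add: induced_map_def vertices_generated)
  have supp: "{w. ?y w \<noteq> 0} \<subseteq> \<alpha> ` T"
  proof
    fix w assume "w \<in> {w. ?y w \<noteq> 0}"
    then obtain v where "\<alpha> v = w" "x v \<noteq> 0" using y[of w] by (auto elim: sum.not_neutral_contains_not_neutral)
    then show "w \<in> \<alpha> ` T" using T(2) by auto
  qed
  have im: "\<alpha> ` ?V \<subseteq> ?V" using \<alpha> by blast
  have "{w. ?y w \<noteq> 0} \<subseteq> ?V" using supp T(1) im by blast
  then have "sum ?y {w. ?y w \<noteq> 0} = sum ?y ?V"
    using V by (intro sum.mono_neutral_left) auto
  also have "\<dots> = (\<Sum>w\<in>?V. \<Sum>v\<in>{v \<in> ?V. \<alpha> v = w}. x v)" by (intro sum.cong refl y)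
  also have "\<dots> = sum x ?V" by (rule sum.group[OF V V im])
  also have "\<dots> = sum x {v. x v \<noteq> 0}"
    using V T by (intro sum.mono_neutral_right) auto
  finally have "sum ?y {w. ?y w \<noteq> 0} = 1" using one by simp
  moreover have "0 \<le> ?y w" for w using y pos by (simp add: sum_nonneg)
  moreover have "\<alpha> ` T \<in> F" using \<alpha> T(1) by blast
  ultimately show ?thesis using geom_points_generated[OF fin, of ?y] supp by blast
qed

text \<open>Equivariance on vertices extends linearly and shows that the image is mapped into
  itself. Finite order turns this into equality, since \<open>g ^^ (k - 1)\<close> also preserves
  the image and inverts \<open>g\<close>.\<close>

lemma geometric_symmetriesI:
  assumes fin: "finite F" "\<And>T. T \<in> F \<Longrightarrow> finite T"
    and \<alpha>: "inj_on \<alpha> (\<Union>F)" "(\<lambda>T. \<alpha> ` T) ` F \<subseteq> F"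
    and g: "linear g" "\<And>x. norm (g x) = norm x" and k: "0 < k" "g ^^ k = id"
    and \<psi>: "\<And>v. v \<in> \<Union>F \<Longrightarrow> \<psi> (\<alpha> v) = g (\<psi> v)"
  shows "g \<in> geometric_symmetries (generated F) \<psi>"
proof -
  let ?K = "generated F" and ?V = "\<Union>F"
  let ?L = "simplexwise_linear ?K \<psi>"
  have V: "finite ?V" using fin by blast
  have im: "\<alpha> ` ?V \<subseteq> ?V" using \<alpha>(2) by blast
  \<comment> \<open>An injective self-map of a finite set is onto; the same argument serves below
    for the set of simplices.\<close>
  have "\<alpha> ` ?V = ?V" using V im \<alpha>(1) by (rule endo_inj_surj)
  then have bij: "bij_betw \<alpha> ?V ?V" using \<alpha>(1) by (simp add: bij_betw_def)
  have "inj_on (\<lambda>T. \<alpha> ` T) ?K"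
    by (rule inj_on_subset[OF inj_on_image_Pow[OF \<alpha>(1)]]) (auto simp: generated_def)
  moreover have "(\<lambda>T. \<alpha> ` T) ` ?K \<subseteq> ?K"
  proof (rule image_subsetI)
    fix \<sigma> assume "\<sigma> \<in> ?K"
    then obtain T where "\<sigma> \<noteq> {}" "\<sigma> \<subseteq> T" "T \<in> F" by (auto simp: generated_def)
    then show "\<alpha> ` \<sigma> \<in> ?K" using \<alpha>(2) by (auto simp: generated_def intro!: bexI[of _ "\<alpha> ` T"])
  qed
  ultimately have "(\<lambda>T. \<alpha> ` T) ` ?K = ?K" using finite_generated[OF fin] by (intro endo_inj_surj)
  then have iso: "simplicial_iso \<alpha> ?K ?K" using bij by (simp add: simplicial_iso_def vertices_generated)
  have eqv: "g (?L x) = ?L (induced_map ?K \<alpha> x)" for x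
  proof -
    have "?L (induced_map ?K \<alpha> x) = (\<Sum>w\<in>?V. \<Sum>v\<in>{v \<in> ?V. \<alpha> v = w}. x v *\<^sub>R \<psi> (\<alpha> v))"
      by (simp add: simplexwise_linear_def induced_map_def vertices_generated scaleR_sum_left)
    also have "\<dots> = (\<Sum>v\<in>?V. x v *\<^sub>R \<psi> (\<alpha> v))" by (rule sum.group[OF V V im])
    also have "\<dots> = (\<Sum>v\<in>?V. g (x v *\<^sub>R \<psi> v))" using \<psi> g(1) by (simp add: linear_cmul)
    also have "\<dots> = g (?L x)"
      using g(1) by (simp add: simplexwise_linear_def vertices_generated linear_sum)
    finally show ?thesis by simp
  qed
  let ?S = "?L ` geom_points ?K"
  have sub: "g ` ?S \<subseteq> ?S"
    using eqv induced_map_geom_points[OF fin \<alpha>(2)] by (auto simp: image_iff)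
  have pow: "(g ^^ j) ` ?S \<subseteq> ?S" for j
  proof (induction j)
    case (Suc j)
    then have "g ` ((g ^^ j) ` ?S) \<subseteq> ?S" using sub by blast
    moreover have "(g ^^ Suc j) ` ?S = g ` ((g ^^ j) ` ?S)" by (simp add: image_image)
    ultimately show ?case by simp
  qed simp
  obtain j where j: "k = Suc j" using k(1) by (cases k) auto
  have "g ((g ^^ j) y) = y" for y
    using fun_cong[OF k(2)[unfolded j], of y] by simp
  then have "?S = g ` ((g ^^ j) ` ?S)" by (simp add: image_image)
  also have "\<dots> \<subseteq> g ` ?S" using pow by (rule image_mono)
  finally have "g ` ?S = ?S" using sub by (rule subset_antisym[rotated])
  moreover have "dist (g x) (g y) = dist x y" for x y
    using g by (simp add: dist_norm linear_diff[symmetric])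
  ultimately show ?thesis
    unfolding geometric_symmetries_def using iso eqv by blast
qed

text \<open>The vertices of a realization are distinct points, so the automorphism induced by a symmetry
  is recovered from the coordinates.\<close>

definition vertex_at :: "point list \<Rightarrow> point \<Rightarrow> nat" where
  "vertex_at cs p = length (takeWhile (\<lambda>q. q \<noteq> p) cs)"

definition preserves :: "nat list list \<Rightarrow> nat list \<Rightarrow> nat list \<Rightarrow> bool" where
  "preserves F \<alpha> T \<longleftrightarrow> sort (map ((!) \<alpha>) T) \<in> set F"

definition automorphism :: "nat list list \<Rightarrow> nat list \<Rightarrow> bool" where
  "automorphism F \<alpha> \<longleftrightarrow> distinct \<alpha> \<and> list_all (preserves F \<alpha>) F"

definition keeps :: "(point \<Rightarrow> point) \<Rightarrow> point list \<Rightarrow> point \<Rightarrow> bool" where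
  "keeps g cs p \<longleftrightarrow> g p \<in> set cs"

definition symmetric :: "(point \<Rightarrow> point) \<Rightarrow> nat list list \<Rightarrow> point list \<Rightarrow> bool" where
  "symmetric g F cs \<longleftrightarrow> length cs = 10 \<and> list_all (keeps g cs) cs \<and>
     automorphism F (map (vertex_at cs) (map g cs))"

lemma nth_vertex_at:
  assumes "p \<in> set cs"
  shows "cs ! vertex_at cs p = p"
  using assms by (induction cs) (auto simp: vertex_at_def)

lemma symmetric_imp:
  assumes wf: "well_formed F" and sym: "symmetric f F cs"
    and g: "linear g" "\<And>x. norm (g x) = norm x" "0 < k" "g ^^ k = id"
    and fg: "\<And>p. vec3 (f p) = g (vec3 p)"
  shows "g \<in> geometric_symmetries (complex_of F) (place cs)"
proof -
  let ?\<alpha> = "map (vertex_at cs) (map f cs)"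
  have V: "\<Union>(set ` set F) = {..<10}" by (rule well_formedD(3)[OF wf])
  have a: "distinct ?\<alpha>" "length cs = 10" "\<And>T. T \<in> set F \<Longrightarrow> sort (map ((!) ?\<alpha>) T) \<in> set F"
    and c: "\<And>c. c \<in> set cs \<Longrightarrow> f c \<in> set cs"
    using sym by (auto simp: symmetric_def automorphism_def list_all_iff preserves_def keeps_def)
  show ?thesis
    unfolding complex_of_def
  proof (rule geometric_symmetriesI[where \<alpha> = "(!) ?\<alpha>" and k = k])
    show "inj_on ((!) ?\<alpha>) (\<Union>(set ` set F))"
      unfolding V using a(1,2) by (intro inj_on_nth) auto
    show "(`) ((!) ?\<alpha>) ` set ` set F \<subseteq> set ` set F"
    proof (rule image_subsetI)
      fix X assume "X \<in> set ` set F"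
      then obtain T where T: "T \<in> set F" "X = set T" by blast
      then have "(!) ?\<alpha> ` X = set (sort (map ((!) ?\<alpha>) T))" by simp
      then show "(!) ?\<alpha> ` X \<in> set ` set F" using a(3)[OF T(1)] by (rule image_eqI)
    qed
    fix v assume "v \<in> \<Union>(set ` set F)"
    then have v: "v < length cs" unfolding V a(2) by simp
    then show "place cs (?\<alpha> ! v) = g (place cs v)"
      using nth_vertex_at[OF c, of "cs ! v"] by (simp add: place_def fg)
  qed (use g in auto)
qed

section \<open>The isometries as signed permutations of the coordinates\<close>

fun half_turn_x :: "point \<Rightarrow> point" where "half_turn_x (a, b, c) = (a, - b, - c)"
fun half_turn_y :: "point \<Rightarrow> point" where "half_turn_y (a, b, c) = (- a, b, - c)"
fun half_turn_z :: "point \<Rightarrow> point" where "half_turn_z (a, b, c) = (- a, - b, c)"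
fun third_turn :: "point \<Rightarrow> point" where "third_turn (a, b, c) = (c, a, b)"
fun quarter_turn_reflection :: "point \<Rightarrow> point" where "quarter_turn_reflection (a, b, c) = (- b, a, - c)"

lemma axis_3: "axis i 1 $ j = (if i = j then 1 else 0 :: real)" by (simp add: axis_def)

lemma linear_rotation_about_0: "linear (rotation_about 0 u \<theta>)"
  by (rule linearI) (simp_all add: rotation_about_def cross_add_right cross_mult_right algebra_simps inner_add_right)

lemma half_turn:
  fixes i :: 3
  shows "rotation_about 0 (axis i 1) pi x = (\<chi> j. if j = i then x $ j else - x $ j)"
  by (simp add: rotation_about_def vec_eq_iff inner_axis' axis_3)

lemma norm_eqI: "(\<And>x. x \<bullet> x = g x \<bullet> g x) \<Longrightarrow> norm (g x) = norm x" for g :: "real^3 \<Rightarrow> real^3"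
  by (simp add: norm_eq_sqrt_inner)

lemma half_turn_order:
  fixes i :: 3
  shows "rotation_about 0 (axis i 1) pi ^^ 2 = id" "rotation_about 0 (axis i 1) pi \<noteq> id"
proof -
  show "rotation_about 0 (axis i 1) pi ^^ 2 = id"
    by (simp add: fun_eq_iff half_turn numeral_2_eq_2 vec_eq_iff)
  \<comment> \<open>A coordinate direction other than that of the axis is reversed by the
    half-turn.\<close>
  define j :: 3 where "j = (if i = 1 then 2 else 1)"
  have "j \<noteq> i" by (simp add: j_def)
  then have "rotation_about 0 (axis i 1) pi (axis j 1) \<noteq> axis j 1"
    by (auto simp: half_turn vec_eq_iff axis_3)
  then show "rotation_about 0 (axis i 1) pi \<noteq> id" by (metis id_apply)
qed

lemma half_turn_norm: "norm (rotation_about 0 (axis (i :: 3) 1) pi x) = norm x"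
  by (rule norm_eqI) (simp add: half_turn inner_vec_def sum_3)

lemma vec3_half_turns:
  "vec3 (half_turn_x p) = rotation_about 0 (axis 1 1) pi (vec3 p)"
  "vec3 (half_turn_y p) = rotation_about 0 (axis 2 1) pi (vec3 p)"
  "vec3 (half_turn_z p) = rotation_about 0 (axis 3 1) pi (vec3 p)"
  by (cases p; simp add: half_turn vec_eq_iff forall_3)+

lemma half_turn_rotation: "rotation_of_order 2 (rotation_about 0 (axis (i :: 3) 1) pi)"
proof -
  let ?g = "rotation_about 0 (axis i 1) pi"
  have "has_order ?g 2"
    unfolding has_order_def
  proof (intro conjI allI impI)
    fix j :: nat assume "0 < j" "j < 2"
    then have "j = 1" by simp
    then show "?g ^^ j \<noteq> id" using half_turn_order(2) by simp
  qed (simp_all add: half_turn_order(1))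
  moreover have "norm (axis i 1 :: real^3) = 1" by simp
  ultimately show ?thesis unfolding rotation_of_order_def by blast
qed

text \<open>The axis is the diagonal of the positive octant, about which a third of a turn permutes
  the coordinates cyclically.\<close>

definition third_turn_map :: "real^3 \<Rightarrow> real^3" where
  "third_turn_map = rotation_about 0 (vector [1 / sqrt 3, 1 / sqrt 3, 1 / sqrt 3]) (2 * pi / 3)"

lemma third_turn_map: "third_turn_map x = vector [x $ 3, x $ 1, x $ 2]"
proof -
  have s: "sin (2 * pi / 3) = sqrt 3 / 2" "cos (2 * pi / 3) = - 1 / 2"
    using sin_120 cos_120 by simp_all
  have r: "sqrt 3 * (sqrt 3 * y) = 3 * y" for y by (simp flip: mult.assoc)
  show ?thesis
    unfolding third_turn_map_def rotation_about_def s
    by (simp add: vec_eq_iff forall_3 cross3_def inner_vec_def sum_3 field_simps r)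
qed

lemma third_turn_rotation: "rotation_of_order 3 third_turn_map"
proof -
  have 3: "third_turn_map ^^ 3 = id"
    by (simp add: fun_eq_iff third_turn_map numeral_3_eq_3 vec_eq_iff forall_3)
  \<comment> \<open>The first unit vector has an orbit of length three, which excludes the orders 1
    and 2.\<close>
  have "third_turn_map (vector [1, 0, 0]) \<noteq> vector [1, 0, 0]"
    "third_turn_map (third_turn_map (vector [1, 0, 0])) \<noteq> vector [1, 0, 0]"
    by (simp_all add: third_turn_map vec_eq_iff forall_3)
  then have "third_turn_map ^^ 1 \<noteq> id" "third_turn_map ^^ 2 \<noteq> id"
    by (auto simp: fun_eq_iff numeral_2_eq_2)
  moreover have "j = 1 \<or> j = 2" if "0 < j" "j < 3" for j :: nat using that by auto
  moreover have "norm (vector [1 / sqrt 3, 1 / sqrt 3, 1 / sqrt 3] :: real^3) = 1"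
    by (simp add: norm_eq_1 inner_vec_def sum_3)
  ultimately show ?thesis
    unfolding rotation_of_order_def has_order_def using 3 third_turn_map_def by (metis zero_less_numeral)
qed

definition quarter_turn_reflection_map :: "real^3 \<Rightarrow> real^3" where
  "quarter_turn_reflection_map =
     reflection_in_plane 0 (axis 3 1) \<circ> rotation_about 0 (axis 3 1) (pi / 2)"

lemma quarter_turn_reflection_map: "quarter_turn_reflection_map x = vector [- x $ 2, x $ 1, - x $ 3]"
  by (simp add: quarter_turn_reflection_map_def reflection_in_plane_def rotation_about_def
      vec_eq_iff forall_3 cross3_def inner_axis' axis_3)

lemma quarter_turn_reflection_order: "quarter_turn_reflection_map ^^ 4 = id"
  by (simp add: fun_eq_iff quarter_turn_reflection_map eval_nat_numeral vec_eq_iff forall_3)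

lemma linear_vector: "linear third_turn_map" "linear quarter_turn_reflection_map"
  by (rule linearI; simp add: third_turn_map quarter_turn_reflection_map vec_eq_iff forall_3)+

lemma norm_vector: "norm (third_turn_map x) = norm x" "norm (quarter_turn_reflection_map x) = norm x"
  by (rule norm_eqI; simp add: third_turn_map quarter_turn_reflection_map inner_vec_def sum_3)+

lemma vec3_turns:
  "vec3 (third_turn p) = third_turn_map (vec3 p)"
  "vec3 (quarter_turn_reflection p) = quarter_turn_reflection_map (vec3 p)"
  by (cases p; simp add: third_turn_map quarter_turn_reflection_map vec_eq_iff forall_3)+

lemma half_turn_symmetry:
  assumes "well_formed F" "symmetric f F cs" "\<And>p. vec3 (f p) = rotation_about 0 (axis i 1) pi (vec3 p)"
  shows "rotation_about 0 (axis i 1) pi \<in> geometric_symmetries (complex_of F) (place cs)"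
  using symmetric_imp[OF assms(1,2) linear_rotation_about_0 half_turn_norm _ half_turn_order(1) assms(3)] by simp

lemma rotational_symmetry_2:
  assumes "well_formed F" "symmetric half_turn_z F cs"
  shows "rotational_symmetry 2 (complex_of F) (place cs)"
  unfolding rotational_symmetry_def
  using half_turn_symmetry[OF assms vec3_half_turns(3)] half_turn_rotation by blast

lemma rotational_symmetry_3:
  assumes "well_formed F" "symmetric third_turn F cs"
  shows "rotational_symmetry 3 (complex_of F) (place cs)"
  unfolding rotational_symmetry_def
  using symmetric_imp[OF assms linear_vector(1) norm_vector(1) _ _ vec3_turns(1), of 3] third_turn_rotation
  by (auto simp: rotation_of_order_def has_order_def)

lemma rotation_reflection_4_symmetry:
  assumes "well_formed F" "symmetric quarter_turn_reflection F cs"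
  shows "rotation_reflection_4_symmetry (complex_of F) (place cs)"
proof -
  have "rotation_reflection_4 quarter_turn_reflection_map"
    unfolding rotation_reflection_4_def quarter_turn_reflection_map_def by (metis norm_axis_1)
  then show ?thesis
    unfolding rotation_reflection_4_symmetry_def
    using symmetric_imp[OF assms linear_vector(2) norm_vector(2) _ quarter_turn_reflection_order vec3_turns(2)]
    by auto
qed

lemma id_symmetry:
  assumes "well_formed F"
  shows "id \<in> geometric_symmetries (complex_of F) \<psi>"
  unfolding complex_of_def
  by (rule geometric_symmetriesI[where \<alpha> = id and k = 1]) (auto simp: linear_id)

lemma D2_symmetry:
  assumes "well_formed F" "symmetric half_turn_x F cs" "symmetric half_turn_y F cs" "symmetric half_turn_z F cs"
  shows "D2_symmetry (complex_of F) (place cs)"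
proof -
  let ?r = "\<lambda>i :: 3. rotation_about 0 (axis i 1) pi"
  have "dihedral_D2 {id, ?r 1, ?r 2, ?r 3}"
    unfolding dihedral_D2_def
    by (intro exI[of _ 0] exI[of _ "axis 1 1"] exI[of _ "axis 2 1"] exI[of _ "axis 3 1"])
      (simp add: norm_axis_1 orthogonal_def inner_axis_axis)
  moreover have "{id, ?r 1, ?r 2, ?r 3} \<subseteq> geometric_symmetries (complex_of F) (place cs)"
    using id_symmetry[OF assms(1)] half_turn_symmetry[OF assms(1)] assms(2-4) vec3_half_turns by auto
  ultimately show ?thesis unfolding D2_symmetry_def by blast
qed

section \<open>An isomorphism invariant\<close>

text \<open>Iterating sums of vertex degrees over facets does not separate all 57 triangulations; using the
  degrees of the vertices opposite to the edges of a facet does.\<close>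

definition degree :: "'v set set \<Rightarrow> 'v \<Rightarrow> nat" where
  "degree \<F> v = (\<Sum>\<sigma>\<in>\<F>. if v \<in> \<sigma> then 1 else 0)"

definition apex_degrees :: "'v set set \<Rightarrow> 'v set \<Rightarrow> nat" where
  "apex_degrees \<F> \<sigma> = (\<Sum>\<tau>\<in>\<F>. if card (\<tau> \<inter> \<sigma>) = 2 then \<Sum>v\<in>\<tau> - \<sigma>. degree \<F> v else 0)"

definition weight :: "'v set set \<Rightarrow> 'v \<Rightarrow> nat" where
  "weight \<F> v = (\<Sum>\<sigma>\<in>\<F>. \<Sum>\<tau>\<in>\<F>. if card (\<tau> \<inter> \<sigma>) = 2 \<and> v \<in> \<tau> - \<sigma> then (apex_degrees \<F> \<sigma>)\<^sup>2 else 0)"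

text \<open>Without the square this would be the sum of degree times weight over the vertices; the
  square also records which weights meet in a facet.\<close>

definition invariant :: "'v set set \<Rightarrow> nat" where
  "invariant \<F> = (\<Sum>\<sigma>\<in>\<F>. (\<Sum>v\<in>\<sigma>. weight \<F> v)\<^sup>2)"

text \<open>Membership, intersections, differences and cardinalities are all that the definitions
  use, and an injective map preserves each of them.\<close>

lemma invariant_image:
  assumes inj: "inj_on \<alpha> (\<Union>\<F>)"
  shows "invariant ((`) \<alpha> ` \<F>) = invariant \<F>"
proof -
  let ?G = "(`) \<alpha> ` \<F>"
  have I: "inj_on ((`) \<alpha>) \<F>" using inj by (rule inj_on_image)
  have sub: "inj_on \<alpha> \<sigma>" if "\<sigma> \<subseteq> \<Union>\<F>" for \<sigma> using inj that by (rule inj_on_subset)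
  have mem: "\<alpha> v \<in> \<alpha> ` \<sigma> \<longleftrightarrow> v \<in> \<sigma>" if "v \<in> \<Union>\<F>" "\<sigma> \<in> \<F>" for v \<sigma>
    using that by (intro inj_on_image_mem_iff[OF inj]) auto
  have int: "card (\<alpha> ` \<tau> \<inter> \<alpha> ` \<sigma>) = card (\<tau> \<inter> \<sigma>)" if "\<sigma> \<in> \<F>" "\<tau> \<in> \<F>" for \<sigma> \<tau>
  proof -
    have "\<alpha> ` \<tau> \<inter> \<alpha> ` \<sigma> = \<alpha> ` (\<tau> \<inter> \<sigma>)"
      using that by (intro inj_on_image_Int[symmetric, OF inj]) auto
    moreover have "inj_on \<alpha> (\<tau> \<inter> \<sigma>)" using that by (intro sub) auto
    ultimately show ?thesis by (simp add: card_image)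
  qed
  have diff: "\<alpha> ` \<tau> - \<alpha> ` \<sigma> = \<alpha> ` (\<tau> - \<sigma>)" if "\<sigma> \<in> \<F>" "\<tau> \<in> \<F>" for \<sigma> \<tau>
    using that by (intro inj_on_image_set_diff[symmetric, OF inj]) auto
  have deg: "degree ?G (\<alpha> v) = degree \<F> v" if "v \<in> \<Union>\<F>" for v
    unfolding degree_def sum.reindex[OF I] comp_def using mem[OF that] by (intro sum.cong) auto
  have apex: "apex_degrees ?G (\<alpha> ` \<sigma>) = apex_degrees \<F> \<sigma>" if "\<sigma> \<in> \<F>" for \<sigma>
  proof -
    have "sum (degree ?G) (\<alpha> ` \<tau> - \<alpha> ` \<sigma>) = sum (degree \<F>) (\<tau> - \<sigma>)" if "\<tau> \<in> \<F>" for \<tau>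
    proof -
      have "inj_on \<alpha> (\<tau> - \<sigma>)" using that by (intro sub) auto
      then show ?thesis
        unfolding diff[OF \<open>\<sigma> \<in> \<F>\<close> that] using that deg by (subst sum.reindex) (auto intro!: sum.cong)
    qed
    then show ?thesis
      unfolding apex_degrees_def sum.reindex[OF I] comp_def using int that by (intro sum.cong) auto
  qed
  have weight: "weight ?G (\<alpha> v) = weight \<F> v" if v: "v \<in> \<Union>\<F>" for v
    unfolding weight_def sum.reindex[OF I] comp_def
  proof (intro sum.cong refl)
    fix \<sigma> \<tau> assume st: "\<sigma> \<in> \<F>" "\<tau> \<in> \<F>"
    have "\<alpha> v \<in> \<alpha> ` \<tau> - \<alpha> ` \<sigma> \<longleftrightarrow> v \<in> \<tau> - \<sigma>" using mem[OF v] st by blast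
    then show "(if card (\<alpha> ` \<tau> \<inter> \<alpha> ` \<sigma>) = 2 \<and> \<alpha> v \<in> \<alpha> ` \<tau> - \<alpha> ` \<sigma> then (apex_degrees ?G (\<alpha> ` \<sigma>))\<^sup>2 else 0)
      = (if card (\<tau> \<inter> \<sigma>) = 2 \<and> v \<in> \<tau> - \<sigma> then (apex_degrees \<F> \<sigma>)\<^sup>2 else 0)"
      using int[OF st] apex[OF st(1)] by simp
  qed
  have "sum (weight ?G) (\<alpha> ` \<sigma>) = sum (weight \<F>) \<sigma>" if "\<sigma> \<in> \<F>" for \<sigma>
    using that weight sub[of \<sigma>] by (subst sum.reindex) (auto intro!: sum.cong)
  then show ?thesis
    unfolding invariant_def sum.reindex[OF I] comp_def by (intro sum.cong) auto
qed

text \<open>The facets are recovered from the complex alone, so an isomorphism of complexes must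
  match facets, and the invariant becomes one of complexes.\<close>

lemma facets_complex_of:
  assumes "well_formed F"
  shows "{\<sigma> \<in> complex_of F. card \<sigma> = 3} = set ` set F"
proof -
  have t: "card (set T) = 3" if "T \<in> set F" for T
    using card_triangle well_formedD(1)[OF assms that] by blast
  have "\<sigma> = set T" if "\<sigma> \<subseteq> set T" "card \<sigma> = 3" "T \<in> set F" for \<sigma> T
    using that t by (intro card_subset_eq) auto
  then have "\<sigma> \<in> set ` set F" if "\<sigma> \<in> complex_of F" "card \<sigma> = 3" for \<sigma>
    using that unfolding complex_of_def generated_def by blast
  moreover have "set T \<in> complex_of F" if "T \<in> set F" for T
    using that t[OF that] by (auto simp: complex_of_def generated_def)
  ultimately show ?thesis using t by blast
qed

lemma isomorphic_imp_invariant_eq: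
  assumes F: "well_formed F" and G: "well_formed G"
    and iso: "isomorphic_complexes (complex_of F) (complex_of G)"
  shows "invariant (set ` set F) = invariant (set ` set G)"
proof -
  obtain \<alpha> where \<alpha>: "bij_betw \<alpha> (vertices (complex_of F)) (vertices (complex_of G))"
      "(\<lambda>\<sigma>. \<alpha> ` \<sigma>) ` complex_of F = complex_of G"
    using iso unfolding isomorphic_complexes_def simplicial_iso_def by blast
  have inj: "inj_on \<alpha> (\<Union>(set ` set F))"
    using bij_betw_imp_inj_on[OF \<alpha>(1)] by (simp add: complex_of_def vertices_generated)
  have c: "card (\<alpha> ` \<sigma>) = card \<sigma>" if "\<sigma> \<in> complex_of F" for \<sigma>
    using that by (intro card_image inj_on_subset[OF inj]) (auto simp: complex_of_def generated_def)
  have "{\<sigma> \<in> complex_of G. card \<sigma> = 3} = (`) \<alpha> ` {\<sigma> \<in> complex_of F. card \<sigma> = 3}"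
    unfolding \<alpha>(2)[symmetric] using c by auto
  then have "set ` set G = (`) \<alpha> ` set ` set F" unfolding facets_complex_of[OF F] facets_complex_of[OF G] .
  then show ?thesis using invariant_image[OF inj] by simp
qed

section \<open>Evaluating the invariant on facet lists\<close>

definition adjacent :: "nat list \<Rightarrow> nat list \<Rightarrow> bool" where
  "adjacent T S \<longleftrightarrow> length (filter (List.member T) S) = 2"

text \<open>Neighbours, and later apex degrees, are attached to each facet once, so that the nested
  sums do not recompute them.\<close>

definition with_neighbours :: "nat list list \<Rightarrow> nat list \<Rightarrow> nat list \<times> nat list list" where
  "with_neighbours F T = (T, filter (adjacent T) F)"

definition degree_in :: "nat list list \<Rightarrow> nat \<Rightarrow> nat" where
  "degree_in F v = length (filter (contains v) F)"

definition apex_term :: "nat list \<Rightarrow> nat list \<Rightarrow> nat \<Rightarrow> nat" where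
  "apex_term ds T u = (if List.member T u then 0 else ds ! u)"

definition facet_term :: "nat list \<Rightarrow> nat list \<Rightarrow> nat list \<Rightarrow> nat" where
  "facet_term ds T S = sum_list (map (apex_term ds T) S)"

fun with_apex_degrees :: "nat list \<Rightarrow> nat list \<times> nat list list \<Rightarrow> nat list \<times> nat list list \<times> nat" where
  "with_apex_degrees ds (T, N) = (T, N, sum_list (map (facet_term ds T) N))"

fun weight_term :: "nat \<Rightarrow> nat list \<times> nat list list \<times> nat \<Rightarrow> nat" where
  "weight_term v (T, N, a) = (if List.member T v then 0 else length (filter (contains v) N) * a * a)"

definition weight_in :: "(nat list \<times> nat list list \<times> nat) list \<Rightarrow> nat \<Rightarrow> nat" where
  "weight_in W v = sum_list (map (weight_term v) W)"

definition square :: "nat \<Rightarrow> nat" where "square x = x * x"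

definition square_term :: "nat list \<Rightarrow> nat list \<Rightarrow> nat" where
  "square_term ws T = square (sum_list (map ((!) ws) T))"

definition square_sum :: "nat list list \<Rightarrow> (nat list \<times> nat list list \<times> nat) list \<Rightarrow> nat" where
  "square_sum F W = sum_list (map (square_term (map (weight_in W) [0..<10])) F)"

definition invariant_list :: "nat list list \<Rightarrow> nat" where
  "invariant_list F = square_sum F (map
     (with_apex_degrees (map (degree_in F) [0..<10])) (map (with_neighbours F) F))"

text \<open>Facets are distinct increasing lists, so sums over sets of facets or vertices are list
  sums without repetition; the stages of the computation are matched one by one.\<close>

lemma invariant_list:
  assumes F: "well_formed F"
  shows "invariant_list F = invariant (set ` set F)"
proof -
  have tri: "distinct T" "sorted T" "set T \<subseteq> {..<10}" if "T \<in> set F" for T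
    using well_formedD(1)[OF F that] by (auto elim!: is_triangleE)
  have I: "inj_on set (set F)" using tri by (auto simp: inj_on_def intro: sorted_distinct_set_unique)
  have S: "(\<Sum>\<sigma>\<in>set ` set F. f \<sigma>) = (\<Sum>T\<leftarrow>F. f (set T))" for f :: "nat set \<Rightarrow> nat"
    using well_formedD(2)[OF F] by (simp add: sum.reindex[OF I] sum_list_distinct_conv_sum_set)
  have s: "sum f (set T) = (\<Sum>v\<leftarrow>T. f v)" if "T \<in> set F" for f :: "nat \<Rightarrow> nat" and T
    using tri(1)[OF that] by (simp add: sum_list_distinct_conv_sum_set)
  have len: "length (filter P xs) = (\<Sum>x\<leftarrow>xs. if P x then 1 else 0)" for P and xs :: "'z list"
    by (induction xs) auto
  have filt: "(\<Sum>x\<leftarrow>filter P xs. f x) = (\<Sum>x\<leftarrow>xs. if P x then f x else 0)" for P and f :: "'z \<Rightarrow> nat" and xs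
    by (induction xs) auto
  have deg: "degree_in F v = degree (set ` set F) v" for v
    by (simp add: degree_def degree_in_def contains_def S len)
  define ds where "ds = map (degree_in F) [0..<10]"
  have ds: "ds ! v = degree (set ` set F) v" if "v < 10" for v
    using that deg by (simp add: ds_def)
  have adj: "adjacent T S \<longleftrightarrow> card (set S \<inter> set T) = 2" if "S \<in> set F" for S T
  proof -
    have "card (set (filter (List.member T) S)) = length (filter (List.member T) S)"
      using tri(1)[OF that] by (intro distinct_card) simp
    moreover have "set (filter (List.member T) S) = set S \<inter> set T" by auto
    ultimately show ?thesis by (simp add: adjacent_def)
  qed
  let ?N = "\<lambda>T. filter (adjacent T) F"
  have diff: "facet_term ds T S = sum (degree (set ` set F)) (set S - set T)"
    if "S \<in> set F" for S T
  proof -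
    have "facet_term ds T S = (\<Sum>u\<in>set S. if u \<in> set T then 0 else ds ! u)"
      using s[OF that] by (simp add: facet_term_def apex_term_def[abs_def])
    also have "\<dots> = (\<Sum>u\<in>set S - set T. ds ! u)"
      by (intro sum.mono_neutral_cong_right) auto
    also have "\<dots> = sum (degree (set ` set F)) (set S - set T)"
      using tri(3)[OF that] ds by (intro sum.cong) auto
    finally show ?thesis .
  qed
  have apex: "with_apex_degrees ds (T, ?N T) = (T, ?N T, apex_degrees (set ` set F) (set T))" for T
    unfolding apex_degrees_def S with_apex_degrees.simps filt using adj diff
    by (auto intro!: arg_cong[where f = sum_list] map_cong)
  define W where "W = map (with_apex_degrees ds) (map (with_neighbours F) F)"
  have W: "W = map (\<lambda>T. (T, ?N T, apex_degrees (set ` set F) (set T))) F"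
    using apex by (simp add: W_def with_neighbours_def)
  have wt: "weight_in W v = weight (set ` set F) v" for v
  proof -
    have "weight_term v (T, ?N T, apex_degrees (set ` set F) (set T)) =
      (\<Sum>S\<leftarrow>F. if card (set S \<inter> set T) = 2 \<and> v \<in> set S - set T
         then (apex_degrees (set ` set F) (set T))\<^sup>2 else 0)" for T
    proof (cases "v \<in> set T")
      case False
      \<comment> \<open>All neighbours of \<open>T\<close> containing \<open>v\<close> contribute
        the same square, so the inner sum is their number times that square.\<close>
      have "length (filter (contains v) (?N T)) * a =
          (\<Sum>S\<leftarrow>F. if card (set S \<inter> set T) = 2 \<and> v \<in> set S then a else 0)" for a
      proof -
        have "filter (contains v) (?N T) = filter (\<lambda>S. card (set S \<inter> set T) = 2 \<and> v \<in> set S) F"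
          using adj by (auto simp: contains_def intro!: filter_cong)
        moreover have "length (filter P xs) * a = (\<Sum>x\<leftarrow>xs. if P x then a else 0)"
          for P and xs :: "nat list list" by (induction xs) auto
        ultimately show ?thesis by simp
      qed
      from this[of "(apex_degrees (set ` set F) (set T))\<^sup>2"] show ?thesis
        using False by (simp add: power2_eq_square mult.assoc)
    qed simp
    then show ?thesis unfolding W weight_in_def weight_def S by (simp add: comp_def)
  qed
  let ?ws = "map (weight_in W) [0..<10]"
  have ws: "?ws ! v = weight (set ` set F) v" if "v < 10" for v
    using that wt by simp
  have "invariant_list F = (\<Sum>T\<leftarrow>F. (\<Sum>v\<leftarrow>T. ?ws ! v)\<^sup>2)"
    unfolding invariant_list_def square_sum_def W_def[symmetric] ds_def[symmetric]
    by (simp add: square_def power2_eq_square square_term_def[abs_def])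
  also have "\<dots> = (\<Sum>T\<leftarrow>F. (sum (weight (set ` set F)) (set T))\<^sup>2)"
  proof (intro arg_cong[where f = sum_list] map_cong refl)
    fix T assume T: "T \<in> set F"
    have "(\<Sum>v\<leftarrow>T. ?ws ! v) = (\<Sum>v\<in>set T. ?ws ! v)" using s[OF T] by simp
    also have "\<dots> = sum (weight (set ` set F)) (set T)"
      using tri(3)[OF T] ws by (intro sum.cong) auto
    finally show "(\<Sum>v\<leftarrow>T. ?ws ! v)\<^sup>2 = (sum (weight (set ` set F)) (set T))\<^sup>2" by simp
  qed
  finally show ?thesis unfolding invariant_def S .
qed

text \<open>Facets, vertex coordinates, triples of vertices whose planes separate all pairs of facets, and
  the value of \<open>invariant\<close>.\<close>

type_synonym realization = "nat list list \<times> point list \<times> (nat \<times> nat \<times> nat) list \<times> nat"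

fun realizes :: "(point \<Rightarrow> point) \<Rightarrow> realization \<Rightarrow> bool" where
  "realizes g (F, cs, ts, i) \<longleftrightarrow>
     well_formed F \<and> embedded F cs ts \<and> symmetric g F cs \<and> invariant_list F = i"

fun chain :: "(nat list \<times> nat list) list list \<Rightarrow> nat list list \<Rightarrow> nat list list list \<Rightarrow> bool" where
  "chain (ms # mss) F (G # Gs) \<longleftrightarrow> moves_to ms F G \<and> chain mss G Gs"
| "chain mss F [] \<longleftrightarrow> True"
| "chain [] F (G # Gs) \<longleftrightarrow> False"

lemma chain_homeomorphic:
  assumes "chain mss F Gs" "underlying_space (complex_of F) homeomorphic_space S" "G \<in> set Gs"
  shows "underlying_space (complex_of G) homeomorphic_space S"
  using assms
proof (induction mss F Gs rule: chain.induct)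
  case (1 ms mss F H Gs)
  then have "underlying_space (complex_of H) homeomorphic_space S"
    using moves_to_homeomorphic by (metis chain.simps(1) homeomorphic_space_sym homeomorphic_space_trans)
  then show ?case using 1 by auto
qed auto

section \<open>The realizations\<close>

text \<open>The edge flips leading from each triangulation to the next one, beginning with
  \<open>base_complex\<close>.\<close>

definition flips :: "(nat list \<times> nat list) list list" where
  "flips = [
    [([0,8],[1,7])],[([0,1],[2,7]),([7,8],[1,6])],[([1,7],[2,6])],[([4,9],[1,7])],
    [([0,7],[2,5]),([1,8],[3,6])],[([1,7],[4,9])],[([2,6],[1,7])],
    [([2,9],[1,8]),([4,6],[0,7])],[([0,3],[2,9]),([1,7],[2,6])],
    [([4,5],[0,8]),([2,9],[0,3]),([6,8],[3,5])],[([0,3],[2,9])],[([5,8],[0,3])],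
    [([1,2],[6,8]),([7,9],[4,5])],[([0,3],[5,8])],[([0,4],[7,8]),([5,8],[0,3]),([3,6],[1,5])],
    [([0,3],[5,8])],[([0,6],[7,9]),([3,4],[1,2])],[([2,9],[0,3])],
    [([1,2],[3,4]),([7,9],[0,6])],[([2,8],[4,6]),([0,6],[7,9]),([6,7],[2,9]),([4,8],[6,7])],
    [([1,5],[3,6]),([1,9],[4,8])],[([0,5],[2,8]),([0,9],[3,7])],[([3,4],[1,2]),([6,8],[1,7])],
    [([3,5],[6,8]),([8,9],[3,4])],[([4,9],[3,5]),([5,6],[8,9])],[([2,6],[4,9]),([4,7],[5,6])],
    [([2,9],[4,7]),([5,7],[2,6])],[([2,8],[0,5]),([3,7],[0,9])],[([2,5],[0,6]),([7,9],[0,4])],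
    [([1,4],[2,8]),([1,6],[3,7])],[([0,3],[2,9]),([0,8],[5,7])],[([3,9],[2,5]),([5,8],[7,9])],
    [([3,4],[5,8]),([6,8],[3,9])],[([2,3],[1,5]),([7,8],[1,9])],[([4,5],[6,8]),([6,9],[3,4])],
    [([2,4],[7,8]),([6,7],[2,3])],[([3,6],[2,4]),([4,8],[6,7])],[([4,9],[0,3]),([5,6],[0,8])],
    [([2,4],[3,6]),([6,7],[4,8])],[([2,3],[6,7]),([7,8],[2,4])],[([1,5],[2,3]),([1,9],[7,8])],
    [([0,2],[6,9]),([0,7],[4,5])],[([0,3],[4,9]),([0,8],[5,6])],
    [([2,3],[1,5]),([2,5],[1,9]),([4,7],[2,5]),([6,7],[2,3])],[([4,9],[0,3]),([5,6],[0,8])],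
    [([2,3],[6,7]),([2,8],[1,4])],[([4,5],[0,2]),([3,6],[4,7])],
    [([0,9],[3,6]),([2,7],[5,6]),([4,8],[1,6])],[([6,7],[4,5]),([6,8],[0,1]),([6,9],[2,3])],
    [([1,8],[0,7]),([3,9],[2,8]),([5,7],[4,9])],[([0,8],[5,7]),([2,9],[1,8]),([4,7],[3,9])],
    [([0,1],[6,7]),([2,3],[6,8]),([4,5],[6,9])],[([1,6],[4,7]),([5,7],[0,8]),([6,8],[2,3])],
    [([0,2],[4,5]),([5,9],[1,6]),([3,4],[0,9]),([3,6],[0,2])],
    [([0,2],[3,6]),([1,7],[3,4]),([0,5],[4,8]),([1,9],[6,8])],
    [([3,4],[1,7]),([3,6],[0,2]),([0,9],[3,4]),([1,4],[2,7]),([2,4],[5,7]),([7,8],[0,9])],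
    [([0,2],[3,6]),([4,5],[7,8])]]"

text \<open>All half-turns are about the third coordinate axis. No vertex lies on the axis in this
  list; in \<open>half_turn_realizations3\<close> and \<open>half_turn_realizations4\<close> each
  realization has two vertices on it.\<close>

definition half_turn_realizations1 :: "realization list" where
  "half_turn_realizations1 = [
    ([[0,1,2],[0,1,7],[0,2,3],[0,3,9],[0,4,5],[0,4,6],[0,5,7],[0,6,9],[1,2,9],[1,3,4],
    [1,3,8],[1,4,9],[1,7,8],[2,3,4],[2,4,8],[2,8,9],[3,8,9],[4,5,8],[4,6,7],[4,7,9],
    [5,6,8],[5,6,9],[5,7,9],[6,7,8]],
    [(-2,-1,-2),(0,1,2),(-2,1,0),(-2,2,0),(1,0,-1),(2,-2,0),(2,-1,0),(0,-1,2),(2,1,-2),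
    (-1,0,-1)],
    [(1,4,9),(4,7,8),(0,1,9),(4,6,7),(0,5,6),(2,3,8),(1,2,9),(0,4,6),(0,1,7),(3,5,8),
    (0,2,3),(5,7,9),(3,8,9),(0,6,9),(1,7,8),(2,3,4),(4,7,9),(0,1,2),(0,4,5),(1,3,4),
    (5,6,8),(0,3,9),(0,5,7),(1,3,8),(2,4,8),(2,8,9),(4,5,8),(5,6,9),(6,7,8)], 3015745976),
    ([[0,2,3],[0,2,7],[0,3,9],[0,4,5],[0,4,6],[0,5,7],[0,6,9],[1,2,7],[1,2,9],[1,3,4],
    [1,3,8],[1,4,9],[1,6,7],[1,6,8],[2,3,4],[2,4,8],[2,8,9],[3,8,9],[4,5,8],[4,6,7],
    [4,7,9],[5,6,8],[5,6,9],[5,7,9]],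
    [(-2,-1,2),(2,2,-2),(-1,1,0),(1,2,1),(1,0,1),(-1,-2,1),(1,-1,0),(-2,-2,-2),(2,1,2),
    (-1,0,1)],
    [(1,4,9),(0,4,6),(2,8,9),(4,6,7),(0,2,5),(3,4,8),(5,6,9),(1,2,9),(1,6,8),(0,2,7),
    (4,5,8),(0,3,9),(2,3,4),(4,7,9),(0,5,7),(1,2,7),(1,3,4),(0,2,3),(0,4,5),(0,6,9),
    (1,3,8),(1,6,7),(2,4,8),(3,8,9),(5,6,8),(5,7,9)], 2860668880),
    ([[0,2,3],[0,2,7],[0,3,9],[0,4,5],[0,4,6],[0,5,7],[0,6,9],[1,2,6],[1,2,9],[1,3,4],
    [1,3,8],[1,4,9],[1,6,8],[2,3,4],[2,4,8],[2,6,7],[2,8,9],[3,8,9],[4,5,8],[4,6,7],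
    [4,7,9],[5,6,8],[5,6,9],[5,7,9]],
    [(-1,-1,2),(2,1,-2),(1,-2,0),(2,-2,0),(0,1,1),(-2,2,0),(-1,2,0),(-2,-1,-2),(1,1,2),
    (0,-1,1)],
    [(1,4,9),(0,4,6),(2,8,9),(0,2,6),(4,6,7),(2,3,4),(1,3,8),(4,5,8),(5,6,9),(0,3,7),
    (1,2,9),(1,6,8),(0,5,7),(4,7,9),(0,3,9),(0,2,7),(0,2,3),(0,4,5),(0,6,9),(1,2,6),
    (1,3,4),(2,4,8),(2,6,7),(3,8,9),(5,6,8),(5,7,9)], 3009675000),
    ([[0,2,3],[0,2,7],[0,3,9],[0,4,5],[0,4,6],[0,5,7],[0,6,9],[1,2,6],[1,2,9],[1,3,4],
    [1,3,8],[1,4,7],[1,6,8],[1,7,9],[2,3,4],[2,4,8],[2,6,7],[2,8,9],[3,8,9],[4,5,8],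
    [4,6,7],[5,6,8],[5,6,9],[5,7,9]],
    [(-1,-2,-2),(0,1,1),(-2,1,2),(-2,2,2),(1,1,-1),(2,-2,2),(2,-1,2),(0,-1,1),(1,2,-2),
    (-1,-1,-1)],
    [(1,2,9),(0,4,6),(2,3,8),(4,6,7),(0,5,7),(1,3,8),(5,6,9),(0,8,9),(1,4,7),(0,2,3),
    (1,2,6),(5,6,8),(2,6,7),(3,8,9),(2,3,4),(4,5,8),(1,7,9),(0,2,7),(0,3,9),(0,4,5),
    (0,6,9),(1,3,4),(1,6,8),(2,4,8),(2,8,9),(5,7,9)], 2654590172),
    ([[0,2,3],[0,2,5],[0,3,9],[0,4,5],[0,4,6],[0,6,9],[1,2,6],[1,2,9],[1,3,4],[1,3,6],
    [1,4,7],[1,7,9],[2,3,4],[2,4,8],[2,5,7],[2,6,7],[2,8,9],[3,6,8],[3,8,9],[4,5,8],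
    [4,6,7],[5,6,8],[5,6,9],[5,7,9]],
    [(2,0,2),(-2,-2,-2),(-1,-2,0),(-1,-1,1),(-2,1,2),(1,1,1),(1,2,0),(2,2,-2),(-2,0,2),
    (2,-1,2)],
    [(2,5,9),(3,4,6),(1,3,6),(4,7,9),(2,5,8),(0,4,5),(2,5,7),(1,2,7),(0,6,9),(2,3,4),
    (2,3,9),(1,6,7),(4,5,8),(5,6,9),(3,6,8),(0,2,3),(0,4,6),(2,8,9),(1,2,6),(1,2,9),
    (1,3,4),(0,2,5),(0,3,9),(1,4,7),(1,7,9),(2,4,8),(2,6,7),(3,8,9),(4,6,7),(5,6,8),
    (5,7,9)], 2977876520),
    ([[0,2,3],[0,2,5],[0,3,9],[0,4,5],[0,4,6],[0,6,9],[1,2,6],[1,2,9],[1,3,4],[1,3,6],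
    [1,4,9],[2,3,4],[2,4,8],[2,5,7],[2,6,7],[2,8,9],[3,6,8],[3,8,9],[4,5,8],[4,6,7],
    [4,7,9],[5,6,8],[5,6,9],[5,7,9]],
    [(-1,-2,-2),(1,-2,2),(2,-1,1),(-2,-2,-2),(0,-1,0),(2,2,-2),(-2,1,1),(-1,2,2),
    (1,2,-2),(0,1,0)],
    [(2,4,9),(3,6,9),(2,8,9),(0,4,6),(0,4,5),(4,7,9),(1,5,6),(0,2,4),(2,6,7),(0,4,8),
    (0,3,9),(1,3,4),(2,4,8),(5,8,9),(1,2,9),(2,5,7),(3,6,8),(0,2,3),(0,6,9),(1,3,6),
    (5,6,9),(0,2,5),(1,2,6),(1,4,9),(2,3,4),(3,8,9),(4,5,8),(4,6,7),(5,6,8),(5,7,9)], 3514258300),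
    ([[0,2,3],[0,2,5],[0,3,9],[0,4,5],[0,4,6],[0,6,9],[1,2,7],[1,2,9],[1,3,4],[1,3,6],
    [1,4,9],[1,6,7],[2,3,4],[2,4,8],[2,5,7],[2,8,9],[3,6,8],[3,8,9],[4,5,8],[4,6,7],
    [4,7,9],[5,6,8],[5,6,9],[5,7,9]],
    [(-2,1,-2),(-2,-2,2),(-1,-2,0),(-2,2,-2),(-1,0,-1),(2,-2,-2),(1,2,0),(2,2,2),
    (2,-1,-2),(1,0,-1)],
    [(2,5,9),(3,6,9),(1,4,7),(3,4,8),(4,7,9),(0,4,6),(0,5,9),(2,4,8),(1,2,9),(0,3,9),
    (5,6,8),(0,2,5),(1,3,4),(1,6,7),(2,5,7),(3,6,8),(0,2,3),(0,4,5),(2,8,9),(0,6,9),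
    (1,2,7),(1,3,6),(1,4,9),(2,3,4),(3,8,9),(4,5,8),(4,6,7),(5,6,9),(5,7,9)], 2985775320),
    ([[0,2,3],[0,2,5],[0,3,9],[0,4,5],[0,4,7],[0,6,7],[0,6,9],[1,2,7],[1,2,8],[1,3,4],
    [1,3,6],[1,4,9],[1,6,7],[1,8,9],[2,3,4],[2,4,8],[2,5,7],[3,6,8],[3,8,9],[4,5,8],
    [4,7,9],[5,6,8],[5,6,9],[5,7,9]],
    [(0,1,0),(1,1,2),(2,0,-1),(-1,2,-1),(1,2,0),(1,-2,-1),(-2,0,-1),(-1,-1,2),(0,-1,0),
    (-1,-2,0)],
    [(0,3,8),(4,7,9),(5,6,8),(2,5,8),(3,8,9),(1,4,6),(0,4,5),(0,6,9),(1,2,7),(1,3,6),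
    (5,7,9),(0,2,3),(2,4,8),(1,4,9),(0,6,7),(1,6,7),(0,3,4),(1,2,8),(0,2,5),(0,3,9),
    (0,4,7),(1,3,4),(1,8,9),(2,3,4),(2,5,7),(3,6,8),(4,5,8),(5,6,9)], 2507320656),
    ([[0,2,5],[0,2,9],[0,4,5],[0,4,7],[0,6,7],[0,6,9],[1,2,6],[1,2,8],[1,3,4],[1,3,6],
    [1,4,9],[1,8,9],[2,3,4],[2,3,9],[2,4,8],[2,5,7],[2,6,7],[3,6,8],[3,8,9],[4,5,8],
    [4,7,9],[5,6,8],[5,6,9],[5,7,9]],
    [(2,0,2),(-2,-2,0),(1,-1,-2),(-2,0,2),(-2,1,2),(1,1,1),(2,-1,2),(2,2,0),(-1,-1,1),
    (-1,1,-2)],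
    [(2,4,9),(2,3,6),(4,5,8),(0,6,9),(2,4,8),(5,7,9),(0,4,7),(1,3,9),(0,2,5),(1,2,6),
    (1,3,6),(3,8,9),(0,2,7),(5,6,8),(2,3,4),(1,2,8),(0,6,7),(1,3,4),(0,2,9),(0,4,5),
    (1,4,9),(1,8,9),(2,3,9),(2,5,7),(2,6,7),(3,6,8),(4,7,9),(5,6,9)], 3051004016),
    ([[0,2,3],[0,2,5],[0,3,9],[0,4,7],[0,4,8],[0,5,8],[0,6,7],[0,6,9],[1,2,6],[1,2,8],
    [1,3,4],[1,3,6],[1,4,9],[1,8,9],[2,3,4],[2,4,8],[2,5,7],[2,6,7],[3,5,6],[3,5,8],
    [3,8,9],[4,7,9],[5,6,9],[5,7,9]],
    [(0,1,0),(2,-2,0),(-1,-2,2),(0,-1,0),(2,0,-2),(-1,0,-1),(-2,0,-2),(-2,2,0),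
    (1,0,-1),(1,2,2)],
    [(0,2,9),(2,3,5),(3,8,9),(0,8,9),(0,2,5),(1,2,4),(6,7,9),(0,2,3),(0,4,7),(1,3,6),
    (1,4,9),(2,6,7),(0,1,3),(1,2,8),(5,6,9),(0,4,8),(0,5,8),(0,6,7),(1,3,4),(2,5,7),
    (0,3,9),(0,6,9),(1,2,6),(1,8,9),(2,3,4),(2,4,8),(3,5,6),(3,5,8),(4,7,9),(5,7,9)], 2628120156),
    ([[0,2,5],[0,2,9],[0,4,7],[0,4,8],[0,5,8],[0,6,7],[0,6,9],[1,2,6],[1,2,8],[1,3,4],
    [1,3,6],[1,4,9],[1,8,9],[2,3,4],[2,3,9],[2,4,8],[2,5,7],[2,6,7],[3,5,6],[3,5,8],
    [3,8,9],[4,7,9],[5,6,9],[5,7,9]],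
    [(-2,1,-2),(0,-1,2),(1,0,0),(2,-1,-2),(-2,-2,0),(2,1,-1),(2,2,0),(0,1,2),
    (-2,-1,-1),(-1,0,0)],
    [(0,2,5),(3,8,9),(1,4,8),(2,5,6),(2,7,9),(0,2,9),(0,4,7),(1,3,4),(1,3,6),(5,6,7),
    (0,4,8),(1,4,9),(2,3,9),(0,6,7),(1,2,8),(5,6,9),(2,3,5),(0,5,8),(1,2,6),(2,3,4),
    (2,5,7),(0,6,9),(1,8,9),(2,4,8),(2,6,7),(3,5,6),(3,5,8),(4,7,9),(5,7,9)], 2817979884)]"

definition half_turn_realizations2 :: "realization list" where
  "half_turn_realizations2 = [
    ([[0,2,5],[0,2,9],[0,3,5],[0,3,8],[0,4,7],[0,4,8],[0,6,7],[0,6,9],[1,2,6],[1,2,8],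
    [1,3,4],[1,3,6],[1,4,9],[1,8,9],[2,3,4],[2,3,9],[2,4,8],[2,5,7],[2,6,7],[3,5,6],
    [3,8,9],[4,7,9],[5,6,9],[5,7,9]],
    [(-2,-1,2),(2,1,-1),(1,0,1),(2,1,2),(0,2,-2),(2,-1,0),(0,-2,-2),(-2,-1,-1),
    (-2,1,0),(-1,0,1)],
    [(1,2,9),(0,6,9),(2,3,4),(0,3,5),(0,3,8),(1,4,9),(2,6,7),(0,4,7),(1,3,6),(5,7,9),
    (1,2,8),(1,8,9),(2,5,7),(0,2,5),(2,3,8),(0,2,9),(3,7,9),(0,4,8),(3,5,6),(0,6,7),
    (1,2,6),(1,3,4),(2,3,9),(2,4,8),(3,8,9),(4,7,9),(5,6,9)], 2945267360),
    ([[0,2,5],[0,2,9],[0,3,5],[0,3,8],[0,4,7],[0,4,8],[0,6,7],[0,6,9],[1,3,4],[1,3,6],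
    [1,4,9],[1,6,8],[1,8,9],[2,3,4],[2,3,9],[2,4,8],[2,5,7],[2,6,7],[2,6,8],[3,5,6],
    [3,8,9],[4,5,7],[4,5,9],[5,6,9]],
    [(2,1,2),(-2,1,-1),(-1,-1,0),(-2,-1,2),(1,2,-2),(2,-2,-2),(-1,-2,-2),(2,-1,-1),
    (-2,2,-2),(1,1,0)],
    [(0,2,3),(4,6,9),(2,3,8),(5,6,9),(0,3,4),(0,6,7),(2,4,8),(1,3,4),(4,5,7),(1,8,9),
    (3,5,6),(0,2,5),(2,3,9),(0,4,7),(0,4,8),(1,6,8),(2,6,8),(0,2,9),(0,3,8),(2,5,7),
    (0,3,5),(0,6,9),(1,3,6),(1,4,9),(2,3,4),(2,6,7),(3,8,9),(4,5,9)], 2986681720),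
    ([[0,2,5],[0,2,9],[0,4,7],[0,4,8],[0,5,8],[0,6,7],[0,6,9],[1,3,4],[1,3,6],[1,4,9],
    [1,6,8],[1,8,9],[2,3,4],[2,3,9],[2,4,8],[2,5,7],[2,6,7],[2,6,8],[3,5,6],[3,5,8],
    [3,8,9],[4,5,7],[4,5,9],[5,6,9]],
    [(2,-1,-2),(-2,-1,-1),(2,2,-1),(-2,1,-2),(-1,2,2),(-1,1,1),(1,-2,2),(2,1,-1),
    (1,-1,1),(-2,-2,-1)],
    [(0,5,8),(0,2,4),(3,6,9),(1,6,8),(3,4,5),(2,7,8),(4,5,7),(0,2,9),(3,8,9),(5,6,9),
    (2,3,4),(0,2,6),(1,4,9),(2,4,8),(3,5,6),(0,2,5),(0,4,7),(0,6,9),(0,6,7),(1,3,4),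
    (0,4,8),(1,3,6),(1,8,9),(2,3,9),(2,5,7),(2,6,7),(2,6,8),(3,5,8),(4,5,9)], 2960094992),
    ([[0,2,5],[0,2,9],[0,3,5],[0,3,8],[0,6,7],[0,6,9],[0,7,8],[1,3,4],[1,3,5],[1,4,9],
    [1,5,6],[1,6,8],[1,8,9],[2,3,4],[2,3,9],[2,4,8],[2,5,7],[2,6,7],[2,6,8],[3,8,9],
    [4,5,7],[4,5,9],[4,7,8],[5,6,9]],
    [(1,1,-2),(-2,-2,0),(2,1,0),(-1,-1,-2),(1,-1,1),(1,-2,2),(-1,1,1),(2,2,0),(-1,2,2),
    (-2,-1,0)],
    [(0,2,9),(3,5,8),(2,4,8),(5,6,9),(0,8,9),(1,4,5),(2,6,7),(2,3,4),(2,3,9),(0,7,8),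
    (4,5,7),(1,4,9),(1,6,8),(0,4,6),(0,2,5),(0,3,5),(1,3,4),(0,3,8),(0,6,7),(0,6,9),
    (1,3,5),(1,5,6),(1,8,9),(2,5,7),(2,6,8),(3,8,9),(4,5,9),(4,7,8)], 2689593532),
    ([[0,2,5],[0,2,9],[0,5,8],[0,6,7],[0,6,9],[0,7,8],[1,3,4],[1,3,5],[1,4,9],[1,5,6],
    [1,6,8],[1,8,9],[2,3,4],[2,3,9],[2,4,8],[2,5,7],[2,6,7],[2,6,8],[3,5,8],[3,8,9],
    [4,5,7],[4,5,9],[4,7,8],[5,6,9]],
    [(-1,-2,-1),(2,0,0),(1,-2,-2),(1,2,-1),(2,-2,-1),(2,-1,2),(-2,2,-1),(-2,0,0),
    (-2,1,2),(-1,2,-2)],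
    [(4,5,8),(2,8,9),(1,3,9),(5,6,9),(0,2,7),(2,4,8),(1,6,8),(0,2,6),(0,5,7),(1,3,5),
    (2,5,7),(3,4,9),(2,6,8),(3,5,8),(1,4,9),(4,7,8),(0,2,9),(0,5,8),(0,6,7),(1,8,9),
    (2,3,4),(0,2,5),(0,6,9),(0,7,8),(1,3,4),(1,5,6),(2,3,9),(2,6,7),(3,8,9),(4,5,7),
    (4,5,9)], 3037028336),
    ([[0,2,5],[0,2,9],[0,5,8],[0,7,8],[0,7,9],[1,2,3],[1,2,4],[1,3,5],[1,4,9],[1,5,6],
    [1,6,8],[1,8,9],[2,3,9],[2,4,8],[2,5,7],[2,6,7],[2,6,8],[3,5,8],[3,8,9],[4,5,7],
    [4,5,9],[4,7,8],[5,6,9],[6,7,9]],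
    [(2,-2,1),(-2,1,1),(-1,-2,-2),(-2,2,1),(-1,-1,0),(-2,0,2),(1,1,0),(2,-1,1),(2,0,2),
    (1,2,-2)],
    [(1,2,8),(2,6,9),(1,5,6),(1,8,9),(4,7,8),(2,5,7),(1,3,8),(0,2,7),(4,5,9),(0,5,7),
    (1,2,9),(2,6,8),(2,4,6),(0,2,9),(0,5,8),(0,7,9),(1,2,3),(1,2,4),(1,3,5),(2,3,9),
    (2,6,7),(4,5,7),(0,2,5),(0,7,8),(1,4,9),(1,6,8),(2,4,8),(3,5,8),(3,8,9),(5,6,9),
    (6,7,9)], 3608583676),
    ([[0,2,3],[0,2,5],[0,3,9],[0,5,8],[0,7,8],[0,7,9],[1,2,3],[1,2,4],[1,3,5],[1,4,9],
    [1,5,6],[1,6,8],[1,8,9],[2,4,8],[2,5,7],[2,6,7],[2,6,8],[3,5,8],[3,8,9],[4,5,7],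
    [4,5,9],[4,7,8],[5,6,9],[6,7,9]],
    [(1,1,2),(-1,-2,1),(-2,0,-1),(-1,-1,2),(1,-2,-2),(0,1,0),(-1,2,-2),(1,2,1),
    (0,-1,0),(2,0,-1)],
    [(0,2,9),(1,6,8),(4,5,7),(1,3,5),(0,7,8),(3,8,9),(1,2,5),(0,3,5),(7,8,9),(2,6,7),
    (1,4,9),(2,4,8),(4,5,6),(0,3,9),(5,6,9),(0,2,3),(0,2,5),(0,5,8),(0,7,9),(1,2,3),
    (1,2,4),(1,5,6),(1,8,9),(2,5,7),(2,6,8),(3,5,8),(4,5,9),(4,7,8),(6,7,9)], 3042743828),
    ([[0,2,3],[0,2,5],[0,3,9],[0,5,8],[0,6,7],[0,6,9],[0,7,8],[1,3,4],[1,3,5],[1,4,9],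
    [1,5,6],[1,6,8],[1,8,9],[2,3,4],[2,4,8],[2,5,7],[2,6,7],[2,6,8],[3,5,8],[3,8,9],
    [4,5,7],[4,5,9],[4,7,8],[5,6,9]],
    [(-1,-2,-2),(0,2,-1),(2,-2,0),(1,2,-2),(2,-1,0),(1,0,-1),(-2,1,0),(0,-2,-1),
    (-1,0,-1),(-2,2,0)],
    [(4,5,8),(2,6,8),(0,3,6),(0,3,4),(1,5,9),(2,4,7),(1,3,5),(0,7,8),(1,8,9),(4,7,8),
    (0,2,5),(1,5,6),(0,6,9),(2,3,4),(3,5,8),(0,5,8),(1,3,4),(0,3,9),(0,6,7),(1,4,9),
    (2,5,7),(0,2,3),(1,6,8),(2,4,8),(2,6,7),(3,8,9),(4,5,7),(4,5,9),(5,6,9)], 2838737352),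
    ([[0,2,3],[0,2,5],[0,3,9],[0,5,8],[0,7,8],[0,7,9],[1,3,4],[1,3,5],[1,4,9],[1,5,6],
    [1,6,8],[1,8,9],[2,3,4],[2,4,6],[2,5,7],[2,6,9],[2,7,9],[3,5,8],[3,8,9],[4,5,7],
    [4,5,9],[4,6,7],[5,6,9],[6,7,8]],
    [(0,0,-3),(0,0,-1),(1,-3,1),(1,2,-2),(3,2,2),(1,-1,0),(-3,-2,2),(-1,3,1),
    (-1,-2,-2),(-1,1,0)],
    [(4,5,9),(3,5,8),(3,8,9),(0,2,5),(5,6,9),(6,7,8),(2,3,4),(1,5,9),(0,7,9),(2,4,7),
    (0,3,8),(2,5,7),(1,3,4),(1,6,8),(2,6,9),(2,4,6),(0,2,3),(0,3,9),(0,5,8),(0,7,8),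
    (1,3,5),(1,4,9),(1,5,6),(1,8,9),(2,7,9),(4,5,7),(4,6,7)], 2860849652),
    ([[0,2,3],[0,2,5],[0,3,9],[0,5,8],[0,7,8],[0,7,9],[1,3,4],[1,3,6],[1,4,8],[1,6,8],
    [2,3,4],[2,4,6],[2,5,7],[2,6,9],[2,7,9],[3,5,6],[3,5,8],[3,8,9],[4,5,7],[4,5,9],
    [4,6,7],[4,8,9],[5,6,9],[6,7,8]],
    [(0,0,2),(0,0,-3),(-1,-2,1),(-2,-3,3),(-3,3,-1),(3,-2,0),(3,-3,-1),(1,2,1),(2,3,3),
    (-3,2,0)],
    [(3,4,6),(4,6,8),(2,5,7),(0,5,9),(2,7,9),(0,2,3),(1,8,9),(6,7,8),(1,3,5),(2,3,4),
    (3,8,9),(0,5,8),(1,3,6),(1,4,8),(2,6,9),(4,5,7),(0,1,7),(3,5,6),(4,5,9),(0,2,5),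
    (0,3,9),(0,7,8),(0,7,9),(1,3,4),(1,6,8),(2,4,6),(3,5,8),(4,6,7),(4,8,9),(5,6,9)], 3027513026),
    ([[0,2,3],[0,2,8],[0,3,7],[0,7,8],[1,3,4],[1,3,6],[1,4,8],[1,6,8],[2,3,4],[2,4,6],
    [2,5,7],[2,5,8],[2,6,9],[2,7,9],[3,5,6],[3,5,8],[3,7,9],[3,8,9],[4,5,7],[4,5,9],
    [4,6,7],[4,8,9],[5,6,9],[6,7,8]],
    [(0,0,2),(0,0,3),(-1,0,-1),(0,-2,1),(-2,-1,-2),(-1,-3,-3),(2,1,-2),(1,0,-1),
    (0,2,1),(1,3,-3)],
    [(2,4,5),(6,7,9),(3,5,8),(3,7,8),(4,8,9),(3,5,6),(0,2,3),(1,4,8),(0,7,8),(1,3,6),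
    (2,4,6),(2,7,9),(4,5,6),(4,5,7),(0,2,8),(1,3,4),(2,6,9),(1,6,8),(3,5,9),(0,3,7),
    (2,3,4),(2,5,7),(2,5,8),(3,7,9),(3,8,9),(4,5,9),(4,6,7),(5,6,9),(6,7,8)], 3677545500),
    ([[0,2,3],[0,2,8],[0,3,7],[0,7,8],[1,2,3],[1,2,4],[1,3,6],[1,4,8],[1,6,7],[1,7,8],
    [2,4,6],[2,5,7],[2,5,8],[2,6,9],[2,7,9],[3,5,6],[3,5,8],[3,7,9],[3,8,9],[4,5,7],
    [4,5,9],[4,6,7],[4,8,9],[5,6,9]],
    [(0,0,-2),(0,0,-1),(-3,-1,-3),(1,3,3),(-1,-1,1),(3,-3,2),(1,1,1),(3,1,-3),
    (-1,-3,3),(-3,3,2)],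
    [(2,6,9),(4,5,8),(0,3,7),(1,2,4),(0,7,8),(3,5,9),(0,2,3),(5,6,9),(4,5,7),(1,6,7),
    (1,3,8),(4,5,9),(2,5,7),(0,2,8),(1,3,6),(2,4,6),(2,7,9),(3,8,9),(1,2,3),(1,4,8),
    (1,7,8),(2,5,8),(3,5,6),(3,5,8),(3,7,9),(4,6,7),(4,8,9)], 3175542966)]"

definition half_turn_realizations3 :: "realization list" where
  "half_turn_realizations3 = [
    ([[0,2,3],[0,2,8],[0,3,7],[0,7,8],[1,2,3],[1,2,4],[1,3,6],[1,4,8],[1,6,7],[1,7,8],
    [2,4,6],[2,5,7],[2,5,8],[2,6,9],[2,7,9],[3,4,8],[3,4,9],[3,6,8],[3,7,9],[4,5,7],
    [4,5,9],[4,6,7],[5,6,8],[5,6,9]],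
    [(0,0,1),(0,0,2),(1,2,-2),(-3,-3,3),(-3,3,-1),(1,3,-3),(3,-3,-1),(-1,-2,-2),
    (3,3,3),(-1,-3,-3)],
    [(2,4,6),(6,7,8),(3,4,7),(1,2,3),(1,7,8),(2,5,8),(0,2,8),(2,5,9),(0,3,7),(2,5,6),
    (4,5,9),(4,6,7),(1,3,6),(1,4,8),(2,5,7),(3,7,9),(0,2,3),(1,3,8),(2,6,9),(0,7,8),
    (1,2,4),(1,6,7),(2,7,9),(3,4,8),(3,4,9),(3,6,8),(4,5,7),(5,6,8),(5,6,9)], 3326449178),
    ([[0,2,3],[0,2,8],[0,3,7],[0,7,8],[1,2,3],[1,2,4],[1,3,6],[1,4,8],[1,6,7],[1,7,8],
    [2,4,6],[2,5,7],[2,5,8],[2,6,9],[2,7,9],[3,4,5],[3,4,8],[3,5,9],[3,6,8],[3,7,9],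
    [4,5,7],[4,6,7],[5,8,9],[6,8,9]],
    [(0,0,-3),(0,0,-1),(-2,3,2),(-3,-2,0),(-2,0,1),(-2,2,3),(2,0,1),(2,-3,2),(3,2,0),
    (2,-2,3)],
    [(2,3,7),(3,6,8),(2,4,8),(2,7,9),(1,4,8),(1,2,3),(4,6,7),(5,8,9),(4,5,7),(0,3,7),
    (0,7,8),(3,5,7),(2,5,8),(2,6,9),(0,2,8),(1,6,7),(3,4,5),(3,5,9),(0,2,3),(1,2,4),
    (1,3,6),(1,7,8),(2,4,6),(2,5,7),(3,4,8),(3,7,9),(6,8,9)], 3649401582),
    ([[0,2,3],[0,2,8],[0,3,7],[0,7,8],[1,2,3],[1,2,4],[1,3,6],[1,4,8],[1,6,7],[1,7,8],
    [2,4,9],[2,5,7],[2,5,8],[2,7,9],[3,4,5],[3,4,8],[3,5,9],[3,6,8],[3,7,9],[4,5,6],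
    [4,6,9],[5,6,7],[5,8,9],[6,8,9]],
    [(0,0,3),(0,0,2),(-2,-3,-3),(-3,3,1),(-1,0,-1),(1,1,-2),(1,0,-1),(2,3,-3),(3,-3,1),
    (-1,-1,-2)],
    [(2,4,8),(3,6,7),(3,5,9),(4,5,6),(1,2,3),(1,4,8),(1,7,8),(2,5,7),(0,3,7),(4,6,9),
    (5,8,9),(3,6,8),(0,2,8),(2,7,9),(0,2,3),(1,3,6),(3,4,5),(0,7,8),(1,2,4),(1,6,7),
    (2,4,9),(2,5,8),(3,4,8),(3,7,9),(5,6,7),(6,8,9)], 3256627238),
    ([[0,2,3],[0,2,8],[0,3,7],[0,7,8],[1,2,3],[1,2,4],[1,3,6],[1,4,8],[1,6,7],[1,7,8],
    [2,4,7],[2,5,6],[2,5,8],[2,6,7],[3,4,5],[3,4,8],[3,5,9],[3,6,8],[3,7,9],[4,5,6],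
    [4,6,9],[4,7,9],[5,8,9],[6,8,9]],
    [(0,0,-3),(0,0,2),(3,0,-2),(-2,-3,1),(1,-1,-1),(1,1,0),(-1,1,-1),(-3,0,-2),(2,3,1),
    (-1,-1,0)],
    [(3,4,8),(3,6,8),(2,5,8),(3,7,9),(0,2,7),(2,4,6),(1,3,8),(4,5,6),(0,2,3),(0,7,8),
    (4,6,9),(1,6,7),(3,4,5),(5,8,9),(0,2,8),(1,2,4),(5,6,9),(0,3,7),(2,4,7),(1,2,3),
    (1,3,6),(1,4,8),(1,7,8),(2,5,6),(2,6,7),(3,5,9),(4,7,9),(6,8,9)], 3436706126),
    ([[0,2,3],[0,2,5],[0,3,9],[0,5,8],[0,7,8],[0,7,9],[1,2,3],[1,2,4],[1,3,6],[1,4,8],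
    [1,6,7],[1,7,8],[2,4,7],[2,5,6],[2,6,7],[3,4,5],[3,4,8],[3,5,9],[3,6,8],[4,5,6],
    [4,6,9],[4,7,9],[5,8,9],[6,8,9]],
    [(0,0,3),(0,0,-2),(-2,3,-3),(-1,2,-1),(-3,-1,0),(3,2,1),(3,1,0),(2,-3,-3),
    (1,-2,-1),(-3,-2,1)],
    [(3,4,8),(3,6,7),(2,3,5),(0,8,9),(1,4,6),(3,5,9),(5,8,9),(1,2,7),(4,7,9),(2,5,6),
    (0,7,8),(3,6,8),(0,2,3),(0,5,8),(2,4,7),(2,6,7),(1,2,3),(1,4,8),(3,4,5),(4,6,9),
    (0,2,5),(0,3,9),(0,7,9),(1,2,4),(1,3,6),(1,6,7),(1,7,8),(4,5,6),(6,8,9)], 2649901980),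
    ([[0,2,3],[0,2,6],[0,3,9],[0,4,7],[0,4,9],[0,5,6],[0,5,8],[0,7,8],[1,2,3],[1,2,4],
    [1,3,6],[1,4,8],[1,6,7],[1,7,8],[2,4,7],[2,6,7],[3,4,5],[3,4,8],[3,5,9],[3,6,8],
    [4,5,6],[4,6,9],[5,8,9],[6,8,9]],
    [(0,0,1),(0,0,3),(3,3,2),(-1,2,-3),(3,2,0),(2,1,-1),(-3,-2,0),(-3,-3,2),(1,-2,-3),
    (-2,-1,-1)],
    [(0,3,6),(0,4,8),(0,4,9),(2,4,7),(1,6,7),(3,4,5),(5,8,9),(3,6,8),(1,2,3),(0,5,6),
    (0,7,8),(1,8,9),(0,2,3),(2,6,7),(5,6,9),(3,4,8),(0,3,9),(0,4,6),(1,2,4),(0,2,6),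
    (0,4,7),(0,5,8),(1,3,6),(1,4,8),(1,7,8),(3,5,9),(4,5,6),(4,6,9),(6,8,9)], 3056919330),
    ([[0,2,3],[0,2,6],[0,3,9],[0,4,7],[0,4,9],[0,5,6],[0,5,8],[0,7,8],[1,2,3],[1,2,8],
    [1,3,7],[1,7,8],[2,4,7],[2,4,8],[2,6,7],[3,4,5],[3,4,8],[3,5,9],[3,6,7],[3,6,8],
    [4,5,6],[4,6,9],[5,8,9],[6,8,9]],
    [(0,0,0),(0,0,2),(-2,3,1),(-3,-2,-3),(-1,3,-1),(1,2,-2),(1,-3,-1),(2,-3,1),
    (3,2,-3),(-1,-2,-2)],
    [(0,3,6),(0,4,8),(2,4,7),(2,6,7),(0,5,9),(3,4,5),(5,6,9),(1,3,8),(0,4,6),(0,5,8),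
    (0,2,3),(3,6,8),(0,4,9),(0,7,8),(5,8,9),(0,5,6),(1,2,8),(1,3,7),(0,3,9),(0,2,6),
    (0,4,7),(1,2,3),(1,7,8),(2,4,8),(3,4,8),(3,5,9),(3,6,7),(4,5,6),(4,6,9),(6,8,9)], 3305403948),
    ([[0,2,6],[0,2,9],[0,4,7],[0,4,9],[0,5,6],[0,5,7],[1,2,3],[1,2,8],[1,3,7],[1,7,8],
    [2,3,9],[2,4,7],[2,4,8],[2,6,7],[3,4,5],[3,4,8],[3,5,9],[3,6,7],[3,6,8],[4,5,6],
    [4,6,9],[5,7,8],[5,8,9],[6,8,9]],
    [(0,0,1),(0,0,3),(3,3,2),(-3,3,-2),(1,-2,-1),(-3,-1,-3),(-1,2,-1),(-3,-3,2),
    (3,-3,-2),(3,1,-3)],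
    [(2,4,7),(3,5,6),(4,8,9),(2,6,7),(2,3,9),(5,7,8),(0,4,6),(3,4,5),(3,8,9),(1,3,8),
    (0,2,9),(4,6,9),(0,5,7),(1,2,3),(1,3,7),(2,4,8),(3,6,8),(3,5,9),(0,2,6),(0,4,7),
    (0,4,9),(0,5,6),(1,2,8),(1,7,8),(3,4,8),(3,6,7),(4,5,6),(5,8,9),(6,8,9)], 3081808470),
    ([[0,2,6],[0,2,9],[0,4,7],[0,4,9],[0,5,6],[0,5,7],[1,2,3],[1,2,8],[1,3,7],[1,7,8],
    [2,3,5],[2,4,7],[2,4,8],[2,5,9],[2,6,7],[3,4,5],[3,4,8],[3,6,7],[3,6,8],[4,5,6],
    [4,6,9],[5,7,9],[6,8,9],[7,8,9]],
    [(0,0,2),(0,0,-3),(2,-3,1),(2,3,-1),(1,-2,0),(3,3,3),(-1,2,0),(-2,3,1),(-2,-3,-1),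
    (-3,-3,3)],
    [(2,5,7),(2,6,7),(1,3,8),(0,4,7),(4,7,9),(3,4,6),(2,4,5),(2,4,8),(3,6,7),(0,2,5),
    (5,7,9),(1,7,8),(4,5,6),(6,8,9),(1,2,3),(0,2,9),(0,5,6),(2,3,5),(0,2,6),(0,4,9),
    (0,5,7),(1,2,8),(1,3,7),(2,4,7),(2,5,9),(3,4,5),(3,4,8),(3,6,8),(4,6,9),(7,8,9)], 3221795498),
    ([[0,2,6],[0,2,9],[0,4,7],[0,4,9],[0,5,6],[0,5,7],[1,2,3],[1,2,8],[1,3,7],[1,7,8],
    [2,3,5],[2,4,7],[2,4,8],[2,5,9],[2,6,7],[3,5,8],[3,6,7],[3,6,9],[3,8,9],[4,5,6],
    [4,5,8],[4,6,9],[5,7,9],[7,8,9]],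
    [(0,0,0),(0,0,3),(3,-3,1),(-3,-3,-3),(2,-1,-1),(3,-1,-2),(-2,1,-1),(-3,3,1),
    (3,3,-3),(-3,1,-2)],
    [(2,4,7),(2,3,7),(2,5,9),(5,8,9),(5,7,9),(0,5,7),(3,6,9),(0,4,6),(4,6,8),(1,3,8),
    (0,2,6),(0,4,9),(2,6,7),(4,5,6),(1,2,8),(1,7,8),(2,3,5),(0,2,9),(0,4,7),(0,5,6),
    (1,2,3),(1,3,7),(2,4,8),(3,5,8),(3,6,7),(3,8,9),(4,5,8),(4,6,9),(7,8,9)], 3201458454),
    ([[0,2,6],[0,2,9],[0,4,7],[0,4,9],[0,5,6],[0,5,7],[1,2,5],[1,2,8],[1,3,5],[1,3,7],
    [1,7,9],[1,8,9],[2,4,7],[2,4,8],[2,5,9],[2,6,7],[3,5,8],[3,6,7],[3,6,9],[3,8,9],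
    [4,5,6],[4,5,8],[4,6,9],[5,7,9]],
    [(0,0,-2),(0,0,1),(-1,0,-1),(2,1,3),(-3,1,-3),(0,3,0),(3,-1,-3),(1,0,-1),(-2,-1,3),
    (0,-3,0)],
    [(2,5,7),(1,7,9),(2,4,7),(0,4,6),(1,8,9),(1,2,5),(1,3,5),(2,6,7),(0,6,9),(0,4,5),
    (1,2,8),(3,6,8),(0,2,9),(0,4,7),(2,4,8),(0,4,9),(0,5,6),(1,3,7),(2,5,9),(3,5,8),
    (3,6,9),(0,2,6),(0,5,7),(3,6,7),(3,8,9),(4,5,6),(4,5,8),(4,6,9),(5,7,9)], 3010485000)]"

definition half_turn_realizations4 :: "realization list" where
  "half_turn_realizations4 = [
    ([[0,2,6],[0,2,9],[0,4,7],[0,4,9],[0,5,6],[0,5,7],[1,2,5],[1,2,8],[1,3,5],[1,3,7],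
    [1,7,9],[1,8,9],[2,4,7],[2,4,8],[2,5,9],[2,6,7],[3,4,6],[3,4,9],[3,5,8],[3,6,7],
    [3,8,9],[4,6,8],[5,6,8],[5,7,9]],
    [(0,0,-3),(0,0,2),(3,-3,-1),(0,1,1),(-3,0,0),(3,2,3),(3,0,0),(-3,3,-1),(0,-1,1),
    (-3,-2,3)],
    [(2,3,4),(3,7,9),(5,6,7),(1,8,9),(0,2,4),(4,6,8),(1,3,5),(1,2,5),(2,4,7),(0,5,9),
    (1,2,8),(2,6,7),(1,7,9),(2,4,9),(3,4,6),(3,5,8),(0,2,6),(0,4,7),(3,4,9),(0,2,9),
    (0,4,9),(0,5,6),(0,5,7),(1,3,7),(2,4,8),(2,5,9),(3,6,7),(3,8,9),(5,6,8),(5,7,9)], 2672552564),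
    ([[0,2,6],[0,2,9],[0,4,7],[0,4,9],[0,5,6],[0,5,7],[1,2,5],[1,2,8],[1,3,5],[1,3,7],
    [1,7,9],[1,8,9],[2,3,6],[2,3,7],[2,5,9],[2,7,8],[3,4,6],[3,4,9],[3,5,8],[3,8,9],
    [4,6,8],[4,7,8],[5,6,8],[5,7,9]],
    [(0,0,3),(0,0,1),(2,-1,0),(1,-1,-1),(-1,3,-3),(-3,-1,2),(1,-3,-3),(-2,1,0),
    (-1,1,-1),(3,1,2)],
    [(3,5,8),(1,2,3),(4,5,9),(2,5,9),(0,4,6),(1,7,8),(1,7,9),(0,2,5),(3,8,9),(0,7,9),
    (2,3,6),(5,6,8),(1,2,7),(1,3,5),(4,7,8),(0,5,7),(1,2,8),(1,3,7),(3,4,6),(0,2,6),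
    (0,2,9),(0,4,7),(0,4,9),(0,5,6),(1,2,5),(1,8,9),(2,3,7),(2,7,8),(3,4,9),(4,6,8),
    (5,7,9)], 2899058688),
    ([[0,2,6],[0,2,9],[0,4,7],[0,4,9],[0,5,6],[0,5,7],[1,2,5],[1,2,8],[1,3,5],[1,3,7],
    [1,7,9],[1,8,9],[2,3,4],[2,3,7],[2,4,6],[2,5,9],[2,7,8],[3,4,9],[3,5,8],[3,8,9],
    [4,6,7],[5,6,8],[5,7,9],[6,7,8]],
    [(0,0,-3),(0,0,1),(-3,1,-1),(1,1,0),(3,0,-2),(-1,-2,2),(-3,0,-2),(3,-1,-1),
    (-1,-1,0),(1,2,2)],
    [(2,3,7),(5,7,8),(2,3,9),(0,4,6),(1,3,5),(1,8,9),(2,7,8),(0,5,9),(2,3,4),(6,7,8),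
    (1,2,5),(1,7,9),(1,3,8),(0,2,6),(0,4,7),(0,4,9),(0,5,6),(0,2,9),(0,5,7),(1,2,8),
    (1,3,7),(2,4,6),(2,5,9),(3,4,9),(3,5,8),(3,8,9),(4,6,7),(5,6,8),(5,7,9)], 3017079764),
    ([[0,2,6],[0,2,9],[0,3,4],[0,3,9],[0,4,7],[0,5,7],[0,5,8],[0,6,8],[1,2,5],[1,2,8],
    [1,3,5],[1,3,7],[1,7,9],[1,8,9],[2,3,4],[2,3,7],[2,4,6],[2,5,9],[2,7,8],[3,5,8],
    [3,8,9],[4,6,7],[5,7,9],[6,7,8]],
    [(0,0,1),(0,0,-2),(2,-3,0),(-1,0,-1),(3,-1,3),(3,2,-3),(-3,1,3),(-2,3,0),(1,0,-1),
    (-3,-2,-3)],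
    [(2,3,8),(2,7,8),(0,4,6),(3,8,9),(1,3,5),(2,3,4),(2,5,9),(0,5,7),(1,7,9),(0,2,6),
    (0,6,7),(1,2,8),(1,5,8),(0,3,4),(0,5,8),(0,2,9),(0,4,7),(0,6,8),(1,3,7),(0,3,9),
    (1,2,5),(1,8,9),(2,3,7),(2,4,6),(3,5,8),(4,6,7),(5,7,9),(6,7,8)], 3245982334),
    ([[0,2,6],[0,2,9],[0,3,4],[0,3,9],[0,4,7],[0,5,7],[0,5,8],[0,6,8],[1,2,5],[1,2,8],
    [1,3,5],[1,3,7],[1,7,9],[1,8,9],[2,3,6],[2,3,7],[2,5,9],[2,7,8],[3,4,6],[3,5,8],
    [3,8,9],[4,6,8],[4,7,8],[5,7,9]],
    [(0,0,1),(0,0,-2),(-1,-1,-1),(-3,-2,-3),(-3,2,2),(3,-1,0),(3,-2,2),(1,1,-1),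
    (3,2,-3),(-3,1,0)],
    [(2,3,9),(5,7,8),(0,4,6),(1,2,8),(2,5,7),(1,3,7),(1,8,9),(0,3,8),(1,3,5),(0,3,4),
    (0,5,8),(1,2,7),(0,2,6),(0,4,7),(1,7,9),(4,6,8),(0,2,9),(2,3,6),(2,5,9),(0,3,9),
    (0,5,7),(0,6,8),(1,2,5),(2,3,7),(2,7,8),(3,4,6),(3,5,8),(3,8,9),(4,7,8),(5,7,9)], 3218480214),
    ([[0,2,6],[0,2,9],[0,3,4],[0,3,9],[0,4,7],[0,5,7],[0,5,8],[0,6,8],[1,2,5],[1,2,8],
    [1,3,5],[1,3,7],[1,7,9],[1,8,9],[2,4,7],[2,4,8],[2,5,9],[2,6,7],[3,4,6],[3,5,8],
    [3,6,7],[3,8,9],[4,6,8],[5,7,9]],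
    [(0,0,1),(0,0,-3),(0,-1,-1),(-3,1,3),(2,-1,2),(1,3,-2),(-2,1,2),(0,1,-1),(3,-1,3),
    (-1,-3,-2)],
    [(2,5,7),(0,4,8),(0,3,6),(1,2,8),(3,7,9),(2,5,9),(1,5,7),(3,8,9),(3,5,8),(0,2,7),
    (0,2,6),(0,4,7),(1,7,9),(0,3,4),(0,6,8),(2,4,7),(2,6,7),(0,2,9),(0,5,7),(1,3,5),
    (3,4,6),(0,3,9),(0,5,8),(1,2,5),(1,3,7),(1,8,9),(2,4,8),(3,6,7),(4,6,8),(5,7,9)], 2726387786),
    ([[0,2,6],[0,2,9],[0,3,4],[0,3,9],[0,4,7],[0,5,7],[0,5,8],[0,6,8],[1,2,3],[1,2,8],
    [1,3,7],[1,7,8],[2,3,5],[2,4,7],[2,4,8],[2,5,9],[2,6,7],[3,4,6],[3,5,8],[3,6,7],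
    [3,8,9],[4,6,8],[5,7,9],[7,8,9]],
    [(0,0,2),(0,0,-2),(2,-3,-1),(3,-2,3),(-1,1,0),(3,3,-3),(1,-1,0),(-2,3,-1),(-3,2,3),
    (-3,-3,-3)],
    [(2,3,6),(2,4,8),(0,3,7),(2,5,7),(0,2,8),(2,4,7),(1,2,3),(0,3,6),(5,8,9),(0,5,8),
    (1,3,7),(2,5,9),(4,6,8),(0,4,7),(0,3,9),(0,5,6),(5,7,9),(1,7,8),(3,5,8),(0,3,4),
    (2,6,7),(0,2,6),(0,2,9),(0,5,7),(0,6,8),(1,2,8),(2,3,5),(3,4,6),(3,6,7),(3,8,9),
    (7,8,9)], 3618565916),
    ([[0,3,4],[0,3,9],[0,4,5],[0,5,8],[0,6,8],[0,6,9],[1,2,3],[1,2,8],[1,3,7],[1,7,8],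
    [2,3,5],[2,4,7],[2,4,8],[2,5,9],[2,6,7],[2,6,9],[3,4,6],[3,5,8],[3,6,7],[3,8,9],
    [4,5,7],[4,6,8],[5,7,9],[7,8,9]],
    [(0,0,2),(0,0,-2),(1,2,0),(3,-3,-3),(1,0,-1),(2,3,1),(-1,0,-1),(-1,-2,0),(-3,3,-3),
    (-2,-3,1)],
    [(2,3,5),(7,8,9),(2,4,7),(0,5,6),(1,3,7),(4,6,7),(2,4,8),(5,7,9),(0,6,9),(0,3,9),
    (1,3,8),(0,5,8),(3,4,6),(0,4,5),(2,6,9),(1,2,3),(0,3,4),(0,6,8),(1,2,8),(1,7,8),
    (2,5,9),(2,6,7),(3,5,8),(3,6,7),(3,8,9),(4,5,7),(4,6,8)], 3207673178),
    ([[0,4,5],[0,4,9],[0,5,6],[0,6,9],[1,2,3],[1,2,8],[1,3,7],[1,7,8],[2,3,5],[2,4,7],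
    [2,4,8],[2,5,9],[2,6,7],[2,6,9],[3,4,6],[3,4,9],[3,5,8],[3,6,7],[3,8,9],[4,5,7],
    [4,6,8],[5,6,8],[5,7,9],[7,8,9]],
    [(0,0,3),(0,0,0),(0,-1,-2),(-2,-1,1),(3,2,2),(3,0,-3),(-3,-2,2),(0,1,-2),(2,1,1),
    (-3,0,-3)],
    [(3,4,6),(5,6,8),(2,4,9),(2,3,7),(2,5,8),(3,8,9),(2,5,7),(2,7,8),(0,4,5),(7,8,9),
    (1,2,3),(0,6,9),(0,5,6),(2,6,7),(3,4,9),(1,2,8),(1,3,7),(2,3,5),(2,4,7),(2,4,8),
    (2,5,9),(0,4,9),(1,7,8),(2,6,9),(3,5,8),(3,6,7),(4,5,7),(4,6,8),(5,7,9)], 3426369536),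
    ([[0,4,5],[0,4,9],[0,5,6],[0,6,9],[1,2,8],[1,2,9],[1,3,5],[1,3,7],[1,5,9],[1,7,8],
    [2,3,6],[2,3,7],[2,4,5],[2,4,8],[2,5,7],[2,6,9],[3,4,6],[3,4,9],[3,5,8],[3,8,9],
    [4,6,8],[5,6,8],[5,7,9],[7,8,9]],
    [(0,0,-2),(-2,2,1),(0,0,-1),(3,-2,2),(-1,-3,-3),(-1,3,0),(1,3,-3),(2,-2,1),
    (-3,2,2),(1,-3,0)],
    [(1,5,9),(3,6,9),(4,5,8),(2,5,7),(0,4,9),(0,5,6),(1,2,9),(1,3,7),(3,5,8),(7,8,9),
    (2,4,5),(2,6,9),(1,3,5),(1,2,8),(3,4,6),(5,7,9),(0,2,3),(4,6,8),(0,4,5),(0,6,9),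
    (1,7,8),(2,3,6),(2,3,7),(2,4,6),(2,4,8),(3,4,9),(3,8,9),(5,6,8)], 3310375736),
    ([[0,3,4],[0,3,9],[0,4,5],[0,5,8],[0,6,8],[0,6,9],[1,2,8],[1,2,9],[1,3,5],[1,3,7],
    [1,5,9],[1,7,8],[2,3,6],[2,3,7],[2,4,5],[2,4,8],[2,5,7],[2,6,9],[3,4,6],[3,5,8],
    [3,8,9],[4,6,8],[5,7,9],[7,8,9]],
    [(0,0,3),(-1,0,-2),(0,0,1),(2,3,-3),(0,1,2),(-3,1,-1),(0,-1,2),(1,0,-2),(-2,-3,-3),
    (3,-1,-1)],
    [(2,3,9),(2,5,8),(3,4,6),(4,6,8),(1,2,7),(1,3,5),(7,8,9),(0,3,8),(1,3,7),(1,2,9),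
    (2,5,7),(0,4,9),(2,4,5),(2,6,9),(2,3,4),(3,5,8),(3,8,9),(0,4,5),(0,6,8),(1,2,8),
    (1,5,9),(0,3,4),(0,3,9),(0,5,8),(0,6,9),(1,7,8),(2,3,6),(2,3,7),(2,4,8),(5,7,9)], 3071492722),
    ([[0,3,4],[0,3,9],[0,4,5],[0,5,8],[0,6,8],[0,6,9],[1,2,4],[1,2,9],[1,3,5],[1,3,7],
    [1,4,8],[1,5,9],[1,7,8],[2,4,5],[2,5,7],[2,6,7],[2,6,9],[3,4,6],[3,5,8],[3,6,7],
    [3,8,9],[4,6,8],[5,7,9],[7,8,9]],
    [(0,0,-2),(-2,-3,1),(0,0,-3),(0,-2,2),(-2,-1,-1),(-1,2,3),(2,1,-1),(2,3,1),(0,2,2),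
    (1,-2,3)],
    [(1,5,8),(3,7,9),(0,3,5),(1,2,9),(2,5,7),(0,8,9),(0,3,6),(0,4,8),(1,2,4),(1,3,7),
    (2,6,7),(1,7,8),(1,4,8),(1,5,9),(3,4,6),(3,6,7),(5,7,9),(0,6,8),(2,4,5),(0,6,9),
    (3,5,8),(0,3,4),(0,3,9),(0,4,5),(0,5,8),(1,3,5),(2,6,9),(3,8,9),(4,6,8),(7,8,9)], 2662596564)]"

text \<open>Nine vertices form three orbits of length three; the remaining one has three equal
  coordinates and lies on the axis.\<close>

definition third_turn_realizations :: "realization list" where
  "third_turn_realizations = [
    ([[0,2,4],[0,2,5],[0,3,4],[0,3,9],[0,5,8],[0,6,8],[0,6,9],[1,2,4],[1,2,9],[1,3,5],
    [1,3,7],[1,4,8],[1,5,9],[1,7,8],[2,5,7],[2,6,7],[2,6,9],[3,4,7],[3,5,8],[3,8,9],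
    [4,6,7],[4,6,8],[5,7,9],[7,8,9]],
    [(2,0,1),(0,1,1),(0,1,2),(1,1,0),(1,2,0),(1,0,1),(0,0,0),(-2,-1,1),(-1,1,-2),
    (1,-2,-1)],
    [(0,6,9),(2,6,7),(4,6,8),(1,3,5),(0,5,8),(1,2,9),(3,4,7),(1,3,7),(1,5,8),(7,8,9),
    (3,5,7),(0,2,4),(0,3,8),(2,5,9),(1,4,7),(0,3,9),(1,4,6),(0,2,5),(0,3,4),(0,6,8),
    (1,2,4),(1,4,8),(1,5,9),(1,7,8),(2,5,7),(2,6,9),(3,5,8),(3,8,9),(4,6,7),(5,7,9)], 2579549406),
    ([[0,2,4],[0,2,5],[0,3,4],[0,3,6],[0,5,8],[0,6,8],[1,2,4],[1,2,9],[1,3,5],[1,3,7],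
    [1,4,6],[1,5,9],[1,6,8],[1,7,8],[2,5,6],[2,6,9],[3,4,7],[3,5,8],[3,6,9],[3,8,9],
    [4,6,7],[5,6,7],[5,7,9],[7,8,9]],
    [(-2,1,2),(-1,-1,-2),(2,-2,1),(-2,-1,-1),(1,2,-2),(-1,-2,-1),(-1,-1,-1),(0,1,-1),
    (-1,0,1),(1,-1,0)],
    [(0,3,6),(1,4,6),(2,5,6),(0,2,4),(1,3,5),(0,6,8),(2,6,9),(1,4,7),(5,6,7),(3,8,9),
    (6,7,8),(5,7,9),(1,4,9),(2,5,8),(3,4,7),(6,8,9),(0,2,5),(1,2,4),(1,6,8),(5,6,9),
    (0,3,4),(0,5,8),(1,2,9),(1,3,7),(1,5,9),(1,7,8),(3,5,8),(3,6,9),(4,6,7),(7,8,9)], 2868576102),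
    ([[0,1,6],[0,1,8],[0,2,4],[0,2,5],[0,3,4],[0,3,6],[0,5,8],[1,2,4],[1,2,9],[1,3,5],
    [1,3,7],[1,4,6],[1,5,9],[1,7,8],[2,3,6],[2,3,9],[2,5,6],[3,4,7],[3,5,8],[3,8,9],
    [4,5,6],[4,5,7],[5,7,9],[7,8,9]],
    [(-1,0,-2),(2,-1,1),(-2,-1,0),(1,2,-1),(0,-2,-1),(-1,1,2),(0,0,0),(0,-1,-1),
    (-1,0,-1),(-1,-1,0)],
    [(0,3,6),(1,5,8),(1,4,6),(4,5,7),(2,3,9),(2,5,6),(0,2,4),(0,3,7),(1,3,5),(1,4,9),
    (2,5,8),(1,8,9),(3,7,9),(1,7,8),(0,1,8),(1,5,9),(3,5,8),(0,2,5),(0,3,4),(1,2,4),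
    (1,3,7),(0,1,6),(0,5,8),(1,2,9),(2,3,6),(3,4,7),(3,8,9),(4,5,6),(5,7,9),(7,8,9)], 3142749612),
    ([[0,1,6],[0,1,7],[0,2,4],[0,2,5],[0,3,4],[0,3,6],[0,5,8],[0,7,8],[1,2,4],[1,2,9],
    [1,3,5],[1,3,7],[1,4,6],[1,5,9],[2,3,6],[2,3,8],[2,5,6],[2,8,9],[3,4,7],[3,5,8],
    [4,5,6],[4,5,9],[4,7,9],[7,8,9]],
    [(0,2,-1),(0,-1,-2),(-1,0,2),(-2,0,-1),(2,-1,0),(-1,-2,0),(-2,-2,-2),(1,2,-1),
    (-1,1,2),(2,-1,1)],
    [(0,2,5),(0,3,4),(1,2,4),(0,2,4),(1,3,7),(1,5,9),(3,5,8),(0,5,6),(0,7,8),(1,3,5),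
    (2,8,9),(4,7,9),(0,1,6),(2,3,6),(7,8,9),(4,5,6),(0,3,6),(0,1,7),(0,5,8),(1,2,9),
    (1,4,6),(2,3,8),(2,5,6),(3,4,7),(4,5,9)], 2852616960),
    ([[0,1,6],[0,1,7],[0,2,4],[0,2,5],[0,3,4],[0,3,6],[0,5,7],[1,2,4],[1,2,8],[1,3,5],
    [1,3,7],[1,4,6],[1,5,9],[1,8,9],[2,3,6],[2,3,8],[2,5,6],[3,4,9],[3,5,8],[3,7,9],
    [4,5,6],[4,5,9],[5,7,8],[7,8,9]],
    [(2,-3,-2),(2,3,3),(-2,2,-3),(3,2,3),(-3,-2,2),(3,3,2),(2,2,2),(1,-2,-1),(-1,1,-2),
    (-2,-1,1)],
    [(0,3,6),(1,4,5),(2,3,5),(0,2,4),(3,4,8),(0,1,7),(1,2,8),(3,7,9),(4,6,7),(1,3,5),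
    (5,7,8),(2,5,6),(4,5,9),(1,8,9),(2,3,8),(0,5,7),(1,4,6),(0,3,4),(0,5,9),(0,1,6),
    (0,2,5),(1,2,4),(1,3,7),(1,5,9),(2,3,6),(3,4,9),(3,5,8),(4,5,6),(7,8,9)], 3111115176),
    ([[0,2,4],[0,2,5],[0,3,4],[0,3,6],[0,5,7],[0,6,7],[1,2,4],[1,2,8],[1,3,5],[1,3,7],
    [1,4,6],[1,5,9],[1,6,7],[1,8,9],[2,5,6],[2,6,8],[3,4,9],[3,5,8],[3,6,8],[3,7,9],
    [4,6,9],[5,6,9],[5,7,8],[7,8,9]],
    [(-2,1,-1),(1,-1,0),(1,-1,-2),(-1,0,1),(-1,-2,1),(0,1,-1),(1,1,1),(0,2,2),(2,2,0),
    (2,0,2)],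
    [(1,3,5),(1,6,9),(3,6,7),(5,6,8),(7,8,9),(0,3,6),(1,4,6),(2,5,6),(0,5,7),(1,2,8),
    (3,4,9),(1,3,7),(1,5,9),(3,5,8),(0,2,4),(0,2,5),(0,3,4),(0,6,7),(1,2,4),(1,6,7),
    (1,8,9),(2,6,8),(3,6,8),(3,7,9),(4,6,9),(5,6,9),(5,7,8)], 2837724318),
    ([[0,2,4],[0,2,5],[0,3,4],[0,3,6],[0,5,8],[0,6,7],[0,7,8],[1,2,4],[1,2,8],[1,3,5],
    [1,3,7],[1,4,7],[1,5,9],[1,8,9],[2,3,6],[2,3,8],[2,5,6],[3,4,9],[3,5,8],[3,7,9],
    [4,6,7],[4,6,9],[5,6,9],[7,8,9]],
    [(0,-1,1),(1,1,-1),(1,-1,1),(2,2,2),(-1,1,1),(1,0,-2),(0,-2,1),(-1,1,0),(1,0,-1),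
    (-2,1,0)],
    [(1,3,6),(0,7,8),(1,8,9),(0,2,5),(2,3,4),(4,6,7),(5,6,9),(3,4,7),(1,3,8),(0,2,3),
    (0,5,8),(7,8,9),(0,6,7),(1,2,8),(1,4,7),(1,3,5),(3,4,9),(0,2,4),(1,5,9),(2,3,6),
    (3,7,9),(0,3,4),(0,3,6),(1,2,4),(1,3,7),(2,3,8),(2,5,6),(3,5,8),(4,6,9)], 2583935136)]"

text \<open>Two vertices on the axis are exchanged, the other eight form two orbits of length
  four.\<close>

definition quarter_turn_realizations :: "realization list" where
  "quarter_turn_realizations = [
    ([[0,2,3],[0,2,6],[0,3,9],[0,4,5],[0,4,9],[0,5,8],[0,6,7],[0,7,8],[1,2,4],[1,2,8],
    [1,3,5],[1,3,7],[1,4,7],[1,5,6],[1,6,9],[1,8,9],[2,3,8],[2,4,5],[2,5,6],[3,5,8],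
    [3,7,9],[4,6,7],[4,6,9],[7,8,9]],
    [(0,0,2),(0,0,-2),(-1,3,3),(0,1,-1),(-1,0,1),(1,-3,3),(1,0,1),(-3,-1,-3),(0,-1,-1),
    (3,1,-3)],
    [(2,4,9),(0,6,7),(1,3,5),(1,7,8),(0,3,9),(0,5,6),(2,3,8),(0,4,5),(1,3,7),(1,6,9),
    (2,6,8),(3,5,6),(0,2,6),(0,5,8),(1,2,4),(2,4,5),(3,4,5),(3,7,9),(4,6,7),(0,4,9),
    (1,8,9),(0,2,3),(0,7,8),(1,2,8),(1,4,7),(1,5,6),(2,5,6),(3,5,8),(4,6,9),(7,8,9)], 2517464584),
    ([[0,3,6],[0,3,9],[0,4,8],[0,4,9],[0,6,7],[0,7,8],[1,2,4],[1,2,8],[1,3,4],[1,3,5],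
    [1,5,6],[1,6,8],[2,3,6],[2,3,8],[2,4,5],[2,5,6],[3,4,7],[3,5,8],[3,7,9],[4,5,8],
    [4,6,7],[4,6,9],[6,8,9],[7,8,9]],
    [(0,0,3),(0,0,-3),(0,-1,-1),(-3,-3,-2),(3,-3,2),(0,1,-1),(-3,3,2),(1,0,1),(3,3,-2),
    (-1,0,1)],
    [(2,3,6),(4,5,8),(3,4,7),(6,8,9),(0,4,6),(1,3,8),(2,3,4),(3,5,8),(3,6,9),(4,6,7),
    (0,7,8),(1,5,6),(2,5,6),(7,8,9),(0,3,6),(0,4,9),(1,2,3),(1,2,4),(1,2,8),(0,3,9),
    (0,4,8),(0,6,7),(1,3,4),(1,3,5),(1,6,8),(2,3,5),(2,3,8),(2,4,5),(3,7,9),(4,6,9),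
    (4,7,8)], 3473489628)]"

text \<open>Two vertices lie on the third coordinate axis and are exchanged by the other two
  half-turns; the other eight form two orbits of length four.\<close>

definition dihedral_realizations :: "realization list" where
  "dihedral_realizations = [
    ([[0,2,3],[0,2,6],[0,3,4],[0,4,8],[0,6,7],[0,7,9],[0,8,9],[1,2,7],[1,2,8],[1,3,5],
    [1,3,7],[1,5,6],[1,6,8],[2,3,8],[2,5,6],[2,5,7],[3,4,9],[3,5,8],[3,7,9],[4,5,7],
    [4,5,8],[4,6,7],[4,6,9],[6,8,9]],
    [(3,2,3),(0,0,1),(3,-2,-3),(-1,-1,2),(-3,-2,3),(-3,2,-3),(-1,1,-2),(1,-1,-2),
    (1,1,2),(0,0,-1)],
    [(1,3,7),(6,8,9),(0,2,7),(3,4,5),(1,4,8),(4,6,9),(0,2,3),(0,7,9),(1,5,6),(3,5,8),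
    (2,5,7),(0,4,8),(0,8,9),(0,2,6),(3,7,9),(1,2,8),(4,5,7),(4,5,8),(0,6,7),(0,3,4),
    (1,2,7),(1,3,5),(1,6,8),(2,3,8),(2,5,6),(3,4,9),(4,6,7)], 2691099020),
    ([[0,3,4],[0,3,6],[0,4,8],[0,6,7],[0,7,9],[0,8,9],[1,2,7],[1,2,8],[1,3,5],[1,3,7],
    [1,5,6],[1,6,8],[2,3,6],[2,3,8],[2,5,6],[2,5,7],[3,4,9],[3,5,8],[3,7,9],[4,6,7],
    [4,6,9],[4,7,8],[5,7,8],[6,8,9]],
    [(0,1,-1),(0,0,3),(0,-1,1),(-3,-3,2),(0,-1,-1),(0,1,1),(-3,3,-2),(3,-3,-2),(3,3,2),
    (0,0,-3)],
    [(0,3,6),(4,7,8),(2,5,6),(0,3,4),(1,3,8),(4,7,9),(0,6,7),(2,3,7),(1,6,8),(5,7,8),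
    (0,8,9),(4,6,9),(3,5,6),(0,4,6),(1,2,3),(1,3,5),(3,4,9),(1,2,7),(1,2,8),(0,4,8),
    (0,7,9),(1,3,7),(1,5,6),(2,3,6),(2,3,8),(2,5,7),(3,5,8),(3,7,9),(4,6,7),(6,8,9)], 3472327116)]"

definition half_turn_realizations :: "realization list" where
  "half_turn_realizations = half_turn_realizations1 @ half_turn_realizations2 @
     half_turn_realizations3 @ half_turn_realizations4"

definition realizations :: "realization list" where
  "realizations =
     half_turn_realizations @ third_turn_realizations @ quarter_turn_realizations @ dihedral_realizations"

fun stored_invariant :: "realization \<Rightarrow> nat" where "stored_invariant (F, cs, ts, i) = i"

section \<open>Evaluation of the data\<close>

lemma half_turn_checks1: "list_all (realizes half_turn_z) half_turn_realizations1" by code_simp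
lemma half_turn_checks2: "list_all (realizes half_turn_z) half_turn_realizations2" by code_simp
lemma half_turn_checks3: "list_all (realizes half_turn_z) half_turn_realizations3" by code_simp
lemma half_turn_checks4: "list_all (realizes half_turn_z) half_turn_realizations4" by code_simp

lemma third_turn_checks: "list_all (realizes third_turn) third_turn_realizations" by code_simp

lemma quarter_turn_checks: "list_all (realizes quarter_turn_reflection) quarter_turn_realizations"
  by code_simp

lemma dihedral_checks:
  "list_all (realizes half_turn_x) dihedral_realizations"
  "list_all (realizes half_turn_y) dihedral_realizations"
  "list_all (realizes half_turn_z) dihedral_realizations"
  by code_simp+

lemma distinct_invariants: "distinct (map stored_invariant realizations)" by code_simp

lemma chain_realizations: "chain flips base_complex (map fst realizations)" by code_simp

lemma length_realizations:
  "length half_turn_realizations = 46" "length third_turn_realizations = 7"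
  "length quarter_turn_realizations = 2" "length dihedral_realizations = 2"
  by (simp_all add: half_turn_realizations_def half_turn_realizations1_def half_turn_realizations2_def
      half_turn_realizations3_def half_turn_realizations4_def third_turn_realizations_def
      quarter_turn_realizations_def dihedral_realizations_def)

section \<open>The prescribed symmetries differ from the identity\<close>

lemma rotational_symmetry_imp_nontrivial:
  assumes "rotational_symmetry k K \<psi>" "2 \<le> k"
  shows "\<exists>g\<in>geometric_symmetries K \<psi>. g \<noteq> id"
proof -
  obtain g where g: "g \<in> geometric_symmetries K \<psi>" "has_order g k"
    using assms(1) unfolding rotational_symmetry_def rotation_of_order_def by blast
  then have "g ^^ 1 \<noteq> id" using assms(2) unfolding has_order_def by (metis Suc_1 Suc_le_lessD zero_less_one)
  then show ?thesis using g(1) by auto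
qed

text \<open>The rotation fixes its axis pointwise and the reflection reverses the direction of the
  axis, so the displacement from \<open>p\<close> to \<open>p + u\<close> becomes
  \<open>- u\<close>.\<close>

lemma rotation_reflection_4_imp_nontrivial:
  assumes "rotation_reflection_4_symmetry K \<psi>"
  shows "\<exists>g\<in>geometric_symmetries K \<psi>. g \<noteq> id"
proof -
  obtain g p q u where g: "g \<in> geometric_symmetries K \<psi>" and u: "norm u = 1"
    and gdef: "g = reflection_in_plane q u \<circ> rotation_about p u (pi / 2)"
    using assms unfolding rotation_reflection_4_symmetry_def rotation_reflection_4_def by blast
  have uu: "u \<bullet> u = 1" using u by (simp add: norm_eq_1)
  have "g (p + u) - g p = - u"
    by (simp add: gdef rotation_about_def reflection_in_plane_def cross_refl uu algebra_simps
        inner_add_right inner_diff_right scaleR_2)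
  moreover have "- u \<noteq> u"
  proof -
    have "u \<noteq> 0" using u by auto
    then show ?thesis by (auto simp: vec_eq_iff)
  qed
  ultimately have "g \<noteq> id" by auto
  then show ?thesis using g by blast
qed

text \<open>The half-turn about \<open>u\<close> reverses the orthogonal direction
  \<open>v\<close>.\<close>

lemma D2_symmetry_imp_nontrivial:
  assumes "D2_symmetry K \<psi>"
  shows "\<exists>g\<in>geometric_symmetries K \<psi>. g \<noteq> id"
proof -
  obtain p u v where g: "rotation_about p u pi \<in> geometric_symmetries K \<psi>"
    and uv: "norm v = 1" "orthogonal u v"
    using assms unfolding D2_symmetry_def dihedral_D2_def by blast
  have "rotation_about p u pi (p + v) - p = - v"
    using uv(2) by (simp add: rotation_about_def orthogonal_def)
  moreover have "- v \<noteq> v"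
  proof -
    have "v \<noteq> 0" using uv(1) by auto
    then show ?thesis by (auto simp: vec_eq_iff)
  qed
  ultimately have "rotation_about p u pi \<noteq> id" by auto
  then show ?thesis using g by blast
qed

section \<open>Assembling the four classes\<close>

fun points_of :: "realization \<Rightarrow> point list" where "points_of (F, cs, ts, i) = cs"

definition complex_at :: "realization \<Rightarrow> nat set set" where "complex_at e = complex_of (fst e)"

text \<open>The theorem wants coordinates as a function of the complex, hence a lookup. It is
  unambiguous because \<open>complex_at\<close> is injective on the data; values at other complexes
  do not matter.\<close>

definition coordinates :: "nat set set \<Rightarrow> nat \<Rightarrow> real^3" where
  "coordinates K = place (the (map_of (map (\<lambda>e. (complex_at e, points_of e)) realizations) K))"

lemma coordinates_complex_at:
  assumes "e \<in> set realizations" "inj_on complex_at (set realizations)" "distinct realizations"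
  shows "coordinates (complex_at e) = place (points_of e)"
proof -
  have "distinct (map fst (map (\<lambda>e. (complex_at e, points_of e)) realizations))"
    using assms(2,3) by (simp add: distinct_map comp_def)
  then have "map_of (map (\<lambda>e. (complex_at e, points_of e)) realizations) (complex_at e) = Some (points_of e)"
    using assms(1) by (intro map_of_is_SomeI) auto
  then show ?thesis by (simp add: coordinates_def)
qed

lemma realizesD:
  assumes "realizes g e"
  shows "well_formed (fst e)" "symmetric g (fst e) (points_of e)"
    "polyhedral_realization (complex_at e) (place (points_of e))"
    "invariant (set ` set (fst e)) = stored_invariant e"
  using assms embedded_imp_realization invariant_list by (cases e; auto simp: complex_at_def)+

lemma in_realizations:
  "e \<in> set half_turn_realizations \<Longrightarrow> realizes half_turn_z e"
  "e \<in> set third_turn_realizations \<Longrightarrow> realizes third_turn e"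
  "e \<in> set quarter_turn_realizations \<Longrightarrow> realizes quarter_turn_reflection e"
  "e \<in> set dihedral_realizations \<Longrightarrow> realizes half_turn_x e"
  "e \<in> set dihedral_realizations \<Longrightarrow> realizes half_turn_y e"
  "e \<in> set dihedral_realizations \<Longrightarrow> realizes half_turn_z e"
  using half_turn_checks1 half_turn_checks2 half_turn_checks3 half_turn_checks4
    third_turn_checks quarter_turn_checks dihedral_checks
  by (auto simp: half_turn_realizations_def list_all_iff)

lemma realizations_well_formed:
  assumes "e \<in> set realizations"
  shows "\<exists>g. realizes g e"
  using assms in_realizations unfolding realizations_def set_append Un_iff by blast

text \<open>Isomorphic complexes have equal invariants, and the stored values are pairwise
  different.\<close>

lemma isomorphic_imp_eq:
  assumes "e \<in> set realizations" "e' \<in> set realizations" "isomorphic_complexes (complex_at e) (complex_at e')"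
  shows "e = e'"
proof -
  obtain g g' where r: "realizes g e" "realizes g' e'" using realizations_well_formed assms by blast
  have "stored_invariant e = stored_invariant e'"
    using isomorphic_imp_invariant_eq[OF realizesD(1)[OF r(1)] realizesD(1)[OF r(2)]] assms(3)
      realizesD(4)[OF r(1)] realizesD(4)[OF r(2)] by (simp add: complex_at_def)
  then show ?thesis using assms distinct_invariants by (auto simp: distinct_map inj_on_def)
qed

lemma isomorphic_complexes_refl: "isomorphic_complexes K K"
  unfolding isomorphic_complexes_def simplicial_iso_def by (intro exI[of _ id]) auto

text \<open>Equality is a special case of isomorphism, so the invariant also shows that different
  entries give different complexes.\<close>

lemma inj_on_complex_at: "inj_on complex_at (set realizations)"
proof (rule inj_onI)
  fix e e' assume e: "e \<in> set realizations" "e' \<in> set realizations" "complex_at e = complex_at e'"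
  then have "isomorphic_complexes (complex_at e) (complex_at e')" using isomorphic_complexes_refl by simp
  then show "e = e'" using e isomorphic_imp_eq by blast
qed

lemma triangulates_realization:
  assumes "e \<in> set realizations"
  shows "triangulates (orientable_surface 2) (complex_at e)"
proof -
  obtain g where g: "realizes g e" using realizations_well_formed[OF assms] by blast
  have "fst e \<in> set (map fst realizations)" using assms by simp
  then show ?thesis
    unfolding complex_at_def
    by (intro triangulates_complex_of realizesD(1)[OF g]
        chain_homeomorphic[OF chain_realizations base_homeomorphic])
qed

theorem theorem6p1:
  shows "\<exists>(R2 :: nat set set set) (R3 :: nat set set set) (S4 :: nat set set set) (D :: nat set set set)
            (\<Psi> :: nat set set \<Rightarrow> nat \<Rightarrow> real^3).
     card R2 = 46 \<and> card R3 = 7 \<and> card S4 = 2 \<and> card D = 2 \<and> card (R2 \<union> R3 \<union> S4 \<union> D) = 57 \<and>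
     (\<forall>K \<in> R2 \<union> R3 \<union> S4 \<union> D.
        triangulates (orientable_surface 2) K \<and> card (vertices K) = 10 \<and>
        polyhedral_realization K (\<Psi> K) \<and>
        (\<exists>g \<in> geometric_symmetries K (\<Psi> K). g \<noteq> id)) \<and>
     (\<forall>K \<in> R2 \<union> R3 \<union> S4 \<union> D. \<forall>L \<in> R2 \<union> R3 \<union> S4 \<union> D.
        K \<noteq> L \<longrightarrow> \<not> isomorphic_complexes K L) \<and>
     (\<forall>K \<in> R2. rotational_symmetry 2 K (\<Psi> K)) \<and>
     (\<forall>K \<in> R3. rotational_symmetry 3 K (\<Psi> K)) \<and>
     (\<forall>K \<in> S4. rotation_reflection_4_symmetry K (\<Psi> K)) \<and>
     (\<forall>K \<in> D. D2_symmetry K (\<Psi> K))"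
proof -
  let ?C = "\<lambda>es. complex_at ` set es"
  let ?R2 = "?C half_turn_realizations" and ?R3 = "?C third_turn_realizations"
    and ?S4 = "?C quarter_turn_realizations" and ?D = "?C dihedral_realizations"
  have un: "?R2 \<union> ?R3 \<union> ?S4 \<union> ?D = ?C realizations"
    by (simp add: realizations_def image_Un Un_assoc)
  have dist: "distinct realizations" using distinct_invariants by (simp add: distinct_map)
  \<comment> \<open>By injectivity of \<open>complex_at\<close> cardinalities are list lengths.
    Applied to the whole list this gives 57, so the four classes are disjoint.\<close>
  have card: "card (?C es) = length es" if "set es \<subseteq> set realizations" "distinct es" for es
    using that card_image[OF inj_on_subset[OF inj_on_complex_at that(1)]] by (simp add: distinct_card)
  have cards: "card ?R2 = 46" "card ?R3 = 7" "card ?S4 = 2" "card ?D = 2" "card (?C realizations) = 57"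
    using dist length_realizations by (subst card; auto simp: realizations_def)+
  have coord: "coordinates (complex_at e) = place (points_of e)" if "e \<in> set realizations" for e
    using coordinates_complex_at[OF that inj_on_complex_at dist] .
  have R2: "rotational_symmetry 2 K (coordinates K)" if "K \<in> ?R2" for K
  proof -
    obtain e where e: "e \<in> set half_turn_realizations" "K = complex_at e" using \<open>K \<in> ?R2\<close> by blast
    then have "coordinates K = place (points_of e)" using coord by (simp add: realizations_def)
    then show ?thesis
      using rotational_symmetry_2[OF realizesD(1,2)[OF in_realizations(1)[OF e(1)]]] e(2)
      by (simp add: complex_at_def)
  qed
  have R3: "rotational_symmetry 3 K (coordinates K)" if "K \<in> ?R3" for K
  proof -
    obtain e where e: "e \<in> set third_turn_realizations" "K = complex_at e" using \<open>K \<in> ?R3\<close> by blast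
    then have "coordinates K = place (points_of e)" using coord by (simp add: realizations_def)
    then show ?thesis
      using rotational_symmetry_3[OF realizesD(1,2)[OF in_realizations(2)[OF e(1)]]] e(2)
      by (simp add: complex_at_def)
  qed
  have S4: "rotation_reflection_4_symmetry K (coordinates K)" if "K \<in> ?S4" for K
  proof -
    obtain e where e: "e \<in> set quarter_turn_realizations" "K = complex_at e" using \<open>K \<in> ?S4\<close> by blast
    then have "coordinates K = place (points_of e)" using coord by (simp add: realizations_def)
    then show ?thesis
      using rotation_reflection_4_symmetry[OF realizesD(1,2)[OF in_realizations(3)[OF e(1)]]] e(2)
      by (simp add: complex_at_def)
  qed
  have D: "D2_symmetry K (coordinates K)" if "K \<in> ?D" for K
  proof -
    obtain e where e: "e \<in> set dihedral_realizations" "K = complex_at e" using \<open>K \<in> ?D\<close> by blast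
    then have "coordinates K = place (points_of e)" using coord by (simp add: realizations_def)
    then show ?thesis
      using D2_symmetry[OF realizesD(1,2)[OF in_realizations(4)[OF e(1)]]
        realizesD(2)[OF in_realizations(5)[OF e(1)]] realizesD(2)[OF in_realizations(6)[OF e(1)]]] e(2)
      by (simp add: complex_at_def)
  qed
  have nontrivial: "\<exists>g\<in>geometric_symmetries K (coordinates K). g \<noteq> id" if "K \<in> ?R2 \<union> ?R3 \<union> ?S4 \<union> ?D" for K
    using that
  proof (elim UnE)
    show ?thesis if "K \<in> ?R2" using rotational_symmetry_imp_nontrivial[OF R2[OF that]] by simp
    show ?thesis if "K \<in> ?R3" using rotational_symmetry_imp_nontrivial[OF R3[OF that]] by simp
    show ?thesis if "K \<in> ?S4" using rotation_reflection_4_imp_nontrivial[OF S4[OF that]] .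
    show ?thesis if "K \<in> ?D" using D2_symmetry_imp_nontrivial[OF D[OF that]] .
  qed
  have all: "triangulates (orientable_surface 2) K \<and> card (vertices K) = 10 \<and>
      polyhedral_realization K (coordinates K)" if K: "K \<in> ?C realizations" for K
  proof -
    obtain e where e: "e \<in> set realizations" "K = complex_at e" using K by blast
    obtain g where g: "realizes g e" using realizations_well_formed[OF e(1)] by blast
    have "card (vertices K) = 10"
      using vertices_well_formed[OF realizesD(1)[OF g]] by (simp add: e(2) complex_at_def)
    then show ?thesis
      using triangulates_realization[OF e(1)] realizesD(3)[OF g] coord[OF e(1)] e(2) by simp
  qed
  have noniso: "\<not> isomorphic_complexes K L" if "K \<in> ?C realizations" "L \<in> ?C realizations" "K \<noteq> L" for K L
    using that isomorphic_imp_eq by blast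
  show ?thesis
    using cards R2 R3 S4 D nontrivial all noniso
    by (intro exI[of _ ?R2] exI[of _ ?R3] exI[of _ ?S4] exI[of _ ?D] exI[of _ coordinates]) (simp add: un)
qed

end
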